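(* Let $\mathcal{G}\rightrightarrows M$ be a Lie groupoid with Lie algebroid $A$, let $F\in\Gamma(\wedge^pT\mathcal{G}\otimes\wedge^qT^*\mathcal{G})$ be a $(p,q)$-tensor and let $f=\mathrm{pr}_{\wedge^pA\otimes\wedge^qT^*M}F|_M$. Define $$F_l=F-\overleftarrow{f},\qquad F_r=F-\overrightarrow{f}.$$ Then $F$ is an affine $(p,q)$-tensor on $\mathcal{G}$ if and only if $F_l$ is a multiplicative $(p,q)$-tensor; likewise, $F$ is affine if and only if $F_r$ is a multiplicative $(p,q)$-tensor.
   Context: Conventions: $\mathcal{G}\rightrightarrows M$ has source $s$ and target $t$; $gh$ is defined iff $s(g)=t(h)$; $M\subset\mathcal{G}$ via units. $A=\ker(ds)|_M$, $T\mathcal{G}|_M=TM\oplus A$, $T^*\mathcal{G}|_M=T^*M\oplus A^*$; $\mathrm{pr}_{\wedge^pA\otimes\wedge^qT^*M}F|_M$ is the corresponding component of $F|_M$. For $u\in\Gamma(A)$, $\overrightarrow{u}(g)=dR_g(u_{t(g)})$, $\overleftarrow{u}(g)=-dL_g(d\,\mathrm{inv}(u_{s(g)}))$. The tangent groupoid $T\mathcal{G}\rightrightarrows TM$ has as structure maps the differentials of those of $\mathcal{G}$. The cotangent groupoid $T^*\mathcal{G}\rightrightarrows A^*$ has source and target of $\xi\in T_g^*\mathcal{G}$ given by $\langle s(\xi),u\rangle=\langle\xi,\overleftarrow{u}\rangle$ for $u\in A_{s(g)}$ and $\langle t(\xi),v\rangle=\langle\xi,\overrightarrow{v}\rangle$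 for $v\in A_{t(g)}$, and product $(\xi\cdot\eta)(X\cdot Y)=\xi(X)+\eta(Y)$ for composable $X,Y$ in $T\mathcal{G}$. A $(p,q)$-tensor $F$ is viewed as a function on the Lie groupoid $\Gamma:\ \oplus^qT\mathcal{G}\oplus^pT^*\mathcal{G}\rightrightarrows\oplus^qTM\oplus^pA^*$ (componentwise structure), with source and target $s_\Gamma,t_\Gamma$. A function $F$ on a Lie groupoid is affine if $F(gh)=F(g)+F(h)-F(s(g))$ for all composable $g,h$, and multiplicative if $F(gh)=F(g)+F(h)$ (equivalently, affine and zero on units). A $(p,q)$-tensor on $\mathcal{G}$ is affine (multiplicative) if it is an affine (multiplicative) function on $\Gamma$. For $f\in\Gamma(\wedge^pA\otimes\wedge^qT^*M)$, viewed as a function on $\oplus^qTM\oplus^pA^*$, $\overleftarrow{f}:=s_\Gamma^*f$ and $\overrightarrow{f}:=t_\Gamma^*f$, which are $(p,q)$-tensors on $\mathcal{G}$; for $f=u\otimes\beta$ one has $\overleftarrow f=\overleftarrow u\otimes s^*\beta$, $\overrightarrow f=\overrightarrow u\otimes t^*\beta$ (translations of $u\in\Gamma(\wedge^pA)$ being factorwise). *)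

theory Defs
  imports "HOL-Analysis.Analysis"
begin

section \<open>Smooth maps between finite-dimensional spaces\<close>

(* Class C^k on an open set, by iterated directional derivatives.  On a finite-dimensional
   space this is the usual C^k. *)
primrec Ck_on :: "nat \<Rightarrow> 'a::real_normed_vector set \<Rightarrow> ('a \<Rightarrow> 'b::real_normed_vector) \<Rightarrow> bool"
  where
    "Ck_on 0 S f \<longleftrightarrow> continuous_on S f"
  | "Ck_on (Suc k) S f \<longleftrightarrow>
      (\<forall>x\<in>S. f differentiable (at x)) \<and>
      (\<forall>v. Ck_on k S (\<lambda>x. frechet_derivative f (at x) v))"

definition smooth_on :: "'a::real_normed_vector set \<Rightarrow> ('a \<Rightarrow> 'b::real_normed_vector) \<Rightarrow> bool"
  where "smooth_on S f \<longleftrightarrow> (\<forall>k. Ck_on k S f)"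


section \<open>Manifolds\<close>

(* A chart (U, phi) has domain U; the values of phi outside U are irrelevant.  The underlying
   point set of a manifold is the whole type 'a.  The model space 'e is any finite-dimensional
   normed space: class banach, rather than euclidean_space, admits dimension 0 (needed for
   instance for Lie groups, where the manifold of objects is a point). *)
type_synonym ('a, 'e) chart = "'a set \<times> ('a \<Rightarrow> 'e)"

abbreviation chart_dom :: "('a, 'e) chart \<Rightarrow> 'a set" where "chart_dom \<equiv> fst"
abbreviation chart_map :: "('a, 'e) chart \<Rightarrow> 'a \<Rightarrow> 'e" where "chart_map \<equiv> snd"

definition chart_inv :: "('a, 'e) chart \<Rightarrow> 'e \<Rightarrow> 'a"
  where "chart_inv c = inv_into (chart_dom c) (chart_map c)"

definition charts_at :: "('a, 'e) chart set \<Rightarrow> 'a \<Rightarrow> ('a, 'e) chart set"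
  where "charts_at A p = {c \<in> A. p \<in> chart_dom c}"

definition chart_at :: "('a, 'e) chart set \<Rightarrow> 'a \<Rightarrow> ('a, 'e) chart"
  where "chart_at A p = (SOME c. c \<in> charts_at A p)"

(* The Hausdorff and countability axioms are left to the type class of the point set. *)
definition smooth_atlas :: "('a::topological_space, 'e::banach) chart set \<Rightarrow> bool"
  where "smooth_atlas A \<longleftrightarrow>
    (\<exists>B::'e set. finite B \<and> span B = UNIV) \<and>
    (\<forall>p. charts_at A p \<noteq> {}) \<and>
    (\<forall>c\<in>A. open (chart_dom c) \<and> open (chart_map c ` chart_dom c) \<and>
       homeomorphism (chart_dom c) (chart_map c ` chart_dom c) (chart_map c) (chart_inv c)) \<and>
    (\<forall>c\<in>A. \<forall>d\<in>A.
       smooth_on (chart_map c ` (chart_dom c \<inter> chart_dom d)) (chart_map d \<circ> chart_inv c))"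

(* Smoothness of f along a subset S: f agrees on S, near each point of S, with a smooth map
   defined on an open set of the manifold.  For S = UNIV this is ordinary smoothness, and for an
   embedded submanifold S it is smoothness for the submanifold structure. *)
definition smooth_map ::
    "('a::topological_space, 'e::banach) chart set \<Rightarrow> ('b::topological_space, 'f::banach) chart set
      \<Rightarrow> 'a set \<Rightarrow> ('a \<Rightarrow> 'b) \<Rightarrow> bool"
  where "smooth_map A B S f \<longleftrightarrow>
    (\<forall>p\<in>S. \<exists>c\<in>charts_at A p. \<exists>d\<in>charts_at B (f p). \<exists>W h.
       open W \<and> p \<in> W \<and> W \<subseteq> chart_dom c \<and> smooth_on (chart_map c ` W) h \<and>
       (\<forall>x\<in>W \<inter> S. f x \<in> chart_dom d \<and> h (chart_map c x) = chart_map d (f x)))"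

definition prod_chart :: "('a, 'e) chart \<Rightarrow> ('b, 'f) chart \<Rightarrow> ('a \<times> 'b, 'e \<times> 'f) chart"
  where "prod_chart c d =
    (chart_dom c \<times> chart_dom d, \<lambda>(x, y). (chart_map c x, chart_map d y))"

definition prod_atlas ::
    "('a, 'e) chart set \<Rightarrow> ('b, 'f) chart set \<Rightarrow> ('a \<times> 'b, 'e \<times> 'f) chart set"
  where "prod_atlas A B = {prod_chart c d |c d. c \<in> A \<and> d \<in> B}"


section \<open>Tangent and cotangent spaces\<close>

(* A tangent vector at p is the family of its coordinate vectors in the charts around p,
   transforming under changes of charts by the derivative of the transition map (and set to 0 at
   all other charts).  Vector space operations are pointwise.  Since the vectors at different
   points are not disjoint, elements of a tangent bundle are written as pairs (point, vector). *)
type_synonym ('a, 'e) tvec = "('a, 'e) chart \<Rightarrow> 'e"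

definition tangent_space :: "('a, 'e::real_normed_vector) chart set \<Rightarrow> 'a \<Rightarrow> ('a, 'e) tvec set"
  where "tangent_space A p = {v.
    (\<forall>c. c \<notin> charts_at A p \<longrightarrow> v c = 0) \<and>
    (\<forall>c\<in>charts_at A p. \<forall>d\<in>charts_at A p.
       v d = frechet_derivative (chart_map d \<circ> chart_inv c) (at (chart_map c p)) (v c))}"

(* The differential at p of a map f that is smooth along S, applied to a vector v tangent to S.
   For S = UNIV this is the ordinary differential.  For a proper submanifold S the derivative
   within S is not unique as a linear map, but its value on vectors tangent to S is. *)
definition mdiff ::
    "('a, 'e::real_normed_vector) chart set \<Rightarrow> ('b, 'f::real_normed_vector) chart set
      \<Rightarrow> 'a set \<Rightarrow> ('a \<Rightarrow> 'b) \<Rightarrow> 'a \<Rightarrow> ('a, 'e) tvec \<Rightarrow> ('b, 'f) tvec"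
  where "mdiff A B S f p v =
    (let c = chart_at A p in
     (\<lambda>d. if d \<in> charts_at B (f p)
         then frechet_derivative (chart_map d \<circ> f \<circ> chart_inv c)
                (at (chart_map c p) within chart_map c ` (S \<inter> chart_dom c)) (v c)
         else 0))"

(* The identification of T_p x T_q with the tangent space at (p, q) of the product; note that
   prod_chart is injective on charts with non-empty domain. *)
definition tan_pair ::
    "('a, 'e::real_normed_vector) chart set \<Rightarrow> ('b, 'f::real_normed_vector) chart set
      \<Rightarrow> 'a \<Rightarrow> 'b \<Rightarrow> ('a, 'e) tvec \<Rightarrow> ('b, 'f) tvec \<Rightarrow> ('a \<times> 'b, 'e \<times> 'f) tvec"
  where "tan_pair A B p q v w = (\<lambda>e.
    if e \<in> charts_at (prod_atlas A B) (p, q)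
    then (THE z. \<exists>c\<in>charts_at A p. \<exists>d\<in>charts_at B q. e = prod_chart c d \<and> z = (v c, w d))
    else 0)"

definition submersion ::
    "('a::topological_space, 'e::banach) chart set \<Rightarrow> ('b::topological_space, 'f::banach) chart set
      \<Rightarrow> ('a \<Rightarrow> 'b) \<Rightarrow> bool"
  where "submersion A B f \<longleftrightarrow>
    smooth_map A B UNIV f \<and>
    (\<forall>p. mdiff A B UNIV f p ` tangent_space A p = tangent_space B (f p))"

definition lin_on :: "('i \<Rightarrow> 'v::real_vector) set \<Rightarrow> (('i \<Rightarrow> 'v) \<Rightarrow> real) \<Rightarrow> bool"
  where "lin_on V L \<longleftrightarrow> (\<forall>v\<in>V. \<forall>w\<in>V. \<forall>a b.
    L (\<lambda>i. a *\<^sub>R v i + b *\<^sub>R w i) = a * L v + b * L w)"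

(* Linear forms on a space V of vectors, extended by 0 outside V so that forms which agree on V
   are equal. *)
definition dual_space :: "('i \<Rightarrow> 'v::real_vector) set \<Rightarrow> (('i \<Rightarrow> 'v) \<Rightarrow> real) set"
  where "dual_space V = {\<xi>. lin_on V \<xi> \<and> (\<forall>v. v \<notin> V \<longrightarrow> \<xi> v = 0)}"

type_synonym ('a, 'e) covec = "('a, 'e) tvec \<Rightarrow> real"

abbreviation cotangent_space ::
    "('a, 'e::real_normed_vector) chart set \<Rightarrow> 'a \<Rightarrow> ('a, 'e) covec set"
  where "cotangent_space A p \<equiv> dual_space (tangent_space A p)"

(* The tangent vector at p, and the covector at p, with given coordinates in the chart c. *)
definition coord_vec ::
    "('a, 'e::real_normed_vector) chart set \<Rightarrow> ('a, 'e) chart \<Rightarrow> 'a \<Rightarrow> 'e \<Rightarrow> ('a, 'e) tvec"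
  where "coord_vec A c p x = (\<lambda>d.
    if d \<in> charts_at A p
    then frechet_derivative (chart_map d \<circ> chart_inv c) (at (chart_map c p)) x else 0)"

definition coord_covec ::
    "('a, 'e::real_normed_vector) chart set \<Rightarrow> ('a, 'e) chart \<Rightarrow> 'a \<Rightarrow> ('e \<Rightarrow> real)
      \<Rightarrow> ('a, 'e) covec"
  where "coord_covec A c p l = (\<lambda>v. if v \<in> tangent_space A p then l (v c) else 0)"


section \<open>Groupoids and functions on them\<close>

(* cmp g h is the product gh, defined when src g = tgt h. *)
record ('g, 'm) groupoid =
  arr :: "'g set"
  obj :: "'m set"
  src :: "'g \<Rightarrow> 'm"
  tgt :: "'g \<Rightarrow> 'm"
  cmp :: "'g \<Rightarrow> 'g \<Rightarrow> 'g"
  unt :: "'m \<Rightarrow> 'g"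

definition affine_fun :: "('g, 'm, 'z) groupoid_scheme \<Rightarrow> ('g \<Rightarrow> real) \<Rightarrow> bool"
  where "affine_fun G F \<longleftrightarrow> (\<forall>g\<in>arr G. \<forall>h\<in>arr G. src G g = tgt G h \<longrightarrow>
    F (cmp G g h) = F g + F h - F (unt G (src G g)))"

definition multiplicative_fun :: "('g, 'm, 'z) groupoid_scheme \<Rightarrow> ('g \<Rightarrow> real) \<Rightarrow> bool"
  where "multiplicative_fun G F \<longleftrightarrow> (\<forall>g\<in>arr G. \<forall>h\<in>arr G. src G g = tgt G h \<longrightarrow>
    F (cmp G g h) = F g + F h)"


section \<open>Lie groupoids\<close>

record ('g, 'm, 'e, 'n) lie_groupoid = "('g, 'm) groupoid" +
  ginv :: "'g \<Rightarrow> 'g"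
  garr :: "('g, 'e) chart set"
  gobj :: "('m, 'n) chart set"

definition composable :: "('g, 'm, 'e, 'n) lie_groupoid \<Rightarrow> ('g \<times> 'g) set"
  where "composable G = {(g, h). src G g = tgt G h}"

(* The manifold of objects is Hausdorff and second countable by its type class; as is common for
   Lie groupoids, neither is required of the manifold of arrows.  Since the source is a
   submersion, the set of composable pairs is an embedded submanifold of the product. *)
definition is_lie_groupoid ::
    "('g::topological_space, 'm::{t2_space, second_countable_topology}, 'e::banach, 'n::banach)
      lie_groupoid \<Rightarrow> bool"
  where "is_lie_groupoid G \<longleftrightarrow>
    arr G = UNIV \<and> obj G = UNIV \<and>
    (\<forall>x. src G (unt G x) = x \<and> tgt G (unt G x) = x) \<and>
    (\<forall>g h. src G g = tgt G h \<longrightarrow>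
       src G (cmp G g h) = src G h \<and> tgt G (cmp G g h) = tgt G g) \<and>
    (\<forall>g h k. src G g = tgt G h \<and> src G h = tgt G k \<longrightarrow>
       cmp G (cmp G g h) k = cmp G g (cmp G h k)) \<and>
    (\<forall>g. cmp G (unt G (tgt G g)) g = g \<and> cmp G g (unt G (src G g)) = g) \<and>
    (\<forall>g. src G (ginv G g) = tgt G g \<and> tgt G (ginv G g) = src G g \<and>
       cmp G g (ginv G g) = unt G (tgt G g) \<and> cmp G (ginv G g) g = unt G (src G g)) \<and>
    smooth_atlas (garr G) \<and> smooth_atlas (gobj G) \<and>
    submersion (garr G) (gobj G) (src G) \<and> submersion (garr G) (gobj G) (tgt G) \<and>
    smooth_map (gobj G) (garr G) UNIV (unt G) \<and>
    smooth_map (garr G) (garr G) UNIV (ginv G) \<and>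
    smooth_map (prod_atlas (garr G) (garr G)) (garr G) (composable G) (\<lambda>(g, h). cmp G g h)"

context
  fixes G :: "('g, 'm, 'e::real_normed_vector, 'n::real_normed_vector) lie_groupoid"
begin

definition TG :: "'g \<Rightarrow> ('g, 'e) tvec set" where "TG = tangent_space (garr G)"
definition TM :: "'m \<Rightarrow> ('m, 'n) tvec set" where "TM = tangent_space (gobj G)"

definition d_src :: "'g \<Rightarrow> ('g, 'e) tvec \<Rightarrow> ('m, 'n) tvec"
  where "d_src = mdiff (garr G) (gobj G) UNIV (src G)"
definition d_tgt :: "'g \<Rightarrow> ('g, 'e) tvec \<Rightarrow> ('m, 'n) tvec"
  where "d_tgt = mdiff (garr G) (gobj G) UNIV (tgt G)"
definition d_unt :: "'m \<Rightarrow> ('m, 'n) tvec \<Rightarrow> ('g, 'e) tvec"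
  where "d_unt = mdiff (gobj G) (garr G) UNIV (unt G)"
definition d_inv :: "'g \<Rightarrow> ('g, 'e) tvec \<Rightarrow> ('g, 'e) tvec"
  where "d_inv = mdiff (garr G) (garr G) UNIV (ginv G)"

definition d_cmp :: "'g \<Rightarrow> 'g \<Rightarrow> ('g, 'e) tvec \<Rightarrow> ('g, 'e) tvec \<Rightarrow> ('g, 'e) tvec"
  where "d_cmp g h X Y =
    mdiff (prod_atlas (garr G) (garr G)) (garr G) (composable G) (\<lambda>(g, h). cmp G g h) (g, h)
      (tan_pair (garr G) (garr G) g h X Y)"

definition tangent_groupoid :: "('g \<times> ('g, 'e) tvec, 'm \<times> ('m, 'n) tvec) groupoid"
  where "tangent_groupoid = \<lparr>
    arr = {(g, X). X \<in> TG g},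
    obj = {(x, Y). Y \<in> TM x},
    src = (\<lambda>(g, X). (src G g, d_src g X)),
    tgt = (\<lambda>(g, X). (tgt G g, d_tgt g X)),
    cmp = (\<lambda>(g, X) (h, Y). (cmp G g h, d_cmp g h X Y)),
    unt = (\<lambda>(x, Y). (unt G x, d_unt x Y))\<rparr>"

(* The fibre at x of the Lie algebroid, and the projection onto it in T_xG = T_xM + A_x. *)
definition algd :: "'m \<Rightarrow> ('g, 'e) tvec set"
  where "algd x = {u \<in> TG (unt G x). d_src (unt G x) u = (\<lambda>c. 0)}"

definition pr_algd :: "'m \<Rightarrow> ('g, 'e) tvec \<Rightarrow> ('g, 'e) tvec"
  where "pr_algd x V = (\<lambda>c. V c - d_unt x (d_src (unt G x) V) c)"

(* Translations of u in A_{t(g)}, respectively A_{s(g)}; right multiplication by g is defined on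
   the source fibre over t(g) and left multiplication by g on the target fibre over s(g). *)
definition right_vec :: "'g \<Rightarrow> ('g, 'e) tvec \<Rightarrow> ('g, 'e) tvec"
  where "right_vec g u =
    mdiff (garr G) (garr G) {a. src G a = tgt G g} (\<lambda>a. cmp G a g) (unt G (tgt G g)) u"

definition left_vec :: "'g \<Rightarrow> ('g, 'e) tvec \<Rightarrow> ('g, 'e) tvec"
  where "left_vec g u = (\<lambda>c. -
    mdiff (garr G) (garr G) {a. tgt G a = src G g} (\<lambda>a. cmp G g a) (unt G (src G g))
      (d_inv (unt G (src G g)) u) c)"

definition cot_src :: "'g \<Rightarrow> ('g, 'e) covec \<Rightarrow> ('g, 'e) covec"
  where "cot_src g \<xi> = (\<lambda>u. if u \<in> algd (src G g) then \<xi> (left_vec g u) else 0)"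

definition cot_tgt :: "'g \<Rightarrow> ('g, 'e) covec \<Rightarrow> ('g, 'e) covec"
  where "cot_tgt g \<xi> = (\<lambda>u. if u \<in> algd (tgt G g) then \<xi> (right_vec g u) else 0)"

definition cot_cmp :: "'g \<Rightarrow> 'g \<Rightarrow> ('g, 'e) covec \<Rightarrow> ('g, 'e) covec \<Rightarrow> ('g, 'e) covec"
  where "cot_cmp g h \<xi> \<eta> = (THE \<zeta>. \<zeta> \<in> dual_space (TG (cmp G g h)) \<and>
    (\<forall>X\<in>TG g. \<forall>Y\<in>TG h. d_src g X = d_tgt h Y \<longrightarrow> \<zeta> (d_cmp g h X Y) = \<xi> X + \<eta> Y))"

(* The inclusion of A* in T*G along M, from T*G = T*M + A*: the form alpha on A is extended by
   zero on TM.  This is the unit map of the cotangent groupoid. *)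
definition cot_unt :: "'m \<Rightarrow> ('g, 'e) covec \<Rightarrow> ('g, 'e) covec"
  where "cot_unt x \<alpha> = (\<lambda>V. if V \<in> TG (unt G x) then \<alpha> (pr_algd x V) else 0)"

definition cotangent_groupoid :: "('g \<times> ('g, 'e) covec, 'm \<times> ('g, 'e) covec) groupoid"
  where "cotangent_groupoid = \<lparr>
    arr = {(g, \<xi>). \<xi> \<in> dual_space (TG g)},
    obj = {(x, \<alpha>). \<alpha> \<in> dual_space (algd x)},
    src = (\<lambda>(g, \<xi>). (src G g, cot_src g \<xi>)),
    tgt = (\<lambda>(g, \<xi>). (tgt G g, cot_tgt g \<xi>)),
    cmp = (\<lambda>(g, \<xi>) (h, \<eta>). (cmp G g h, cot_cmp g h \<xi> \<eta>)),
    unt = (\<lambda>(x, \<alpha>). (unt G x, cot_unt x \<alpha>))\<rparr>"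

end


section \<open>Affine and multiplicative tensors\<close>

(* An element of the Whitney sum of q copies of TG and p copies of T*G is a base point with a
   list of q vectors and a list of p covectors; similarly over M. *)
type_synonym ('g, 'e) tensor_arr = "'g \<times> ('g, 'e) tvec list \<times> ('g, 'e) covec list"
type_synonym ('g, 'm, 'e, 'n) tensor_obj = "'m \<times> ('m, 'n) tvec list \<times> ('g, 'e) covec list"

definition tensor_groupoid ::
    "('g, 'm, 'e::real_normed_vector, 'n::real_normed_vector) lie_groupoid \<Rightarrow> nat \<Rightarrow> nat
      \<Rightarrow> (('g, 'e) tensor_arr, ('g, 'm, 'e, 'n) tensor_obj) groupoid"
  where "tensor_groupoid G p q =
    (let T = tangent_groupoid G; C = cotangent_groupoid G in \<lparr>
     arr = {(g, Xs, \<xi>s). length Xs = q \<and> length \<xi>s = p \<and>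
       (\<forall>X\<in>set Xs. (g, X) \<in> arr T) \<and> (\<forall>\<xi>\<in>set \<xi>s. (g, \<xi>) \<in> arr C)},
     obj = {(x, Ys, \<alpha>s). length Ys = q \<and> length \<alpha>s = p \<and>
       (\<forall>Y\<in>set Ys. (x, Y) \<in> obj T) \<and> (\<forall>\<alpha>\<in>set \<alpha>s. (x, \<alpha>) \<in> obj C)},
     src = (\<lambda>(g, Xs, \<xi>s).
       (src G g, map (\<lambda>X. snd (src T (g, X))) Xs, map (\<lambda>\<xi>. snd (src C (g, \<xi>))) \<xi>s)),
     tgt = (\<lambda>(g, Xs, \<xi>s).
       (tgt G g, map (\<lambda>X. snd (tgt T (g, X))) Xs, map (\<lambda>\<xi>. snd (tgt C (g, \<xi>))) \<xi>s)),
     cmp = (\<lambda>(g, Xs, \<xi>s) (h, Ys, \<eta>s).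
       (cmp G g h, map2 (\<lambda>X Y. snd (cmp T (g, X) (h, Y))) Xs Ys,
        map2 (\<lambda>\<xi> \<eta>. snd (cmp C (g, \<xi>) (h, \<eta>))) \<xi>s \<eta>s)),
     unt = (\<lambda>(x, Ys, \<alpha>s).
       (unt G x, map (\<lambda>Y. snd (unt T (x, Y))) Ys, map (\<lambda>\<alpha>. snd (unt C (x, \<alpha>))) \<alpha>s))\<rparr>)"

definition alternating_multilinear ::
    "('i \<Rightarrow> 'v::real_vector) set \<Rightarrow> nat \<Rightarrow> (('i \<Rightarrow> 'v) list \<Rightarrow> real) \<Rightarrow> bool"
  where "alternating_multilinear V k L \<longleftrightarrow>
    (\<forall>vs i. length vs = k \<and> set vs \<subseteq> V \<and> i < k \<longrightarrow> lin_on V (\<lambda>v. L (vs[i := v]))) \<and>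
    (\<forall>vs i j. length vs = k \<and> set vs \<subseteq> V \<and> i < j \<and> j < k \<and> vs ! i = vs ! j \<longrightarrow> L vs = 0)"

(* A smooth section of the bundle of alternating p-vectors tensor alternating q-forms on the
   manifold with atlas A, as a function on q vectors and p covectors: alternating and multilinear
   in either group of arguments, with smooth components in every chart. *)
definition tensor_field ::
    "('a, 'e::real_normed_vector) chart set \<Rightarrow> nat \<Rightarrow> nat \<Rightarrow> (('a, 'e) tensor_arr \<Rightarrow> real) \<Rightarrow> bool"
  where "tensor_field A p q F \<longleftrightarrow>
    (\<forall>g \<xi>s. length \<xi>s = p \<and> set \<xi>s \<subseteq> cotangent_space A g \<longrightarrow>
       alternating_multilinear (tangent_space A g) q (\<lambda>Xs. F (g, Xs, \<xi>s))) \<and>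
    (\<forall>g Xs. length Xs = q \<and> set Xs \<subseteq> tangent_space A g \<longrightarrow>
       alternating_multilinear (cotangent_space A g) p (\<lambda>\<xi>s. F (g, Xs, \<xi>s))) \<and>
    (\<forall>c\<in>A. \<forall>xs ls. length xs = q \<and> length ls = p \<and> (\<forall>l\<in>set ls. linear l) \<longrightarrow>
       smooth_on (chart_map c ` chart_dom c)
         (\<lambda>y. let g = chart_inv c y in
              F (g, map (coord_vec A c g) xs, map (coord_covec A c g) ls)))"

definition affine_tensor ::
    "('g, 'm, 'e::real_normed_vector, 'n::real_normed_vector) lie_groupoid \<Rightarrow> nat \<Rightarrow> nat
      \<Rightarrow> (('g, 'e) tensor_arr \<Rightarrow> real) \<Rightarrow> bool"
  where "affine_tensor G p q F \<longleftrightarrow>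
    tensor_field (garr G) p q F \<and> affine_fun (tensor_groupoid G p q) F"

definition multiplicative_tensor ::
    "('g, 'm, 'e::real_normed_vector, 'n::real_normed_vector) lie_groupoid \<Rightarrow> nat \<Rightarrow> nat
      \<Rightarrow> (('g, 'e) tensor_arr \<Rightarrow> real) \<Rightarrow> bool"
  where "multiplicative_tensor G p q F \<longleftrightarrow>
    tensor_field (garr G) p q F \<and> multiplicative_fun (tensor_groupoid G p q) F"

(* The component along M of F in (p-vectors of A) tensor (q-forms on M), as a function on q vectors
   of TM and p covectors of A*: the restriction of F along TM < TG and A* < T*G. *)
definition base_component ::
    "('g, 'm, 'e::real_normed_vector, 'n::real_normed_vector) lie_groupoid
      \<Rightarrow> (('g, 'e) tensor_arr \<Rightarrow> real) \<Rightarrow> ('g, 'm, 'e, 'n) tensor_obj \<Rightarrow> real"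
  where "base_component G F =
    (\<lambda>(x, Ys, \<alpha>s). F (unt G x, map (d_unt G x) Ys, map (cot_unt G x) \<alpha>s))"

definition left_tensor ::
    "('g, 'm, 'e::real_normed_vector, 'n::real_normed_vector) lie_groupoid \<Rightarrow> nat \<Rightarrow> nat
      \<Rightarrow> (('g, 'm, 'e, 'n) tensor_obj \<Rightarrow> real) \<Rightarrow> ('g, 'e) tensor_arr \<Rightarrow> real"
  where "left_tensor G p q f = f \<circ> src (tensor_groupoid G p q)"

definition right_tensor ::
    "('g, 'm, 'e::real_normed_vector, 'n::real_normed_vector) lie_groupoid \<Rightarrow> nat \<Rightarrow> nat
      \<Rightarrow> (('g, 'm, 'e, 'n) tensor_obj \<Rightarrow> real) \<Rightarrow> ('g, 'e) tensor_arr \<Rightarrow> real"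
  where "right_tensor G p q f = f \<circ> tgt (tensor_groupoid G p q)"

end

theory Submission
  imports Defs
begin

text \<open>
  Let \<open>\<Gamma>\<close> be the groupoid on which \<open>(p, q)\<close>-tensors are functions.  The tensor \<open>f\<close> is the restriction
  of \<open>F\<close> to the units of \<open>\<Gamma>\<close>, so that \<open>F\<^sub>l = F - F \<circ> \<epsilon> \<circ> s\<close> and \<open>F\<^sub>r = F - F \<circ> \<epsilon> \<circ> t\<close>.  Since a product
  has the source of its right factor and the target of its left factor, the defect of \<open>F\<close> from being
  affine equals the defect of \<open>F\<^sub>l\<close>, and that of \<open>F\<^sub>r\<close>, from being multiplicative
  (\<open>affine_fun_iff_multiplicative_fun_src\<close> and \<open>affine_fun_iff_multiplicative_fun_tgt\<close>).  This leaves two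
  facts about \<open>\<Gamma>\<close>.

  Sources and targets of products (\<open>src_tensor_cmp\<close>, \<open>tgt_tensor_cmp\<close>).  On tangent vectors they are
  identities between differentials.  Each of them is proved by moving along curves: a composable
  pair of tangent vectors is the velocity of a curve of composable pairs of arrows (\<open>curve_lift\<close>, by
  the contraction principle, since the source is a submersion), the smooth structure maps carry
  velocities to velocities (\<open>has_velocity_mdiff\<close>), and velocities are unique.  On covectors the product is
  given by a description that has to be shown to determine one covector; this holds because the product of
  tangent vectors is onto and its kernel consists of the pairs of minus the left and the right
  translate of one element of the Lie algebroid (\<open>d_cmp_surj\<close>, \<open>d_cmp_kernel\<close>, \<open>cot_cmp_characterization\<close>).

  Smoothness of the translates of \<open>f\<close> (\<open>tensor_field_translate\<close>).  They arise from \<open>F\<close> by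
  \<open>X \<mapsto> d\<epsilon> (ds X)\<close> on vectors and by the transpose of \<open>V \<mapsto> left translate of the algebroid part of V\<close> on
  covectors, or by the analogous maps for the target.  Both maps are built from differentials of the
  structure maps, which send smooth families of tangent vectors to smooth families
  (\<open>smooth_family_mdiff\<close>), and a tensor field is smooth on smooth families (\<open>smooth_at_tensor_field_families\<close>).
\<close>

section \<open>Coordinates on finite-dimensional normed spaces\<close>

text \<open>
  A finite spanning family with bounded coordinate functionals.  This form also covers dimension 0
  and any norm, and it is all that the calculus below uses of finite dimension.
\<close>

definition coordinate_system :: "'e::real_normed_vector set \<Rightarrow> ('e \<Rightarrow> 'e \<Rightarrow> real) \<Rightarrow> bool"
  where "coordinate_system B \<kappa> \<longleftrightarrow>
    finite B \<and> (\<forall>b. bounded_linear (\<kappa> b)) \<and> (\<forall>v. v = (\<Sum>b\<in>B. \<kappa> b v *\<^sub>R b))"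

text \<open>
  Induction on the basis: the bound makes \<open>span B\<close> closed, because the coefficients of a convergent
  sequence in it converge, so a vector \<open>x\<close> outside has positive distance \<open>\<delta>\<close> from it, and \<open>\<delta>\<close> bounds the
  coefficient of \<open>x\<close>.
\<close>
lemma independent_coefficient_bound:
  fixes B :: "'e::real_normed_vector set"
  assumes "finite B" "independent B"
  shows "\<exists>C>0. \<forall>a. (\<Sum>b\<in>B. \<bar>a b\<bar>) \<le> C * norm (\<Sum>b\<in>B. a b *\<^sub>R b)"
  using assms
proof (induction B rule: finite_induct)
  case empty
  show ?case by (intro exI[of _ 1]) auto
next
  case (insert x B)
  have indB: "independent B" and xB: "x \<notin> span B"
    using insert by (auto simp: independent_insert)
  then obtain C where C: "C > 0" "\<And>a. (\<Sum>b\<in>B. \<bar>a b\<bar>) \<le> C * norm (\<Sum>b\<in>B. a b *\<^sub>R b)"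
    using insert.IH by blast
  have "\<exists>\<delta>>0. \<forall>v\<in>span B. \<delta> \<le> norm (x - v)"
  proof (rule ccontr)
    assume "\<not> ?thesis"
    then have "\<forall>n::nat. \<exists>v\<in>span B. norm (x - v) < inverse (real (Suc n))"
      by (metis inverse_positive_iff_positive not_le of_nat_0_less_iff zero_less_Suc)
    then obtain v where v: "\<And>n. v n \<in> span B" "\<And>n. norm (x - v n) < inverse (real (Suc n))"
      by metis
    have lim: "v \<longlonglongrightarrow> x"
    proof -
      have "(\<lambda>n. x - v n) \<longlonglongrightarrow> 0"
        by (rule Lim_null_comparison[OF _ LIMSEQ_inverse_real_of_nat])
          (use v(2) less_imp_le in \<open>blast intro: always_eventually\<close>)
      then have "(\<lambda>n. x - (x - v n)) \<longlonglongrightarrow> x - 0" by (intro tendsto_intros)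
      then show ?thesis by simp
    qed
    have "\<forall>n. \<exists>a. v n = (\<Sum>b\<in>B. a b *\<^sub>R b)"
      using v(1) insert.hyps(1) by (auto simp: span_finite)
    then obtain a where a: "\<And>n. v n = (\<Sum>b\<in>B. a n b *\<^sub>R b)" by metis
    have conv: "\<exists>l. (\<lambda>n. a n b) \<longlonglongrightarrow> l" if b: "b \<in> B" for b
    proof -
      have "Cauchy (\<lambda>n. a n b)"
      proof (rule metric_CauchyI)
        fix e :: real assume e: "e > 0"
        then have "e / C > 0" using C by simp
        then obtain M where M: "\<And>m n. m \<ge> M \<Longrightarrow> n \<ge> M \<Longrightarrow> dist (v m) (v n) < e / C"
          using lim[THEN LIMSEQ_imp_Cauchy] unfolding Cauchy_def by metis
        show "\<exists>M. \<forall>m\<ge>M. \<forall>n\<ge>M. dist (a m b) (a n b) < e"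
        proof (intro exI allI impI)
          fix m n assume mn: "m \<ge> M" "n \<ge> M"
          have "dist (a m b) (a n b) \<le> (\<Sum>b\<in>B. \<bar>a m b - a n b\<bar>)"
            unfolding dist_real_def using b insert.hyps(1) by (intro member_le_sum) auto
          also have "\<dots> \<le> C * norm (\<Sum>b\<in>B. (a m b - a n b) *\<^sub>R b)" by (rule C(2))
          also have "(\<Sum>b\<in>B. (a m b - a n b) *\<^sub>R b) = v m - v n"
            by (simp add: a scaleR_diff_left sum_subtractf)
          also have "C * norm (v m - v n) < C * (e / C)"
            using M[OF mn] C(1) by (intro mult_strict_left_mono) (auto simp: dist_norm)
          finally show "dist (a m b) (a n b) < e" using C by simp
        qed
      qed
      then show ?thesis by (simp add: Cauchy_convergent_iff convergent_def)
    qed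
    then obtain l where l: "\<And>b. b \<in> B \<Longrightarrow> (\<lambda>n. a n b) \<longlonglongrightarrow> l b" by metis
    have "v \<longlonglongrightarrow> (\<Sum>b\<in>B. l b *\<^sub>R b)"
      unfolding a by (intro tendsto_intros l)
    then have "x = (\<Sum>b\<in>B. l b *\<^sub>R b)" using lim LIMSEQ_unique by blast
    moreover have "(\<Sum>b\<in>B. l b *\<^sub>R b) \<in> span B" by (intro span_sum span_scale span_base)
    ultimately show False using xB by simp
  qed
  then obtain \<delta> where \<delta>: "\<delta> > 0" "\<And>v. v \<in> span B \<Longrightarrow> \<delta> \<le> norm (x - v)" by blast
  \<comment> \<open>The first summand bounds the coefficient of \<open>x\<close>, the second the coefficients of the rest \<open>w - a x *\<^sub>R x\<close>.\<close>
  define D where "D = 1 / \<delta> + C * (1 + norm x / \<delta>)"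
  show ?case
  proof (intro exI[of _ D] conjI allI)
    show "D > 0" unfolding D_def using \<delta>(1) C(1)
      by (intro add_pos_nonneg mult_nonneg_nonneg) auto
    fix a :: "'e \<Rightarrow> real"
    define v where "v = (\<Sum>b\<in>B. a b *\<^sub>R b)"
    define w where "w = a x *\<^sub>R x + v"
    have vs: "v \<in> span B" unfolding v_def by (intro span_sum span_scale span_base)
    have ax: "\<bar>a x\<bar> \<le> norm w / \<delta>"
    proof (cases "a x = 0")
      case False
      have "w = a x *\<^sub>R (x - (- (1 / a x)) *\<^sub>R v)"
        using False by (simp add: w_def algebra_simps)
      then have "norm w = \<bar>a x\<bar> * norm (x - (- (1 / a x)) *\<^sub>R v)" by (metis norm_scaleR)
      moreover have "\<delta> \<le> norm (x - (- (1 / a x)) *\<^sub>R v)" by (intro \<delta>(2) span_scale vs)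
      ultimately have "\<bar>a x\<bar> * \<delta> \<le> norm w" by (simp add: mult_left_mono)
      then show ?thesis using \<delta>(1) by (simp add: field_simps)
    qed (use \<delta> in auto)
    have "norm v \<le> norm w + \<bar>a x\<bar> * norm x"
      using norm_triangle_ineq4[of w "a x *\<^sub>R x"] by (simp add: w_def)
    also have "\<dots> \<le> norm w + norm w / \<delta> * norm x"
      using ax by (intro add_left_mono mult_right_mono) auto
    finally have nv: "norm v \<le> norm w * (1 + norm x / \<delta>)" by (simp add: algebra_simps)
    have "(\<Sum>b\<in>insert x B. \<bar>a b\<bar>) = \<bar>a x\<bar> + (\<Sum>b\<in>B. \<bar>a b\<bar>)"
      using insert.hyps by simp
    also have "\<dots> \<le> norm w / \<delta> + C * norm v"
      using ax C(2)[of a] by (intro add_mono) (auto simp: v_def)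
    also have "\<dots> \<le> norm w / \<delta> + C * (norm w * (1 + norm x / \<delta>))"
      using nv C(1) by (intro add_left_mono mult_left_mono) auto
    also have "\<dots> = D * norm w" by (simp add: D_def algebra_simps)
    finally show "(\<Sum>b\<in>insert x B. \<bar>a b\<bar>) \<le> D * norm (\<Sum>b\<in>insert x B. a b *\<^sub>R b)"
      using insert.hyps by (simp add: w_def v_def)
  qed
qed

lemma coordinate_system_exists:
  fixes B0 :: "'e::real_normed_vector set"
  assumes "finite B0" "span B0 = UNIV"
  obtains B :: "'e set" and \<kappa> where "coordinate_system B \<kappa>"
proof -
  obtain B where B: "B \<subseteq> B0" "independent B" "B0 \<subseteq> span B"
    using maximal_independent_subset[of B0] by blast
  have fin: "finite B" using B(1) assms(1) finite_subset by blast
  have sp: "span B = UNIV" using B(3) assms(2) span_minimal[OF B(3) subspace_span] by auto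
  define \<kappa> where "\<kappa> b v = representation B v b" for b v
  have rep: "(\<Sum>b\<in>B. \<kappa> b v *\<^sub>R b) = v" for v
    unfolding \<kappa>_def using sum_representation_eq[OF B(2) _ fin order_refl, of v] sp by auto
  obtain C where C: "C > 0" "\<And>a. (\<Sum>b\<in>B. \<bar>a b\<bar>) \<le> C * norm (\<Sum>b\<in>B. a b *\<^sub>R b)"
    using independent_coefficient_bound[OF fin B(2)] by blast
  have "bounded_linear (\<kappa> b)" for b
  proof (rule bounded_linear_intro[where K=C])
    show "\<kappa> b (x + y) = \<kappa> b x + \<kappa> b y" "\<kappa> b (r *\<^sub>R x) = r *\<^sub>R \<kappa> b x" for x y r
      using B(2) sp by (simp_all add: \<kappa>_def representation_add representation_scale)
    fix x show "norm (\<kappa> b x) \<le> norm x * C"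
    proof (cases "b \<in> B")
      case True
      have "norm (\<kappa> b x) \<le> (\<Sum>b\<in>B. \<bar>\<kappa> b x\<bar>)"
        using True fin member_le_sum[of b B "\<lambda>b. \<bar>\<kappa> b x\<bar>"] by simp
      also have "\<dots> \<le> C * norm x" using C(2)[of "\<lambda>b. \<kappa> b x"] by (simp add: rep)
      finally show ?thesis by (simp add: mult.commute)
    next
      case False
      then have "\<kappa> b x = 0"
        unfolding \<kappa>_def using representation_ne_zero by blast
      then show ?thesis using C(1) by simp
    qed
  qed
  then have "coordinate_system B \<kappa>" using fin rep by (simp add: coordinate_system_def)
  then show ?thesis by (rule that)
qed

lemma linear_coordinates:
  fixes f :: "'e::real_normed_vector \<Rightarrow> 'f::real_vector"
  assumes "coordinate_system (B :: 'e set) \<kappa>" "linear f"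
  shows "f v = (\<Sum>b\<in>B. \<kappa> b v *\<^sub>R f b)"
proof -
  have "f v = f (\<Sum>b\<in>B. \<kappa> b v *\<^sub>R b)"
    using assms(1) unfolding coordinate_system_def by metis
  also have "\<dots> = (\<Sum>b\<in>B. \<kappa> b v *\<^sub>R f b)"
    using assms(2) by (simp add: linear_sum linear_scale)
  finally show ?thesis .
qed

lemma linear_imp_bounded_linear_coordinates:
  fixes f :: "'e::real_normed_vector \<Rightarrow> 'f::real_normed_vector"
  assumes "coordinate_system (B :: 'e set) \<kappa>" "linear f"
  shows "bounded_linear f"
proof -
  have "bounded_linear (\<lambda>v. \<Sum>b\<in>B. \<kappa> b v *\<^sub>R f b)"
    using assms(1) unfolding coordinate_system_def
    by (intro bounded_linear_sum bounded_linear_scaleR_const) auto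
  then show ?thesis by (simp add: linear_coordinates[OF assms, symmetric])
qed


section \<open>Smooth maps and their germs\<close>

lemma Ck_on_differentiable:
  "Ck_on (Suc k) S f \<Longrightarrow> x \<in> S \<Longrightarrow> (f has_derivative frechet_derivative f (at x)) (at x)"
  by (simp add: frechet_derivative_works)

lemma Ck_on_Suc_imp: "Ck_on (Suc k) S f \<Longrightarrow> Ck_on k S f"
proof (induction k arbitrary: f)
  case 0
  then show ?case
    by (auto intro!: continuous_at_imp_continuous_on differentiable_imp_continuous_within)
qed auto

lemma Ck_on_cong:
  assumes "open S" "\<And>x. x \<in> S \<Longrightarrow> f x = g x"
  shows "Ck_on k S f \<longleftrightarrow> Ck_on k S g"
proof -
  have imp: "Ck_on k S g" if "Ck_on k S f" "\<And>x. x \<in> S \<Longrightarrow> f x = g x"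
    for f g :: "'a \<Rightarrow> 'b" and k
    using that
  proof (induction k arbitrary: f g)
    case 0
    then show ?case by (simp cong: continuous_on_cong)
  next
    case (Suc k)
    have D: "(g has_derivative frechet_derivative f (at x)) (at x)" if "x \<in> S" for x
      by (rule has_derivative_transform_within_open[OF
            Ck_on_differentiable[OF Suc.prems(1) that] assms(1) that Suc.prems(2)])
    then have eq: "frechet_derivative f (at x) = frechet_derivative g (at x)" if "x \<in> S" for x
      using that frechet_derivative_at by blast
    have "Ck_on k S (\<lambda>x. frechet_derivative g (at x) v)" for v
    proof (rule Suc.IH)
      show "Ck_on k S (\<lambda>x. frechet_derivative f (at x) v)" using Suc.prems(1) by simp
      show "frechet_derivative f (at x) v = frechet_derivative g (at x) v" if "x \<in> S" for x
        by (simp only: eq[OF that])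
    qed
    then show ?case using D unfolding Ck_on.simps differentiable_def by blast
  qed
  show ?thesis
    using imp[of k f g, OF _ assms(2)] imp[of k g f, OF _ assms(2)[symmetric]] by blast
qed

lemma Ck_on_subset: "Ck_on k S f \<Longrightarrow> T \<subseteq> S \<Longrightarrow> Ck_on k T f"
  by (induction k arbitrary: f) (auto intro: continuous_on_subset)

lemma Ck_on_const: "Ck_on k S (\<lambda>x. c)"
  by (induction k arbitrary: c) auto

lemma Ck_on_SucI:
  assumes "open S" "\<And>x. x \<in> S \<Longrightarrow> (f has_derivative f' x) (at x)"
    "\<And>v. Ck_on k S (\<lambda>x. f' x v)"
  shows "Ck_on (Suc k) S f"
proof -
  have "frechet_derivative f (at x) = f' x" if "x \<in> S" for x
    using assms(2)[OF that] frechet_derivative_at by metis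
  then have "Ck_on k S (\<lambda>x. frechet_derivative f (at x) v)" for v
    using Ck_on_cong[OF assms(1), of "\<lambda>x. frechet_derivative f (at x) v" "\<lambda>x. f' x v"]
      assms(3)[of v] by simp
  then show ?thesis using assms(2) unfolding Ck_on.simps differentiable_def by blast
qed

lemma Ck_on_bounded_linear:
  assumes "open S" "bounded_linear f"
  shows "Ck_on k S f"
proof (cases k)
  case 0
  then show ?thesis using assms(2) by (simp add: linear_continuous_on)
next
  case (Suc n)
  show ?thesis
    unfolding Suc by (rule Ck_on_SucI[OF assms(1) bounded_linear_imp_has_derivative[OF assms(2)] Ck_on_const])
qed

lemma Ck_on_add:
  assumes "open S" "Ck_on k S f" "Ck_on k S g"
  shows "Ck_on k S (\<lambda>x. f x + g x)"
  using assms(2,3)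
proof (induction k arbitrary: f g)
  case (Suc k)
  show ?case
  proof (rule Ck_on_SucI[OF assms(1)])
    show "((\<lambda>x. f x + g x) has_derivative
        (\<lambda>v. frechet_derivative f (at x) v + frechet_derivative g (at x) v)) (at x)" if "x \<in> S" for x
      by (intro has_derivative_add Ck_on_differentiable[OF Suc.prems(1) that]
          Ck_on_differentiable[OF Suc.prems(2) that])
  qed (use Suc in auto)
qed (auto intro: continuous_intros)

lemma Ck_on_bounded_linear_compose:
  assumes "open S" "bounded_linear L" "Ck_on k S f"
  shows "Ck_on k S (\<lambda>x. L (f x))"
  using assms(3)
proof (induction k arbitrary: f)
  case 0
  then show ?case
    using assms(2) bounded_linear.continuous_on by auto
next
  case (Suc k)
  show ?case
  proof (rule Ck_on_SucI[OF assms(1)])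
    show "((\<lambda>x. L (f x)) has_derivative (\<lambda>v. L (frechet_derivative f (at x) v))) (at x)"
      if "x \<in> S" for x
      using bounded_linear.has_derivative[OF assms(2) Ck_on_differentiable[OF Suc.prems that]] .
  qed (use Suc in auto)
qed

lemma Ck_on_scaleR:
  fixes a :: "'a::real_normed_vector \<Rightarrow> real"
  assumes "open S" "Ck_on k S a" "Ck_on k S f"
  shows "Ck_on k S (\<lambda>x. a x *\<^sub>R f x)"
  using assms(2,3)
proof (induction k arbitrary: a f)
  case (Suc k)
  show ?case
  proof (rule Ck_on_SucI[OF assms(1)])
    show "((\<lambda>x. a x *\<^sub>R f x) has_derivative
        (\<lambda>v. a x *\<^sub>R frechet_derivative f (at x) v + frechet_derivative a (at x) v *\<^sub>R f x)) (at x)"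
      if "x \<in> S" for x
      by (intro has_derivative_scaleR Ck_on_differentiable[OF Suc.prems(1) that]
          Ck_on_differentiable[OF Suc.prems(2) that])
    show "Ck_on k S (\<lambda>x. a x *\<^sub>R frechet_derivative f (at x) v + frechet_derivative a (at x) v *\<^sub>R f x)"
      for v
      using Suc.prems
      by (intro Ck_on_add[OF assms(1)] Suc.IH Ck_on_Suc_imp[OF Suc.prems(1)]
          Ck_on_Suc_imp[OF Suc.prems(2)]) auto
  qed
qed (auto intro: continuous_intros)

lemma Ck_on_sum:
  assumes "open S" "\<And>i. i \<in> I \<Longrightarrow> Ck_on k S (f i)"
  shows "Ck_on k S (\<lambda>x. \<Sum>i\<in>I. f i x)"
  using assms(2)
  by (induction I rule: infinite_finite_induct) (auto intro: Ck_on_const Ck_on_add[OF assms(1)])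

text \<open>
  Expanding the inner derivative in coordinates turns the chain rule into a sum of products of
  functions of class \<open>C\<^sup>k\<close>, the factor \<open>\<partial>\<^sub>b f \<circ> g\<close> by induction.
\<close>
lemma Ck_on_compose:
  fixes f :: "'b::real_normed_vector \<Rightarrow> 'c::real_normed_vector"
    and g :: "'a::real_normed_vector \<Rightarrow> 'b"
  assumes B: "coordinate_system (B :: 'b set) \<kappa>" and "open S" "open T" "g ` S \<subseteq> T"
    and "Ck_on k T f" "Ck_on k S g"
  shows "Ck_on k S (\<lambda>x. f (g x))"
  using assms(5,6)
proof (induction k arbitrary: f)
  case 0
  then show ?case using assms(4) by (auto intro: continuous_on_compose2)
next
  case (Suc k)
  show ?case
  proof (rule Ck_on_SucI[OF assms(2)])
    fix x assume x: "x \<in> S"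
    then have gx: "g x \<in> T" using assms(4) by auto
    have lin: "linear (frechet_derivative f (at (g x)))"
      using Ck_on_differentiable[OF Suc.prems(1) gx] has_derivative_linear by blast
    have "((\<lambda>x. f (g x)) has_derivative
        (\<lambda>v. frechet_derivative f (at (g x)) (frechet_derivative g (at x) v))) (at x)"
      using has_derivative_compose[OF Ck_on_differentiable[OF Suc.prems(2) x]
          Ck_on_differentiable[OF Suc.prems(1) gx]] .
    then show "((\<lambda>x. f (g x)) has_derivative
        (\<lambda>v. \<Sum>b\<in>B. \<kappa> b (frechet_derivative g (at x) v) *\<^sub>R frechet_derivative f (at (g x)) b)) (at x)"
      by (simp add: linear_coordinates[OF B lin, symmetric])
  next
    fix v
    have bl: "bounded_linear (\<kappa> b)" for b using B by (simp add: coordinate_system_def)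
    have gk: "Ck_on k S (\<lambda>x. \<kappa> b (frechet_derivative g (at x) v))" for b
      using Suc.prems(2) by (intro Ck_on_bounded_linear_compose[OF assms(2) bl]) auto
    have "Ck_on k S (\<lambda>x. frechet_derivative f (at (g x)) b)" for b
      using Suc.IH[of "\<lambda>y. frechet_derivative f (at y) b"] Suc.prems(1)
        Ck_on_Suc_imp[OF Suc.prems(2)] by auto
    then show "Ck_on k S
        (\<lambda>x. \<Sum>b\<in>B. \<kappa> b (frechet_derivative g (at x) v) *\<^sub>R frechet_derivative f (at (g x)) b)"
      by (intro Ck_on_sum Ck_on_scaleR assms(2) gk)
  qed
qed

lemma Ck_on_local:
  assumes "\<And>x. x \<in> S \<Longrightarrow> \<exists>U. open U \<and> x \<in> U \<and> Ck_on k U f"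
  shows "Ck_on k S f"
  using assms
proof (induction k arbitrary: f)
  case 0
  show ?case
    unfolding Ck_on.simps
  proof (intro continuous_at_imp_continuous_on ballI)
    fix x assume "x \<in> S"
    then obtain U where "open U" "x \<in> U" "continuous_on U f" using 0 by auto
    then show "isCont f x" using continuous_on_eq_continuous_at by blast
  qed
next
  case (Suc k)
  then show ?case by (fastforce)
qed

text \<open>
  Smoothness of a germ: on a whole neighbourhood, so that the property passes to nearby points and
  depends only on the values near \<open>x\<close>.
\<close>
definition smooth_at :: "'a::real_normed_vector \<Rightarrow> ('a \<Rightarrow> 'b::real_normed_vector) \<Rightarrow> bool"
  where "smooth_at x f \<longleftrightarrow> (\<exists>U. open U \<and> x \<in> U \<and> smooth_on U f)"

lemma smooth_onI_smooth_at: "(\<And>x. x \<in> S \<Longrightarrow> smooth_at x f) \<Longrightarrow> smooth_on S f"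
  unfolding smooth_at_def smooth_on_def by (meson Ck_on_local)

lemma smooth_on_imp_smooth_at: "smooth_on S f \<Longrightarrow> open S \<Longrightarrow> x \<in> S \<Longrightarrow> smooth_at x f"
  by (auto simp: smooth_at_def)

lemma smooth_at_eventually: "smooth_at x f \<Longrightarrow> \<forall>\<^sub>F y in nhds x. smooth_at y f"
  unfolding smooth_at_def eventually_nhds by blast

lemma smooth_at_cong:
  assumes "smooth_at x f" "\<forall>\<^sub>F y in nhds x. f y = g y"
  shows "smooth_at x g"
proof -
  obtain U where U: "open U" "x \<in> U" "smooth_on U f" using assms(1) by (auto simp: smooth_at_def)
  obtain V where V: "open V" "x \<in> V" "\<And>y. y \<in> V \<Longrightarrow> f y = g y"
    using assms(2) by (auto simp: eventually_nhds)
  have "Ck_on k (U \<inter> V) g" for k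
    using Ck_on_cong[of "U \<inter> V" f g k] U V Ck_on_subset[of k U f "U \<inter> V"]
    by (auto simp: smooth_on_def)
  moreover have "open (U \<inter> V)" "x \<in> U \<inter> V" using U V by auto
  ultimately show ?thesis unfolding smooth_at_def smooth_on_def by blast
qed

lemma smooth_at_has_derivative:
  assumes "smooth_at x f"
  shows "(f has_derivative frechet_derivative f (at x)) (at x)"
proof -
  obtain U where "x \<in> U" "Ck_on (Suc 0) U f"
    using assms by (auto simp: smooth_at_def smooth_on_def simp del: Ck_on.simps)
  then show ?thesis using Ck_on_differentiable by blast
qed

lemma smooth_at_tendsto: "smooth_at x f \<Longrightarrow> (f \<longlongrightarrow> f x) (nhds x)"
  using smooth_at_has_derivative has_derivative_continuous
  by (metis continuous_at tendsto_nhds_iff)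

lemma smooth_at_derivative_const:
  assumes "smooth_at x f"
  shows "smooth_at x (\<lambda>y. frechet_derivative f (at y) v)"
proof -
  obtain U where U: "open U" "x \<in> U" "\<And>k. Ck_on k U f"
    using assms by (auto simp: smooth_at_def smooth_on_def)
  have "Ck_on k U (\<lambda>y. frechet_derivative f (at y) v)" for k
    using U(3)[of "Suc k"] by simp
  then show ?thesis using U by (auto simp: smooth_at_def smooth_on_def)
qed

lemma smooth_at_const: "smooth_at x (\<lambda>y. c)"
  unfolding smooth_at_def smooth_on_def using Ck_on_const by blast

lemma smooth_at_bounded_linear: "bounded_linear f \<Longrightarrow> smooth_at x f"
  unfolding smooth_at_def smooth_on_def using Ck_on_bounded_linear by blast

lemma smooth_at_common_nhd:
  assumes "smooth_at x f" "smooth_at x g"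
  obtains U where "open U" "x \<in> U" "\<And>k. Ck_on k U f" "\<And>k. Ck_on k U g"
proof -
  obtain U V where "open U" "x \<in> U" "smooth_on U f" "open V" "x \<in> V" "smooth_on V g"
    using assms unfolding smooth_at_def by blast
  then show thesis
    using that[of "U \<inter> V"] Ck_on_subset[of _ U f "U \<inter> V"] Ck_on_subset[of _ V g "U \<inter> V"]
    by (auto simp: smooth_on_def)
qed

lemma smooth_at_add: "smooth_at x f \<Longrightarrow> smooth_at x g \<Longrightarrow> smooth_at x (\<lambda>y. f y + g y)"
  using smooth_at_common_nhd[of x f g] unfolding smooth_at_def[of _ "\<lambda>y. _ y + _ y"] smooth_on_def
  by (metis Ck_on_add)

lemma smooth_at_bounded_linear_compose:
  "bounded_linear L \<Longrightarrow> smooth_at x f \<Longrightarrow> smooth_at x (\<lambda>y. L (f y))"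
  unfolding smooth_at_def smooth_on_def using Ck_on_bounded_linear_compose by blast

lemma smooth_at_minus: "smooth_at x f \<Longrightarrow> smooth_at x (\<lambda>y. - f y)"
  using smooth_at_bounded_linear_compose[OF bounded_linear_minus[OF bounded_linear_ident]] .

lemma smooth_at_diff: "smooth_at x f \<Longrightarrow> smooth_at x g \<Longrightarrow> smooth_at x (\<lambda>y. f y - g y)"
  using smooth_at_add[of x f "\<lambda>y. - g y"] smooth_at_minus[of x g] by simp

lemma smooth_at_scaleR:
  fixes a :: "'a::real_normed_vector \<Rightarrow> real"
  shows "smooth_at x a \<Longrightarrow> smooth_at x f \<Longrightarrow> smooth_at x (\<lambda>y. a y *\<^sub>R f y)"
  using smooth_at_common_nhd[of x a f] unfolding smooth_at_def[of _ "\<lambda>y. _ y *\<^sub>R _ y"] smooth_on_def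
  by (metis Ck_on_scaleR)

lemma smooth_at_sum:
  "(\<And>i. i \<in> I \<Longrightarrow> smooth_at x (f i)) \<Longrightarrow> smooth_at x (\<lambda>y. \<Sum>i\<in>I. f i y)"
  by (induction I rule: infinite_finite_induct) (auto intro: smooth_at_const smooth_at_add)

lemma smooth_at_Pair:
  assumes "smooth_at x f" "smooth_at x g"
  shows "smooth_at x (\<lambda>y. (f y, g y))"
proof -
  have "smooth_at x (\<lambda>y. (f y, 0))" "smooth_at x (\<lambda>y. (0, g y))"
    using smooth_at_bounded_linear_compose[OF bounded_linear_Pair[OF bounded_linear_ident
          bounded_linear_zero] assms(1)]
      smooth_at_bounded_linear_compose[OF bounded_linear_Pair[OF bounded_linear_zero
          bounded_linear_ident] assms(2)] by simp_all
  from smooth_at_add[OF this] show ?thesis by simp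
qed

lemma smooth_at_compose:
  fixes f :: "'b::real_normed_vector \<Rightarrow> 'c::real_normed_vector"
    and g :: "'a::real_normed_vector \<Rightarrow> 'b"
  assumes B: "coordinate_system (B :: 'b set) \<kappa>"
    and "smooth_at (g x) f" "smooth_at x g"
  shows "smooth_at x (\<lambda>y. f (g y))"
proof -
  obtain T where T: "open T" "g x \<in> T" "smooth_on T f" using assms by (auto simp: smooth_at_def)
  obtain U where U: "open U" "x \<in> U" "smooth_on U g" using assms by (auto simp: smooth_at_def)
  have "\<forall>\<^sub>F y in nhds x. g y \<in> T"
    using smooth_at_tendsto[OF assms(3)] T topological_tendstoD by blast
  then obtain V where V: "open V" "x \<in> V" "\<And>y. y \<in> V \<Longrightarrow> g y \<in> T"
    by (auto simp: eventually_nhds)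
  have "Ck_on k (U \<inter> V) (\<lambda>y. f (g y))" for k
  proof (rule Ck_on_compose[OF B _ T(1)])
    show "Ck_on k T f" using T(3) by (simp add: smooth_on_def)
    show "Ck_on k (U \<inter> V) g" using U(3) Ck_on_subset unfolding smooth_on_def by blast
  qed (use U V in auto)
  moreover have "open (U \<inter> V)" "x \<in> U \<inter> V" using U V by auto
  ultimately show ?thesis unfolding smooth_at_def smooth_on_def by blast
qed

lemma smooth_at_derivative:
  fixes f :: "'b::real_normed_vector \<Rightarrow> 'c::real_normed_vector"
    and g :: "'a::real_normed_vector \<Rightarrow> 'b"
  assumes B: "coordinate_system (B :: 'b set) \<kappa>"
    and f: "smooth_at (g x) f" and g: "smooth_at x g" and v: "smooth_at x v"
  shows "smooth_at x (\<lambda>y. frechet_derivative f (at (g y)) (v y))"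
proof (rule smooth_at_cong)
  have bl: "bounded_linear (\<kappa> b)" for b using B by (simp add: coordinate_system_def)
  show "smooth_at x (\<lambda>y. \<Sum>b\<in>B. \<kappa> b (v y) *\<^sub>R frechet_derivative f (at (g y)) b)"
    by (intro smooth_at_sum smooth_at_scaleR smooth_at_bounded_linear_compose[OF bl] v
        smooth_at_compose[OF B _ g] smooth_at_derivative_const f)
  have "\<forall>\<^sub>F y in nhds x. smooth_at (g y) f"
    using smooth_at_eventually[OF f] smooth_at_tendsto[OF g] filterlim_iff by blast
  then show "\<forall>\<^sub>F y in nhds x. (\<Sum>b\<in>B. \<kappa> b (v y) *\<^sub>R frechet_derivative f (at (g y)) b)
      = frechet_derivative f (at (g y)) (v y)"
  proof eventually_elim
    case (elim y)
    then have "linear (frechet_derivative f (at (g y)))"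
      using smooth_at_has_derivative has_derivative_linear by blast
    then show ?case by (simp add: linear_coordinates[OF B, symmetric])
  qed
qed

section \<open>Lifting curves through a submersion\<close>

text \<open>
  The partial derivatives are continuous and finitely many, so the derivative is continuous in
  operator norm; the mean value inequality is then applied to \<open>f\<close> minus its linear part at \<open>a\<close>.
\<close>
lemma smooth_at_strict_derivative:
  fixes f :: "'e::real_normed_vector \<Rightarrow> 'n::real_normed_vector"
  assumes B: "coordinate_system (B :: 'e set) \<kappa>" and f: "smooth_at a f" and "\<epsilon> > 0"
  obtains \<delta> where "\<delta> > 0"
    "\<And>x y. x \<in> ball a \<delta> \<Longrightarrow> y \<in> ball a \<delta> \<Longrightarrow>
      norm (f x - f y - frechet_derivative f (at a) (x - y)) \<le> \<epsilon> * norm (x - y)"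
proof -
  let ?D = "\<lambda>x. frechet_derivative f (at x)"
  have fin: "finite B" and bl: "\<And>b. bounded_linear (\<kappa> b)"
    using B by (auto simp: coordinate_system_def)
  have "\<forall>b. \<exists>K>0. \<forall>v. norm (\<kappa> b v) \<le> norm v * K"
    using bounded_linear.pos_bounded[OF bl] by blast
  then obtain K where K: "\<And>b. K b > 0" "\<And>b v. norm (\<kappa> b v) \<le> norm v * K b" by metis
  define \<eta> where "\<eta> = \<epsilon> / (1 + (\<Sum>b\<in>B. K b))"
  have pos: "1 + (\<Sum>b\<in>B. K b) > 0" using K(1) by (intro add_pos_nonneg sum_nonneg) (auto intro: less_imp_le)
  then have \<eta>: "\<eta> > 0" using \<open>\<epsilon> > 0\<close> by (simp add: \<eta>_def)
  have "\<forall>\<^sub>F x in nhds a. norm (?D x b - ?D a b) < \<eta>" for b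
    using tendstoD[OF smooth_at_tendsto[OF smooth_at_derivative_const[OF f]] \<eta>, of b]
    by (simp add: dist_norm)
  then have "\<forall>\<^sub>F x in nhds a. \<forall>b\<in>B. norm (?D x b - ?D a b) < \<eta>"
    by (simp add: eventually_ball_finite fin)
  then have "\<forall>\<^sub>F x in nhds a. smooth_at x f \<and> (\<forall>b\<in>B. norm (?D x b - ?D a b) < \<eta>)"
    using smooth_at_eventually[OF f] eventually_conj by blast
  then obtain \<delta> where \<delta>: "\<delta> > 0"
    "\<And>x. dist x a < \<delta> \<Longrightarrow> smooth_at x f \<and> (\<forall>b\<in>B. norm (?D x b - ?D a b) < \<eta>)"
    unfolding eventually_nhds_metric by blast
  have lin: "linear (?D x)" if "x \<in> ball a \<delta>" for x
    using smooth_at_has_derivative has_derivative_linear \<delta>(2)[of x] that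
    by (metis dist_commute mem_ball)
  have a: "a \<in> ball a \<delta>" using \<delta> by simp
  have bound: "onorm (\<lambda>v. ?D x v - ?D a v) \<le> \<epsilon>" if x: "x \<in> ball a \<delta>" for x
  proof (rule onorm_bound)
    show "0 \<le> \<epsilon>" using \<open>\<epsilon> > 0\<close> by simp
    fix v
    have "?D x v - ?D a v = (\<Sum>b\<in>B. \<kappa> b v *\<^sub>R (?D x b - ?D a b))"
      by (simp add: linear_coordinates[OF B lin[OF x], of v] linear_coordinates[OF B lin[OF a], of v]
          sum_subtractf[symmetric] scaleR_diff_right)
    also have "norm \<dots> \<le> (\<Sum>b\<in>B. norm (\<kappa> b v) * norm (?D x b - ?D a b))"
      by (rule order_trans[OF norm_sum]) simp
    also have "\<dots> \<le> (\<Sum>b\<in>B. (norm v * K b) * \<eta>)"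
      using K(2) \<delta>(2)[of x] x less_imp_le[OF K(1)]
      by (intro sum_mono mult_mono) (auto simp: dist_commute intro: less_imp_le)
    also have "\<dots> = norm v * (\<eta> * (\<Sum>b\<in>B. K b))"
      by (simp add: sum_distrib_left mult_ac)
    also have "\<dots> \<le> norm v * \<epsilon>"
    proof (intro mult_left_mono)
      have "\<eta> * (\<Sum>b\<in>B. K b) \<le> \<eta> * (1 + (\<Sum>b\<in>B. K b))" using \<eta> by (intro mult_left_mono) auto
      then show "\<eta> * (\<Sum>b\<in>B. K b) \<le> \<epsilon>" using pos by (simp add: \<eta>_def)
    qed auto
    finally show "norm (?D x v - ?D a v) \<le> \<epsilon> * norm v" by (simp add: mult.commute)
  qed
  have "norm (f x - f y - ?D a (x - y)) \<le> \<epsilon> * norm (x - y)"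
    if x: "x \<in> ball a \<delta>" and y: "y \<in> ball a \<delta>" for x y
  proof -
    have der: "((\<lambda>z. f z - ?D a z) has_derivative (\<lambda>v. ?D z v - ?D a v)) (at z within ball a \<delta>)"
      if "z \<in> ball a \<delta>" for z
    proof (rule has_derivative_at_withinI, rule has_derivative_diff)
      show "(f has_derivative ?D z) (at z)"
        by (rule smooth_at_has_derivative) (use \<delta>(2)[of z] that in \<open>simp add: dist_commute\<close>)
      show "(?D a has_derivative ?D a) (at z)"
        by (intro bounded_linear_imp_has_derivative linear_imp_bounded_linear_coordinates[OF B] lin a)
    qed
    have "norm ((f x - ?D a x) - (f y - ?D a y)) \<le> \<epsilon> * norm (x - y)"
      by (rule differentiable_bound[OF convex_ball der bound x y])
    moreover have "(f x - ?D a x) - (f y - ?D a y) = f x - f y - ?D a (x - y)"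
      by (simp add: linear_diff[OF lin[OF a]])
    ultimately show ?thesis by simp
  qed
  then show ?thesis using that \<delta>(1) by blast
qed

text \<open>
  The values \<open>\<phi> (a + \<tau> X)\<close> and \<open>k \<tau>\<close> differ by \<open>o(\<tau>)\<close>.  With a right inverse \<open>R\<close> of the derivative,
  the equation \<open>\<phi> (a + \<tau> X + R z) = k \<tau>\<close> is a fixed point problem for a contraction in \<open>z\<close>,
  because \<open>\<phi>\<close> is strictly differentiable at \<open>a\<close>; its solution is bounded by twice the defect at
  \<open>z = 0\<close>, so the correction \<open>R z\<close> does not change the velocity.
\<close>
lemma curve_lift:
  fixes \<phi> :: "'e::real_normed_vector \<Rightarrow> 'n::banach"
  assumes B: "coordinate_system (B :: 'e set) \<kappa>" and C: "coordinate_system (C :: 'n set) \<mu>"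
    and \<phi>: "smooth_at a \<phi>" and surj: "surj (frechet_derivative \<phi> (at a))"
    and k0: "k 0 = \<phi> a"
    and k: "(k has_vector_derivative frechet_derivative \<phi> (at a) X) (at 0)"
  obtains x where "x 0 = a" "(x has_vector_derivative X) (at 0)" "\<forall>\<^sub>F \<tau> in nhds 0. \<phi> (x \<tau>) = k \<tau>"
proof -
  define D where "D = frechet_derivative \<phi> (at a)"
  have der: "(\<phi> has_derivative D) (at a)" unfolding D_def by (rule smooth_at_has_derivative[OF \<phi>])
  have linD: "linear D" using der has_derivative_linear by blast
  obtain R where R: "linear R" "\<And>w. D (R w) = w"
    using linear_surj_right_inverse[OF linD, of UNIV UNIV] surj by (auto simp: D_def)
  have blR: "bounded_linear R" by (rule linear_imp_bounded_linear_coordinates[OF C R(1)])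
  then obtain M where M: "M > 0" "\<And>w. norm (R w) \<le> norm w * M"
    using bounded_linear.pos_bounded by blast
  \<comment> \<open>With \<open>M\<close> bounding \<open>R\<close>, this accuracy of the linear approximation gives contraction factor 1/2.\<close>
  obtain \<delta> where \<delta>: "\<delta> > 0" "\<And>x y. x \<in> ball a \<delta> \<Longrightarrow> y \<in> ball a \<delta> \<Longrightarrow>
      norm (\<phi> x - \<phi> y - D (x - y)) \<le> 1 / (2 * M) * norm (x - y)"
    using smooth_at_strict_derivative[OF B \<phi>, of "1 / (2 * M)"] M(1) unfolding D_def by auto
  define \<rho> where "\<rho> \<tau> = \<phi> (a + \<tau> *\<^sub>R X) - k \<tau>" for \<tau> :: real
  have line: "((\<lambda>\<tau>::real. a + \<tau> *\<^sub>R X) has_vector_derivative X) (at 0)"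
    by (auto intro!: derivative_eq_intros simp: has_vector_derivative_def)
  have "((\<lambda>\<tau>. \<phi> (a + \<tau> *\<^sub>R X)) has_vector_derivative D X) (at 0)"
  proof -
    have "(\<phi> has_derivative D) (at (a + 0 *\<^sub>R X))" using der by simp
    from has_derivative_compose[OF line[unfolded has_vector_derivative_def] this]
    show ?thesis by (simp add: has_vector_derivative_def linear_scale[OF linD])
  qed
  from has_vector_derivative_diff[OF this k]
  have \<rho>': "(\<rho> has_vector_derivative 0) (at 0)" by (simp add: \<rho>_def[abs_def] D_def)
  have \<rho>0: "\<rho> 0 = 0" by (simp add: \<rho>_def k0)
  have "((\<lambda>\<tau>. norm (\<tau> *\<^sub>R X) + M * (2 * norm (\<rho> \<tau>))) \<longlongrightarrow> norm ((0::real) *\<^sub>R X) + M * (2 * norm (\<rho> 0))) (nhds 0)"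
  proof -
    have "(\<rho> \<longlongrightarrow> \<rho> 0) (nhds 0)"
      using has_vector_derivative_continuous[OF \<rho>'] by (metis continuous_at tendsto_nhds_iff)
    moreover have "((\<lambda>\<tau>::real. \<tau>) \<longlongrightarrow> 0) (nhds 0)" by (simp add: filterlim_ident)
    ultimately show ?thesis by (intro tendsto_intros)
  qed
  then have small: "\<forall>\<^sub>F \<tau> in nhds 0. norm (\<tau> *\<^sub>R X) + M * (2 * norm (\<rho> \<tau>)) < \<delta>"
    using order_tendstoD(2) \<delta>(1) \<rho>0 by fastforce
  have sol: "\<exists>z. norm z \<le> 2 * norm (\<rho> \<tau>) \<and> \<phi> (a + \<tau> *\<^sub>R X + R z) = k \<tau>"
    if \<tau>: "norm (\<tau> *\<^sub>R X) + M * (2 * norm (\<rho> \<tau>)) < \<delta>" for \<tau>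
  proof -
    define r where "r = 2 * norm (\<rho> \<tau>)"
    define T where "T z = z - (\<phi> (a + \<tau> *\<^sub>R X + R z) - k \<tau>)" for z
    have inball: "a + \<tau> *\<^sub>R X + R z \<in> ball a \<delta>" if "z \<in> cball 0 r" for z
    proof -
      have "norm (\<tau> *\<^sub>R X + R z) \<le> norm (\<tau> *\<^sub>R X) + norm z * M"
        by (rule order_trans[OF norm_triangle_ineq]) (use M(2) in auto)
      also have "\<dots> \<le> norm (\<tau> *\<^sub>R X) + M * r" using that M(1) by (simp add: mult.commute)
      finally have "norm (\<tau> *\<^sub>R X + R z) < \<delta>" using \<tau> by (simp add: r_def)
      then show ?thesis by (metis add.assoc add_diff_cancel_left' dist_commute dist_norm mem_ball)
    qed
    have contr: "dist (T z) (T w) \<le> 1 / 2 * dist z w" if "z \<in> cball 0 r" "w \<in> cball 0 r" for z w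
    proof -
      let ?x = "a + \<tau> *\<^sub>R X + R z" and ?y = "a + \<tau> *\<^sub>R X + R w"
      have xy: "?x - ?y = R (z - w)" by (simp add: linear_diff[OF R(1)])
      have "T z - T w = - (\<phi> ?x - \<phi> ?y - D (?x - ?y))" unfolding xy R(2) by (simp add: T_def)
      then have "dist (T z) (T w) = norm (\<phi> ?x - \<phi> ?y - D (?x - ?y))"
        by (metis dist_norm norm_minus_cancel)
      also have "\<dots> \<le> 1 / (2 * M) * norm (R (z - w))" using \<delta>(2)[OF inball inball] that xy by metis
      also have "\<dots> \<le> 1 / (2 * M) * (norm (z - w) * M)" using M by (intro mult_left_mono) auto
      also have "\<dots> = 1 / 2 * dist z w" using M(1) by (simp add: dist_norm)
      finally show ?thesis .
    qed
    have r0: "0 \<in> cball 0 r" by (simp add: r_def)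
    have T0: "norm (T 0) = r / 2" by (simp add: T_def r_def \<rho>_def linear_0[OF R(1)] norm_minus_commute)
    have self: "T ` cball 0 r \<subseteq> cball 0 r"
    proof
      fix y assume "y \<in> T ` cball 0 r"
      then obtain z where z: "z \<in> cball 0 r" "y = T z" by auto
      have "norm (T z) \<le> norm (T 0) + dist (T z) (T 0)"
        using norm_triangle_ineq[of "T 0" "T z - T 0"] by (simp add: dist_norm)
      also have "\<dots> \<le> r / 2 + 1 / 2 * r" using contr[OF z(1) r0] z(1) T0 by simp
      finally show "y \<in> cball 0 r" by (simp add: z(2))
    qed
    have "\<exists>!z\<in>cball 0 r. T z = z"
      proof (rule Banach_fix[of _ "1/2"])
      show "complete (cball (0 :: 'n) r)" unfolding complete_eq_closed by (rule closed_cball)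
    qed (use r0 self contr in auto)
    then obtain z where "z \<in> cball 0 r" "T z = z" by blast
    then show ?thesis by (intro exI[of _ z]) (auto simp: T_def r_def)
  qed
  then obtain z where z: "\<And>\<tau>. norm (\<tau> *\<^sub>R X) + M * (2 * norm (\<rho> \<tau>)) < \<delta> \<Longrightarrow>
      norm (z \<tau>) \<le> 2 * norm (\<rho> \<tau>) \<and> \<phi> (a + \<tau> *\<^sub>R X + R (z \<tau>)) = k \<tau>"
    by metis
  have z0: "z 0 = 0" using z[of 0] \<delta>(1) \<rho>0 by simp
  have "(z has_vector_derivative 0) (at 0)"
    unfolding has_vector_derivative_def has_derivative_at
  proof (intro conjI)
    have "(\<lambda>\<tau>. norm (\<rho> \<tau>) / norm \<tau>) \<midarrow>0\<rightarrow> 0"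
      using \<rho>' \<rho>0 by (simp add: has_vector_derivative_def has_derivative_at)
    then have lim: "(\<lambda>\<tau>. 2 * (norm (\<rho> \<tau>) / norm \<tau>)) \<midarrow>0\<rightarrow> 0" by (rule tendsto_mult_right_zero)
    have "\<forall>\<^sub>F \<tau> in at 0. norm (norm (z (0 + \<tau>) - z 0 - \<tau> *\<^sub>R 0) / norm \<tau>) \<le> 2 * (norm (\<rho> \<tau>) / norm \<tau>)"
      using small unfolding eventually_at_filter
    proof eventually_elim
      case (elim \<tau>)
      show ?case using z[OF elim] by (auto simp: z0 divide_simps)
    qed
    from Lim_null_comparison[OF this lim]
    show "(\<lambda>\<tau>. norm (z (0 + \<tau>) - z 0 - \<tau> *\<^sub>R 0) / norm \<tau>) \<midarrow>0\<rightarrow> 0" .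
  qed simp
  then have "((\<lambda>\<tau>. R (z \<tau>)) has_vector_derivative R 0) (at 0)"
    by (rule bounded_linear.has_vector_derivative[OF blR])
  from has_vector_derivative_add[OF line this]
  have "((\<lambda>\<tau>. a + \<tau> *\<^sub>R X + R (z \<tau>)) has_vector_derivative X) (at 0)"
    by (simp add: linear_0[OF R(1)])
  moreover have "\<forall>\<^sub>F \<tau> in nhds 0. \<phi> (a + \<tau> *\<^sub>R X + R (z \<tau>)) = k \<tau>"
    using small by eventually_elim (use z in blast)
  ultimately show ?thesis by (intro that[of "\<lambda>\<tau>. a + \<tau> *\<^sub>R X + R (z \<tau>)"]) (simp_all add: z0 linear_0[OF R(1)])
qed


section \<open>Multilinear expansions\<close>

text \<open>
  Closure under linear combinations for vectors represented as functions, on which the vector space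
  operations are written pointwise.
\<close>
definition lin_subspace :: "('i \<Rightarrow> 'v::real_vector) set \<Rightarrow> bool"
  where "lin_subspace V \<longleftrightarrow> (\<lambda>i. 0) \<in> V \<and>
    (\<forall>v\<in>V. \<forall>w\<in>V. \<forall>a b. (\<lambda>i. a *\<^sub>R v i + b *\<^sub>R w i) \<in> V)"

lemma lin_on_zero:
  assumes "lin_on V L" "lin_subspace V"
  shows "L (\<lambda>i. 0) = 0"
proof -
  have z: "(\<lambda>i. 0) \<in> V" using assms(2) by (simp add: lin_subspace_def)
  show ?thesis
    using assms(1)[unfolded lin_on_def, rule_format, OF z z, of 0 0] by simp
qed

lemma lin_on_sum:
  fixes e :: "'k \<Rightarrow> 'i \<Rightarrow> 'v::real_vector"
  assumes L: "lin_on V L" and V: "lin_subspace V" and e: "\<And>k. k \<in> I \<Longrightarrow> e k \<in> V"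
  shows "(\<lambda>i. \<Sum>k\<in>I. a k *\<^sub>R e k i) \<in> V \<and>
    L (\<lambda>i. \<Sum>k\<in>I. a k *\<^sub>R e k i) = (\<Sum>k\<in>I. a k * L (e k))"
  using e
proof (induction I rule: infinite_finite_induct)
  case (infinite A)
  then show ?case using lin_on_zero[OF L V] V by (simp add: lin_subspace_def)
next
  case empty
  then show ?case using lin_on_zero[OF L V] V by (simp add: lin_subspace_def)
next
  case (insert k I)
  let ?s = "\<lambda>i. \<Sum>k\<in>I. a k *\<^sub>R e k i"
  have s: "?s \<in> V" "L ?s = (\<Sum>k\<in>I. a k * L (e k))" and k: "e k \<in> V"
    using insert.IH insert.prems by auto
  have eq: "(\<lambda>i. \<Sum>k\<in>insert k I. a k *\<^sub>R e k i) = (\<lambda>i. a k *\<^sub>R e k i + 1 *\<^sub>R ?s i)"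
    using insert.hyps by simp
  have "(\<lambda>i. a k *\<^sub>R e k i + 1 *\<^sub>R ?s i) \<in> V"
    using V unfolding lin_subspace_def by (metis (no_types) k s(1))
  moreover have "L (\<lambda>i. a k *\<^sub>R e k i + 1 *\<^sub>R ?s i) = a k * L (e k) + 1 * L ?s"
    by (rule L[unfolded lin_on_def, rule_format, OF k s(1)])
  ultimately show ?case unfolding eq using s(2) insert.hyps by simp
qed

text \<open>
  The entries of the list are expanded one after the other in the finite frame \<open>e\<close>, which may
  itself depend on the point; \<open>is\<close> records the frame vectors already substituted.
\<close>
lemma smooth_at_multilinear:
  fixes \<phi> :: "'y::real_normed_vector \<Rightarrow> 'x list \<Rightarrow> real"
  assumes fin: "finite I"
    and const: "\<And>is. length is = q \<Longrightarrow> set is \<subseteq> I \<Longrightarrow> smooth_at y0 (\<lambda>y. \<phi> y (map (\<lambda>i. e i y) is))"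
    and coeff: "\<And>w i. w \<in> W \<Longrightarrow> i \<in> I \<Longrightarrow> smooth_at y0 (a w i)"
    and expand: "\<And>w is ws. w \<in> W \<Longrightarrow> set is \<subseteq> I \<Longrightarrow> set ws \<subseteq> W \<Longrightarrow>
      length is + Suc (length ws) = q \<Longrightarrow>
      \<forall>\<^sub>F y in nhds y0. \<phi> y (map (\<lambda>i. e i y) is @ w y # map (\<lambda>w. w y) ws) =
        (\<Sum>i\<in>I. a w i y * \<phi> y (map (\<lambda>i. e i y) is @ e i y # map (\<lambda>w. w y) ws))"
    and "length ws = q" "set ws \<subseteq> W"
  shows "smooth_at y0 (\<lambda>y. \<phi> y (map (\<lambda>w. w y) ws))"
proof -
  have "smooth_at y0 (\<lambda>y. \<phi> y (map (\<lambda>i. e i y) is @ map (\<lambda>w. w y) ws))"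
    if "length is + length ws = q" "set is \<subseteq> I" "set ws \<subseteq> W" for "is" ws
    using that
  proof (induction ws arbitrary: "is")
    case Nil
    then show ?case using const[of "is"] by simp
  next
    case (Cons w ws)
    have IH: "smooth_at y0 (\<lambda>y. \<phi> y (map (\<lambda>i. e i y) is @ e i y # map (\<lambda>w. w y) ws))"
      if "i \<in> I" for i
      using Cons.IH[of "is @ [i]"] Cons.prems that by simp
    have "smooth_at y0 (\<lambda>y. \<Sum>i\<in>I. a w i y *\<^sub>R
        \<phi> y (map (\<lambda>i. e i y) is @ e i y # map (\<lambda>w. w y) ws))"
      using Cons.prems by (intro smooth_at_sum smooth_at_scaleR coeff IH) auto
    moreover have "\<forall>\<^sub>F y in nhds y0.
        (\<Sum>i\<in>I. a w i y *\<^sub>R \<phi> y (map (\<lambda>i. e i y) is @ e i y # map (\<lambda>w. w y) ws)) =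
        \<phi> y (map (\<lambda>i. e i y) is @ map (\<lambda>w. w y) (w # ws))"
      using expand[of w "is" ws] Cons.prems by (auto elim: eventually_mono)
    ultimately show ?case by (rule smooth_at_cong)
  qed
  from this[of "[]" ws] show ?thesis using assms by simp
qed

section \<open>Charts and tangent vectors\<close>

lemma smooth_on_eventually_imp_smooth_at:
  assumes "smooth_on S f" "\<forall>\<^sub>F y in nhds x. y \<in> S"
  shows "smooth_at x f"
proof -
  obtain U where "open U" "x \<in> U" "U \<subseteq> S" using assms(2) unfolding eventually_nhds by blast
  moreover from this(3) have "smooth_on U f"
    using assms(1) Ck_on_subset[of _ S f U] by (simp add: smooth_on_def)
  ultimately show ?thesis by (auto simp: smooth_at_def)
qed

lemma smooth_atlas_coordinates:
  fixes A :: "('a::topological_space, 'e::banach) chart set"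
  assumes "smooth_atlas A"
  obtains B :: "'e set" and \<kappa> where "coordinate_system B \<kappa>"
proof -
  obtain B0 :: "'e set" where "finite B0" "span B0 = UNIV"
    using assms unfolding smooth_atlas_def by blast
  from coordinate_system_exists[OF this] show thesis using that by blast
qed

lemma chart_at_in: "smooth_atlas A \<Longrightarrow> chart_at A p \<in> charts_at A p"
  unfolding chart_at_def smooth_atlas_def by (simp add: some_in_eq)

lemma charts_at_nonempty: "smooth_atlas A \<Longrightarrow> \<exists>c. c \<in> charts_at A p"
  using chart_at_in by blast

lemma chart_facts:
  assumes "smooth_atlas A" "c \<in> A"
  shows "open (chart_dom c)" "open (chart_map c ` chart_dom c)"
    "continuous_on (chart_dom c) (chart_map c)"
    "continuous_on (chart_map c ` chart_dom c) (chart_inv c)"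
    "x \<in> chart_dom c \<Longrightarrow> chart_inv c (chart_map c x) = x"
    "y \<in> chart_map c ` chart_dom c \<Longrightarrow> chart_map c (chart_inv c y) = y"
    "y \<in> chart_map c ` chart_dom c \<Longrightarrow> chart_inv c y \<in> chart_dom c"
proof -
  have "homeomorphism (chart_dom c) (chart_map c ` chart_dom c) (chart_map c) (chart_inv c)"
    and o: "open (chart_dom c)" "open (chart_map c ` chart_dom c)"
    using assms unfolding smooth_atlas_def by auto
  then show "continuous_on (chart_dom c) (chart_map c)"
    "continuous_on (chart_map c ` chart_dom c) (chart_inv c)"
    "x \<in> chart_dom c \<Longrightarrow> chart_inv c (chart_map c x) = x"
    "y \<in> chart_map c ` chart_dom c \<Longrightarrow> chart_map c (chart_inv c y) = y"
    "y \<in> chart_map c ` chart_dom c \<Longrightarrow> chart_inv c y \<in> chart_dom c"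
    unfolding homeomorphism_def by auto
  show "open (chart_dom c)" "open (chart_map c ` chart_dom c)" by (rule o)+
qed

lemma charts_atD: "c \<in> charts_at A p \<Longrightarrow> c \<in> A" "c \<in> charts_at A p \<Longrightarrow> p \<in> chart_dom c"
  by (auto simp: charts_at_def)

lemma chart_inv_chart:
  assumes "smooth_atlas A" "c \<in> charts_at A p"
  shows "chart_inv c (chart_map c p) = p"
  using chart_facts(5)[OF assms(1)] charts_atD[OF assms(2)] by blast

lemma eventually_chart_dom:
  assumes "smooth_atlas A" "c \<in> charts_at A p"
  shows "\<forall>\<^sub>F x in nhds p. x \<in> chart_dom c"
    "\<forall>\<^sub>F y in nhds (chart_map c p). y \<in> chart_map c ` chart_dom c"
  using chart_facts(1,2)[OF assms(1)] charts_atD[OF assms(2)] eventually_nhds_in_open by blast+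

lemma continuous_on_open_filterlim:
  assumes "continuous_on S f" "open S" "x \<in> S"
  shows "filterlim f (nhds (f x)) (nhds x)"
proof -
  have "(f \<longlongrightarrow> f x) (at x within S)" using assms(1,3) unfolding continuous_on_def by blast
  then show ?thesis using at_within_open[OF assms(3,2)] tendsto_at_iff_tendsto_nhds by metis
qed

lemma chart_filterlim:
  assumes "smooth_atlas A" "c \<in> charts_at A p"
  shows "filterlim (chart_map c) (nhds (chart_map c p)) (nhds p)"
    "filterlim (chart_inv c) (nhds p) (nhds (chart_map c p))"
proof -
  note cA = charts_atD[OF assms(2)]
  show "filterlim (chart_map c) (nhds (chart_map c p)) (nhds p)"
    using continuous_on_open_filterlim chart_facts[OF assms(1) cA(1)] cA(2) by blast
  have "filterlim (chart_inv c) (nhds (chart_inv c (chart_map c p))) (nhds (chart_map c p))"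
    using continuous_on_open_filterlim chart_facts[OF assms(1) cA(1)] cA(2) by blast
  then show "filterlim (chart_inv c) (nhds p) (nhds (chart_map c p))"
    by (simp add: chart_inv_chart[OF assms])
qed

lemma eventually_filterlim: "filterlim f G F \<Longrightarrow> eventually P G \<Longrightarrow> \<forall>\<^sub>F x in F. P (f x)"
  by (simp add: filterlim_iff)

lemma has_derivative_cong_nhds:
  assumes "(f has_derivative D) (at x)" "\<forall>\<^sub>F y in nhds x. f y = g y"
  shows "(g has_derivative D) (at x)"
proof -
  obtain U where "open U" "x \<in> U" "\<And>y. y \<in> U \<Longrightarrow> f y = g y"
    using assms(2) unfolding eventually_nhds by blast
  then show ?thesis using has_derivative_transform_within_open[OF assms(1)] by blast
qed

lemma transition_smooth_at:
  assumes A: "smooth_atlas A" and c: "c \<in> charts_at A p" and d: "d \<in> charts_at A p"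
  shows "smooth_at (chart_map c p) (chart_map d \<circ> chart_inv c)"
proof (rule smooth_on_eventually_imp_smooth_at)
  note cA = charts_atD[OF c] and dA = charts_atD[OF d]
  show "smooth_on (chart_map c ` (chart_dom c \<inter> chart_dom d)) (chart_map d \<circ> chart_inv c)"
    using A cA(1) dA(1) unfolding smooth_atlas_def by blast
  show "\<forall>\<^sub>F y in nhds (chart_map c p). y \<in> chart_map c ` (chart_dom c \<inter> chart_dom d)"
    using eventually_chart_dom(2)[OF A c]
      eventually_filterlim[OF chart_filterlim(2)[OF A c] eventually_chart_dom(1)[OF A d]]
  proof eventually_elim
    case (elim y)
    then have "chart_inv c y \<in> chart_dom c \<inter> chart_dom d" "chart_map c (chart_inv c y) = y"
      using chart_facts(6,7)[OF A cA(1)] by auto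
    then show ?case by (metis imageI)
  qed
qed

lemma transition_has_derivative:
  assumes "smooth_atlas A" "c \<in> charts_at A p" "d \<in> charts_at A p"
  shows "((chart_map d \<circ> chart_inv c) has_derivative
    frechet_derivative (chart_map d \<circ> chart_inv c) (at (chart_map c p))) (at (chart_map c p))"
  using smooth_at_has_derivative[OF transition_smooth_at[OF assms]] .

lemma transition_derivative_self:
  assumes "smooth_atlas A" "c \<in> charts_at A p"
  shows "frechet_derivative (chart_map c \<circ> chart_inv c) (at (chart_map c p)) v = v"
proof -
  have "((\<lambda>y. y) has_derivative (\<lambda>v. v)) (at (chart_map c p))" by simp
  then have "((chart_map c \<circ> chart_inv c) has_derivative (\<lambda>v. v)) (at (chart_map c p))"
    by (rule has_derivative_transform_within_open[where s="chart_map c ` chart_dom c"])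
      (use chart_facts[OF assms(1)] charts_atD[OF assms(2)] in auto)
  then show ?thesis using frechet_derivative_at by metis
qed

lemma transition_derivative_compose:
  assumes A: "smooth_atlas A" and c: "c \<in> charts_at A p" and d: "d \<in> charts_at A p"
    and e: "e \<in> charts_at A p"
  shows "frechet_derivative (chart_map e \<circ> chart_inv d) (at (chart_map d p))
      (frechet_derivative (chart_map d \<circ> chart_inv c) (at (chart_map c p)) v) =
    frechet_derivative (chart_map e \<circ> chart_inv c) (at (chart_map c p)) v"
proof -
  let ?D = "\<lambda>d c. frechet_derivative (chart_map d \<circ> chart_inv c) (at (chart_map c p))"
  have p: "(chart_map d \<circ> chart_inv c) (chart_map c p) = chart_map d p"
    by (simp add: chart_inv_chart[OF A c])
  have "((\<lambda>y. (chart_map e \<circ> chart_inv d) ((chart_map d \<circ> chart_inv c) y)) has_derivative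
      (\<lambda>v. ?D e d (?D d c v))) (at (chart_map c p))"
    by (rule has_derivative_compose[OF transition_has_derivative[OF A c d]])
      (unfold p, rule transition_has_derivative[OF A d e])
  moreover have "\<forall>\<^sub>F y in nhds (chart_map c p).
      (chart_map e \<circ> chart_inv d) ((chart_map d \<circ> chart_inv c) y) = (chart_map e \<circ> chart_inv c) y"
    using eventually_filterlim[OF chart_filterlim(2)[OF A c] eventually_chart_dom(1)[OF A d]]
    by eventually_elim (simp add: chart_facts(5)[OF A charts_atD(1)[OF d]])
  ultimately have "((chart_map e \<circ> chart_inv c) has_derivative (\<lambda>v. ?D e d (?D d c v)))
      (at (chart_map c p))"
    by (rule has_derivative_cong_nhds)
  then show ?thesis using frechet_derivative_at by metis
qed

lemma coord_vec_in_tangent_space: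
  assumes "smooth_atlas A" "c \<in> charts_at A p"
  shows "coord_vec A c p x \<in> tangent_space A p"
  unfolding tangent_space_def coord_vec_def
  by (auto simp: transition_derivative_compose[OF assms])

lemma coord_vec_self:
  assumes "smooth_atlas A" "c \<in> charts_at A p"
  shows "coord_vec A c p x c = x"
  using assms by (simp add: coord_vec_def transition_derivative_self[OF assms])

lemma tangent_vector_transition:
  assumes "v \<in> tangent_space A p" "c \<in> charts_at A p" "d \<in> charts_at A p"
  shows "v d = frechet_derivative (chart_map d \<circ> chart_inv c) (at (chart_map c p)) (v c)"
  using assms unfolding tangent_space_def by blast

lemma tangent_vector_outside: "v \<in> tangent_space A p \<Longrightarrow> c \<notin> charts_at A p \<Longrightarrow> v c = 0"
  unfolding tangent_space_def by blast

lemma coord_vec_of_coordinates: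
  assumes "v \<in> tangent_space A p" "c \<in> charts_at A p"
  shows "coord_vec A c p (v c) = v"
proof
  fix d
  show "coord_vec A c p (v c) d = v d"
  proof (cases "d \<in> charts_at A p")
    case True
    then show ?thesis by (simp add: coord_vec_def tangent_vector_transition[OF assms True])
  next
    case False
    then show ?thesis by (simp add: coord_vec_def tangent_vector_outside[OF assms(1) False])
  qed
qed

lemma tangent_vector_eqI:
  assumes "v \<in> tangent_space A p" "w \<in> tangent_space A p" "c \<in> charts_at A p" "v c = w c"
  shows "v = w"
  using assms coord_vec_of_coordinates by metis

lemma transition_linear:
  assumes "smooth_atlas A" "c \<in> charts_at A p" "d \<in> charts_at A p"
  shows "linear (frechet_derivative (chart_map d \<circ> chart_inv c) (at (chart_map c p)))"
  using transition_has_derivative[OF assms] has_derivative_linear by blast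

lemma lin_subspace_tangent_space:
  assumes A: "smooth_atlas A"
  shows "lin_subspace (tangent_space A p)"
  unfolding lin_subspace_def
proof (intro conjI ballI allI)
  show "(\<lambda>c. 0) \<in> tangent_space A p"
    by (simp add: tangent_space_def linear_0[OF transition_linear[OF A]])
  fix v w a b assume v: "v \<in> tangent_space A p" and w: "w \<in> tangent_space A p"
  have "a *\<^sub>R v d + b *\<^sub>R w d = frechet_derivative (chart_map d \<circ> chart_inv c) (at (chart_map c p))
      (a *\<^sub>R v c + b *\<^sub>R w c)" if c: "c \<in> charts_at A p" and d: "d \<in> charts_at A p" for c d
    unfolding tangent_vector_transition[OF v c d] tangent_vector_transition[OF w c d]
    by (simp add: linear_add[OF transition_linear[OF A c d]] linear_scale[OF transition_linear[OF A c d]])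
  moreover have "a *\<^sub>R v c + b *\<^sub>R w c = 0" if "c \<notin> charts_at A p" for c
    by (simp add: tangent_vector_outside[OF v that] tangent_vector_outside[OF w that])
  ultimately show "(\<lambda>c. a *\<^sub>R v c + b *\<^sub>R w c) \<in> tangent_space A p"
    unfolding tangent_space_def by blast
qed

lemma coord_vec_linear:
  assumes "smooth_atlas A" "c \<in> charts_at A p"
  shows "linear (\<lambda>x. coord_vec A c p x d)"
proof (cases "d \<in> charts_at A p")
  case True
  then show ?thesis using transition_linear[OF assms True] by (simp add: coord_vec_def)
next
  case False
  then show ?thesis by (simp add: coord_vec_def linear_zero)
qed


section \<open>Velocities of curves\<close>

text \<open>
  The curve needs to be defined well only near 0, so all conditions on curves are stated eventually.
  Since the manifold need not be Hausdorff, the value at 0 is prescribed and staying in a chart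
  near 0 is required separately; together they replace continuity.
\<close>
definition has_velocity ::
    "('a::topological_space, 'e::real_normed_vector) chart set \<Rightarrow> (real \<Rightarrow> 'a) \<Rightarrow> 'a \<Rightarrow>
      ('a, 'e) tvec \<Rightarrow> bool"
  where "has_velocity A \<gamma> p v \<longleftrightarrow> \<gamma> 0 = p \<and> v \<in> tangent_space A p \<and>
    (\<forall>c\<in>charts_at A p. (\<forall>\<^sub>F \<tau> in nhds 0. \<gamma> \<tau> \<in> chart_dom c) \<and>
      ((\<lambda>\<tau>. chart_map c (\<gamma> \<tau>)) has_vector_derivative v c) (at 0))"

lemma has_velocityD:
  assumes "has_velocity A \<gamma> p v"
  shows "\<gamma> 0 = p" "v \<in> tangent_space A p"
    "c \<in> charts_at A p \<Longrightarrow> \<forall>\<^sub>F \<tau> in nhds 0. \<gamma> \<tau> \<in> chart_dom c"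
    "c \<in> charts_at A p \<Longrightarrow> ((\<lambda>\<tau>. chart_map c (\<gamma> \<tau>)) has_vector_derivative v c) (at 0)"
  using assms unfolding has_velocity_def by auto

lemma vector_derivative_filterlim:
  fixes f :: "real \<Rightarrow> 'a::real_normed_vector"
  assumes "(f has_vector_derivative v) (at 0)"
  shows "filterlim f (nhds (f 0)) (nhds 0)"
  using has_vector_derivative_continuous[OF assms] by (metis continuous_at tendsto_nhds_iff)

lemma has_vector_derivative_cong_nhds:
  fixes f :: "real \<Rightarrow> 'a::real_normed_vector"
  assumes "(f has_vector_derivative v) (at 0)" "\<forall>\<^sub>F \<tau> in nhds 0. f \<tau> = g \<tau>"
  shows "(g has_vector_derivative v) (at 0)"
  using assms has_derivative_cong_nhds unfolding has_vector_derivative_def by blast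

lemma has_velocity_coord_vec:
  assumes A: "smooth_atlas A" and c: "c \<in> charts_at A p" and "\<gamma> 0 = p"
    and ev: "\<forall>\<^sub>F \<tau> in nhds 0. \<gamma> \<tau> \<in> chart_dom c"
    and der: "((\<lambda>\<tau>. chart_map c (\<gamma> \<tau>)) has_vector_derivative w) (at 0)"
  shows "has_velocity A \<gamma> p (coord_vec A c p w)"
  unfolding has_velocity_def
proof (intro conjI ballI coord_vec_in_tangent_space[OF A c])
  show "\<gamma> 0 = p" by fact
  fix d assume d: "d \<in> charts_at A p"
  note inv = chart_facts(5)[OF A charts_atD(1)[OF c]]
  have lim: "filterlim (\<lambda>\<tau>. chart_map c (\<gamma> \<tau>)) (nhds (chart_map c p)) (nhds 0)"
    using vector_derivative_filterlim[OF der] \<open>\<gamma> 0 = p\<close> by simp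
  have "\<forall>\<^sub>F \<tau> in nhds 0. chart_inv c (chart_map c (\<gamma> \<tau>)) \<in> chart_dom d"
    using eventually_filterlim[OF filterlim_compose[OF chart_filterlim(2)[OF A c] lim]
        eventually_chart_dom(1)[OF A d]] .
  with ev show "\<forall>\<^sub>F \<tau> in nhds 0. \<gamma> \<tau> \<in> chart_dom d" by eventually_elim (simp add: inv)
  define t where "t = chart_map d \<circ> chart_inv c"
  let ?D = "frechet_derivative t (at (chart_map c p))"
  have t: "(t has_derivative ?D) (at (chart_map c (\<gamma> 0)))"
    using transition_has_derivative[OF A c d] by (simp only: t_def \<open>\<gamma> 0 = p\<close>)
  have "((\<lambda>\<tau>. t (chart_map c (\<gamma> \<tau>))) has_derivative (\<lambda>r. ?D (r *\<^sub>R w))) (at 0)"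
    by (rule has_derivative_compose[OF der[unfolded has_vector_derivative_def] t])
  moreover have "?D w = coord_vec A c p w d" by (simp only: coord_vec_def d t_def if_True)
  ultimately have "((\<lambda>\<tau>. t (chart_map c (\<gamma> \<tau>))) has_vector_derivative coord_vec A c p w d) (at 0)"
    by (simp add: has_vector_derivative_def linear_scale[OF has_derivative_linear[OF t]])
  then show "((\<lambda>\<tau>. chart_map d (\<gamma> \<tau>)) has_vector_derivative coord_vec A c p w d) (at 0)"
    by (rule has_vector_derivative_cong_nhds) (use ev in eventually_elim, simp add: t_def inv)
qed

lemma has_velocityI:
  assumes A: "smooth_atlas A" and "\<gamma> 0 = p"
    and dom: "\<And>c. c \<in> charts_at A p \<Longrightarrow> \<forall>\<^sub>F \<tau> in nhds 0. \<gamma> \<tau> \<in> chart_dom c"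
    and der: "\<And>c. c \<in> charts_at A p \<Longrightarrow>
      ((\<lambda>\<tau>. chart_map c (\<gamma> \<tau>)) has_vector_derivative v c) (at 0)"
    and out: "\<And>c. c \<notin> charts_at A p \<Longrightarrow> v c = 0"
  shows "has_velocity A \<gamma> p v"
proof -
  obtain d where d: "d \<in> charts_at A p" using charts_at_nonempty[OF A] by blast
  have vel: "has_velocity A \<gamma> p (coord_vec A d p (v d))"
    by (rule has_velocity_coord_vec[OF A d assms(2) dom[OF d] der[OF d]])
  have "v e = coord_vec A d p (v d) e" for e
  proof (cases "e \<in> charts_at A p")
    case True
    then show ?thesis using der[OF True] has_velocityD(4)[OF vel True] vector_derivative_unique_at by blast
  qed (simp add: out coord_vec_def)
  then have "v = coord_vec A d p (v d)" by blast
  then show ?thesis using vel by simp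
qed

lemma has_velocity_unique:
  assumes "smooth_atlas A" "has_velocity A \<gamma> p v" "has_velocity A \<delta> p w"
    and "\<forall>\<^sub>F \<tau> in nhds 0. \<gamma> \<tau> = \<delta> \<tau>"
  shows "v = w"
proof -
  obtain c where c: "c \<in> charts_at A p" using charts_at_nonempty[OF assms(1)] by blast
  have "((\<lambda>\<tau>. chart_map c (\<delta> \<tau>)) has_vector_derivative v c) (at 0)"
    using has_vector_derivative_cong_nhds[OF has_velocityD(4)[OF assms(2) c]]
      eventually_mono[OF assms(4)] by (metis (mono_tags, lifting))
  then have "v c = w c"
    using has_velocityD(4)[OF assms(3) c] vector_derivative_unique_at by blast
  then show ?thesis
    using tangent_vector_eqI[OF has_velocityD(2)[OF assms(2)] has_velocityD(2)[OF assms(3)] c] by blast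
qed

lemma has_velocity_chart_curve:
  assumes A: "smooth_atlas A" and c: "c \<in> charts_at A p" and x: "x 0 = chart_map c p"
    and der: "(x has_vector_derivative w) (at 0)"
  shows "has_velocity A (\<lambda>\<tau>. chart_inv c (x \<tau>)) p (coord_vec A c p w)"
    "\<forall>\<^sub>F \<tau> in nhds 0. x \<tau> \<in> chart_map c ` chart_dom c"
proof -
  have lim: "filterlim x (nhds (chart_map c p)) (nhds 0)"
    using vector_derivative_filterlim[OF der] x by simp
  show im: "\<forall>\<^sub>F \<tau> in nhds 0. x \<tau> \<in> chart_map c ` chart_dom c"
    using eventually_filterlim[OF lim eventually_chart_dom(2)[OF A c]] .
  note facts = chart_facts[OF A charts_atD(1)[OF c]]
  show "has_velocity A (\<lambda>\<tau>. chart_inv c (x \<tau>)) p (coord_vec A c p w)"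
  proof (rule has_velocity_coord_vec[OF A c])
    show "chart_inv c (x 0) = p" by (simp add: x chart_inv_chart[OF A c])
    show "\<forall>\<^sub>F \<tau> in nhds 0. chart_inv c (x \<tau>) \<in> chart_dom c"
      using im by eventually_elim (rule facts(7))
    show "((\<lambda>\<tau>. chart_map c (chart_inv c (x \<tau>))) has_vector_derivative w) (at 0)"
      by (rule has_vector_derivative_cong_nhds[OF der])
        (use im in eventually_elim, simp add: facts(6))
  qed
qed

lemma has_velocity_exists:
  assumes A: "smooth_atlas A" and v: "v \<in> tangent_space A p"
  obtains \<gamma> where "has_velocity A \<gamma> p v"
proof -
  obtain c where c: "c \<in> charts_at A p" using charts_at_nonempty[OF A] by blast
  have "((\<lambda>\<tau>. chart_map c p + \<tau> *\<^sub>R v c) has_vector_derivative v c) (at 0)"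
    by (auto intro!: derivative_eq_intros simp: has_vector_derivative_def)
  from has_velocity_chart_curve(1)[OF A c _ this] show ?thesis
    using that coord_vec_of_coordinates[OF v c] by auto
qed

lemma has_velocity_const:
  assumes A: "smooth_atlas A"
  shows "has_velocity A (\<lambda>\<tau>. p) p (\<lambda>c. 0)"
  using lin_subspace_tangent_space[OF A] charts_atD
  by (auto simp: has_velocity_def lin_subspace_def has_vector_derivative_const)

lemma has_velocity_filterlim:
  assumes A: "smooth_atlas A" and "has_velocity A \<gamma> p v"
  shows "filterlim \<gamma> (nhds p) (nhds 0)"
proof -
  obtain c where c: "c \<in> charts_at A p" using charts_at_nonempty[OF A] by blast
  have "filterlim (\<lambda>\<tau>. chart_map c (\<gamma> \<tau>)) (nhds (chart_map c p)) (nhds 0)"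
    using vector_derivative_filterlim[OF has_velocityD(4)[OF assms(2) c]] has_velocityD(1)[OF assms(2)]
    by simp
  then have "filterlim (\<lambda>\<tau>. chart_inv c (chart_map c (\<gamma> \<tau>))) (nhds p) (nhds 0)"
    using filterlim_compose[OF chart_filterlim(2)[OF A c]] by blast
  moreover have "\<forall>\<^sub>F \<tau> in nhds 0. chart_inv c (chart_map c (\<gamma> \<tau>)) = \<gamma> \<tau>"
    using has_velocityD(3)[OF assms(2) c]
    by eventually_elim (rule chart_facts(5)[OF A charts_atD(1)[OF c]])
  ultimately show ?thesis using filterlim_cong by fast
qed


section \<open>Differentials of smooth maps\<close>

text \<open>
  The charts that witness smoothness can be exchanged for any others by composing the local
  representative with transition maps.
\<close>
lemma smooth_map_germ:
  assumes A: "smooth_atlas (A :: ('a::topological_space, 'e::banach) chart set)"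
    and B: "smooth_atlas (B :: ('b::topological_space, 'f::banach) chart set)"
    and f: "smooth_map A B S f" and p: "p \<in> S"
    and c: "c \<in> charts_at A p" and d: "d \<in> charts_at B (f p)"
  obtains h where "smooth_at (chart_map c p) h"
    "\<forall>\<^sub>F x in nhds p. x \<in> S \<longrightarrow> f x \<in> chart_dom d \<and> h (chart_map c x) = chart_map d (f x)"
proof -
  obtain c' d' W h' where c': "c' \<in> charts_at A p" and d': "d' \<in> charts_at B (f p)"
    and W: "open W" "p \<in> W" "W \<subseteq> chart_dom c'" and h': "smooth_on (chart_map c' ` W) h'"
    and eq: "\<forall>x\<in>W \<inter> S. f x \<in> chart_dom d' \<and> h' (chart_map c' x) = chart_map d' (f x)"
    using f[unfolded smooth_map_def, THEN bspec, OF p] by metis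
  obtain BA \<kappa>A where BA: "coordinate_system (BA :: 'e set) \<kappa>A" using smooth_atlas_coordinates[OF A] .
  obtain BB \<kappa>B where BB: "coordinate_system (BB :: 'f set) \<kappa>B" using smooth_atlas_coordinates[OF B] .
  note c'A = chart_facts[OF A charts_atD(1)[OF c']]
  have h'_at: "smooth_at (chart_map c' p) h'"
  proof (rule smooth_on_eventually_imp_smooth_at[OF h'])
    have "\<forall>\<^sub>F x in nhds p. x \<in> W" using W eventually_nhds by blast
    from eventually_filterlim[OF chart_filterlim(2)[OF A c'] this] eventually_chart_dom(2)[OF A c']
    show "\<forall>\<^sub>F y in nhds (chart_map c' p). y \<in> chart_map c' ` W"
      by eventually_elim (metis c'A(6) imageI)
  qed
  have h'p: "h' (chart_map c' p) = chart_map d' (f p)" using bspec[OF eq, of p] W(2) p by simp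
  have c'c: "(chart_map c' \<circ> chart_inv c) (chart_map c p) = chart_map c' p"
    by (simp add: chart_inv_chart[OF A c])
  define h where "h y = (chart_map d \<circ> chart_inv d') (h' ((chart_map c' \<circ> chart_inv c) y))" for y
  have "smooth_at (chart_map c p) (\<lambda>y. h' ((chart_map c' \<circ> chart_inv c) y))"
    by (rule smooth_at_compose[OF BA _ transition_smooth_at[OF A c c']]) (unfold c'c, rule h'_at)
  then have "smooth_at (chart_map c p) h"
    unfolding h_def
    by (rule smooth_at_compose[OF BB, rotated])
      (unfold c'c h'p, rule transition_smooth_at[OF B d' d])
  moreover have "\<forall>\<^sub>F x in nhds p. x \<in> S \<longrightarrow> f x \<in> chart_dom d \<and> h (chart_map c x) = chart_map d (f x)"
  proof -
    have ev1: "\<forall>\<^sub>F x in nhds p. x \<in> W" using W eventually_nhds by blast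
    have "filterlim (\<lambda>x. h' (chart_map c' x)) (nhds (chart_map d' (f p))) (nhds p)"
      using filterlim_compose[OF smooth_at_tendsto[OF h'_at] chart_filterlim(1)[OF A c']]
      by (simp add: h'p)
    from eventually_filterlim[OF filterlim_compose[OF chart_filterlim(2)[OF B d'] this]
        eventually_chart_dom(1)[OF B d]]
    have ev2: "\<forall>\<^sub>F x in nhds p. chart_inv d' (h' (chart_map c' x)) \<in> chart_dom d" .
    show ?thesis
      using ev1 ev2 eventually_chart_dom(1)[OF A c]
    proof eventually_elim
      case (elim x)
      show ?case
      proof
        assume "x \<in> S"
        then have fx: "f x \<in> chart_dom d'" "h' (chart_map c' x) = chart_map d' (f x)"
          using bspec[OF eq, of x] elim(1) by simp_all
        have "chart_inv d' (h' (chart_map c' x)) = f x"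
          using fx chart_facts(5)[OF B charts_atD(1)[OF d']] by simp
        moreover have "chart_inv c (chart_map c x) = x"
          using chart_facts(5)[OF A charts_atD(1)[OF c]] elim by blast
        ultimately show "f x \<in> chart_dom d \<and> h (chart_map c x) = chart_map d (f x)"
          using elim by (simp add: h_def)
      qed
    qed
  qed
  ultimately show ?thesis using that by blast
qed

lemma mdiff_coordinate_has_derivative:
  assumes A: "smooth_atlas A"
    and B: "smooth_atlas B"
    and f: "smooth_map A B S f" and p: "p \<in> S"
    and c: "c \<in> charts_at A p" and d: "d \<in> charts_at B (f p)"
  shows "((chart_map d \<circ> f \<circ> chart_inv c) has_derivative
    frechet_derivative (chart_map d \<circ> f \<circ> chart_inv c)
      (at (chart_map c p) within chart_map c ` (S \<inter> chart_dom c)))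
    (at (chart_map c p) within chart_map c ` (S \<inter> chart_dom c))"
proof -
  let ?T = "chart_map c ` (S \<inter> chart_dom c)"
  obtain h where h: "smooth_at (chart_map c p) h"
    "\<forall>\<^sub>F x in nhds p. x \<in> S \<longrightarrow> f x \<in> chart_dom d \<and> h (chart_map c x) = chart_map d (f x)"
    using smooth_map_germ[OF assms] .
  note cA = chart_facts[OF A charts_atD(1)[OF c]]
  have hd: "(h has_derivative frechet_derivative h (at (chart_map c p))) (at (chart_map c p) within ?T)"
    using smooth_at_has_derivative[OF h(1)] by (rule has_derivative_at_withinI)
  have "\<forall>\<^sub>F y in nhds (chart_map c p). y \<in> ?T \<longrightarrow> h y = (chart_map d \<circ> f \<circ> chart_inv c) y"
    using eventually_filterlim[OF chart_filterlim(2)[OF A c] h(2)]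
    by eventually_elim (auto simp: cA(5))
  then have ev: "\<forall>\<^sub>F y in at (chart_map c p) within ?T. h y = (chart_map d \<circ> f \<circ> chart_inv c) y"
    unfolding eventually_at_filter by eventually_elim auto
  have "h (chart_map c p) = (chart_map d \<circ> f \<circ> chart_inv c) (chart_map c p)"
    using eventually_nhds_x_imp_x[OF h(2)] p by (simp add: chart_inv_chart[OF A c])
  from has_derivative_transform_eventually[OF hd ev this] p charts_atD(2)[OF c]
  have "((chart_map d \<circ> f \<circ> chart_inv c) has_derivative frechet_derivative h (at (chart_map c p)))
      (at (chart_map c p) within ?T)" by blast
  then show ?thesis using frechet_derivative_works differentiable_def by blast
qed

text \<open>
  For a curve inside \<open>S\<close> the derivative within \<open>S\<close> is evaluated on a vector tangent to \<open>S\<close>, where it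
  does not depend on the choice made for it.  Every identity between differentials below is
  an identity between curves, read off with this lemma and the uniqueness of velocities.
\<close>
lemma has_velocity_mdiff:
  assumes A: "smooth_atlas A"
    and B: "smooth_atlas B"
    and f: "smooth_map A B S f" and \<gamma>: "has_velocity A \<gamma> p v"
    and S: "\<forall>\<^sub>F \<tau> in nhds 0. \<gamma> \<tau> \<in> S"
  shows "has_velocity B (\<lambda>\<tau>. f (\<gamma> \<tau>)) (f p) (mdiff A B S f p v)"
proof -
  define c where "c = chart_at A p"
  have c: "c \<in> charts_at A p" unfolding c_def by (rule chart_at_in[OF A])
  note cA = chart_facts[OF A charts_atD(1)[OF c]]
  have \<gamma>0: "\<gamma> 0 = p" by (rule has_velocityD[OF \<gamma>])
  have p: "p \<in> S" using eventually_nhds_x_imp_x[OF S] \<gamma>0 by simp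
  obtain T where T: "open T" "0 \<in> T" "\<And>\<tau>. \<tau> \<in> T \<Longrightarrow> \<gamma> \<tau> \<in> S \<inter> chart_dom c"
    using eventually_conj[OF S has_velocityD(3)[OF \<gamma> c]] unfolding eventually_nhds by auto
  let ?R = "chart_map c ` (S \<inter> chart_dom c)"
  have der: "((\<lambda>\<tau>. chart_map d (f (\<gamma> \<tau>))) has_vector_derivative mdiff A B S f p v d) (at 0)"
    and dom: "\<forall>\<^sub>F \<tau> in nhds 0. f (\<gamma> \<tau>) \<in> chart_dom d"
    if d: "d \<in> charts_at B (f p)" for d
  proof -
    define g where "g = chart_map d \<circ> f \<circ> chart_inv c"
    define D where "D = frechet_derivative g (at (chart_map c p) within ?R)"
    have der_g: "(g has_derivative D) (at (chart_map c p) within ?R)"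
      unfolding D_def g_def by (rule mdiff_coordinate_has_derivative[OF A B f p c d])
    have "((\<lambda>\<tau>. chart_map c (\<gamma> \<tau>)) has_derivative (\<lambda>t. t *\<^sub>R v c)) (at 0 within T)"
      using has_velocityD(4)[OF \<gamma> c] unfolding has_vector_derivative_def
      by (rule has_derivative_at_withinI)
    moreover have "(g has_derivative D) (at (chart_map c (\<gamma> 0)) within (\<lambda>\<tau>. chart_map c (\<gamma> \<tau>)) ` T)"
      unfolding \<gamma>0 by (rule has_derivative_subset[OF der_g]) (use T(3) in auto)
    ultimately have "((\<lambda>\<tau>. g (chart_map c (\<gamma> \<tau>))) has_derivative (\<lambda>t. D (t *\<^sub>R v c))) (at 0 within T)"
      by (rule has_derivative_in_compose)
    then have "((\<lambda>\<tau>. g (chart_map c (\<gamma> \<tau>))) has_vector_derivative D (v c)) (at 0)"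
      unfolding has_vector_derivative_def linear_scale[OF has_derivative_linear[OF der_g]]
      by (simp only: at_within_open[OF T(2,1)])
    moreover have "D (v c) = mdiff A B S f p v d" using d by (simp add: mdiff_def c_def[symmetric] D_def g_def)
    moreover have "\<forall>\<^sub>F \<tau> in nhds 0. g (chart_map c (\<gamma> \<tau>)) = chart_map d (f (\<gamma> \<tau>))"
      using has_velocityD(3)[OF \<gamma> c] by eventually_elim (simp add: g_def cA(5))
    ultimately show "((\<lambda>\<tau>. chart_map d (f (\<gamma> \<tau>))) has_vector_derivative mdiff A B S f p v d) (at 0)"
      using has_vector_derivative_cong_nhds by metis
    obtain h where h: "smooth_at (chart_map c p) h"
      "\<forall>\<^sub>F x in nhds p. x \<in> S \<longrightarrow> f x \<in> chart_dom d \<and> h (chart_map c x) = chart_map d (f x)"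
      using smooth_map_germ[OF A B f p c d] .
    show "\<forall>\<^sub>F \<tau> in nhds 0. f (\<gamma> \<tau>) \<in> chart_dom d"
      using eventually_filterlim[OF has_velocity_filterlim[OF A \<gamma>] h(2)] S by eventually_elim simp
  qed
  show ?thesis
    by (rule has_velocityI[OF B _ dom der]) (simp_all add: \<gamma>0 mdiff_def Let_def)
qed

lemma mdiff_linear_combination:
  assumes A: "smooth_atlas A"
    and B: "smooth_atlas B"
    and f: "smooth_map A B S f" and p: "p \<in> S"
  shows "mdiff A B S f p (\<lambda>c. a *\<^sub>R v c + b *\<^sub>R w c) =
    (\<lambda>d. a *\<^sub>R mdiff A B S f p v d + b *\<^sub>R mdiff A B S f p w d)"
proof
  fix d
  show "mdiff A B S f p (\<lambda>c. a *\<^sub>R v c + b *\<^sub>R w c) d =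
    a *\<^sub>R mdiff A B S f p v d + b *\<^sub>R mdiff A B S f p w d"
  proof (cases "d \<in> charts_at B (f p)")
    case True
    note lin = has_derivative_linear[OF mdiff_coordinate_has_derivative[OF A B f p chart_at_in[OF A] True]]
    show ?thesis
      using True by (simp add: mdiff_def Let_def linear_add[OF lin] linear_scale[OF lin])
  qed (simp add: mdiff_def Let_def)
qed

lemma mdiff_in_tangent_space:
  assumes "smooth_atlas A"
    and "smooth_atlas B"
    and "smooth_map A B UNIV f" "v \<in> tangent_space A p"
  shows "mdiff A B UNIV f p v \<in> tangent_space B (f p)"
proof -
  obtain \<gamma> where "has_velocity A \<gamma> p v" using has_velocity_exists[OF assms(1,4)] .
  from has_velocityD(2)[OF has_velocity_mdiff[OF assms(1-3) this]] show ?thesis by simp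
qed

text \<open>
  The differential computed with any charts and any local representative, for vectors that are
  velocities of curves in \<open>S\<close>.
\<close>
lemma mdiff_germ:
  assumes A: "smooth_atlas A"
    and B: "smooth_atlas B"
    and f: "smooth_map A B S f" and \<gamma>: "has_velocity A \<gamma> p v"
    and S: "\<forall>\<^sub>F \<tau> in nhds 0. \<gamma> \<tau> \<in> S"
    and c: "c \<in> charts_at A p" and d: "d \<in> charts_at B (f p)"
    and h: "smooth_at (chart_map c p) h"
      "\<forall>\<^sub>F x in nhds p. x \<in> S \<longrightarrow> h (chart_map c x) = chart_map d (f x)"
  shows "mdiff A B S f p v d = frechet_derivative h (at (chart_map c p)) (v c)"
proof -
  let ?D = "frechet_derivative h (at (chart_map c p))"
  have \<gamma>0: "\<gamma> 0 = p" by (rule has_velocityD[OF \<gamma>])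
  have D: "(h has_derivative ?D) (at (chart_map c (\<gamma> 0)))"
    unfolding \<gamma>0 by (rule smooth_at_has_derivative[OF h(1)])
  have "((\<lambda>\<tau>. h (chart_map c (\<gamma> \<tau>))) has_derivative (\<lambda>t. ?D (t *\<^sub>R v c))) (at 0)"
    by (rule has_derivative_compose[OF has_velocityD(4)[OF \<gamma> c, unfolded has_vector_derivative_def] D])
  then have "((\<lambda>\<tau>. h (chart_map c (\<gamma> \<tau>))) has_vector_derivative ?D (v c)) (at 0)"
    unfolding has_vector_derivative_def linear_scale[OF has_derivative_linear[OF D]] .
  moreover have "\<forall>\<^sub>F \<tau> in nhds 0. h (chart_map c (\<gamma> \<tau>)) = chart_map d (f (\<gamma> \<tau>))"
    using eventually_filterlim[OF has_velocity_filterlim[OF A \<gamma>] h(2)] S by eventually_elim simp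
  ultimately have "((\<lambda>\<tau>. chart_map d (f (\<gamma> \<tau>))) has_vector_derivative ?D (v c)) (at 0)"
    by (rule has_vector_derivative_cong_nhds)
  then show ?thesis
    using has_velocityD(4)[OF has_velocity_mdiff[OF A B f \<gamma> S] d] vector_derivative_unique_at by blast
qed

text \<open>
  In charts this is \<open>curve_lift\<close>; surjectivity of the differential on tangent spaces gives the
  surjectivity of the derivative of the local representative.
\<close>
lemma velocity_lift:
  assumes A: "smooth_atlas (A :: ('a::topological_space, 'e::banach) chart set)"
    and C: "smooth_atlas (C :: ('c::topological_space, 'n::banach) chart set)"
    and f: "submersion A C f" and X: "X \<in> tangent_space A p"
    and k: "has_velocity C k (f p) (mdiff A C UNIV f p X)"
  obtains \<gamma> where "has_velocity A \<gamma> p X" "\<forall>\<^sub>F \<tau> in nhds 0. f (\<gamma> \<tau>) = k \<tau>"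
proof -
  have sm: "smooth_map A C UNIV f"
    and sub: "mdiff A C UNIV f p ` tangent_space A p = tangent_space C (f p)"
    using f by (auto simp: submersion_def)
  obtain BA \<kappa>A where BA: "coordinate_system (BA :: 'e set) \<kappa>A" using smooth_atlas_coordinates[OF A] .
  obtain BC \<kappa>C where BC: "coordinate_system (BC :: 'n set) \<kappa>C" using smooth_atlas_coordinates[OF C] .
  obtain c d where c: "c \<in> charts_at A p" and d: "d \<in> charts_at C (f p)"
    using charts_at_nonempty A C by metis
  obtain h where h: "smooth_at (chart_map c p) h"
    "\<forall>\<^sub>F x in nhds p. x \<in> UNIV \<longrightarrow> f x \<in> chart_dom d \<and> h (chart_map c x) = chart_map d (f x)"
    using smooth_map_germ[OF A C sm UNIV_I c d] .
  let ?D = "frechet_derivative h (at (chart_map c p))"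
  have coord: "mdiff A C UNIV f p v d = ?D (v c)" if v: "v \<in> tangent_space A p" for v
  proof -
    obtain \<gamma> where "has_velocity A \<gamma> p v" using has_velocity_exists[OF A v] .
    moreover have "\<forall>\<^sub>F x in nhds p. x \<in> UNIV \<longrightarrow> h (chart_map c x) = chart_map d (f x)"
      using h(2) by eventually_elim simp
    ultimately show ?thesis using mdiff_germ[OF A C sm _ _ c d h(1)] by simp
  qed
  have "surj ?D"
    unfolding surj_def
  proof
    fix w
    have "coord_vec C d (f p) w \<in> mdiff A C UNIV f p ` tangent_space A p"
      unfolding sub by (rule coord_vec_in_tangent_space[OF C d])
    then obtain v where "v \<in> tangent_space A p" "coord_vec C d (f p) w = mdiff A C UNIV f p v" by blast
    then have "?D (v c) = coord_vec C d (f p) w d" using coord by simp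
    then show "\<exists>x. w = ?D x" using coord_vec_self[OF C d] by metis
  qed
  moreover have "chart_map d (k 0) = h (chart_map c p)"
    using eventually_nhds_x_imp_x[OF h(2)] has_velocityD(1)[OF k] by simp
  moreover have "((\<lambda>\<tau>. chart_map d (k \<tau>)) has_vector_derivative ?D (X c)) (at 0)"
    using has_velocityD(4)[OF k d] coord[OF X] by simp
  ultimately obtain x where x: "x 0 = chart_map c p" "(x has_vector_derivative X c) (at 0)"
    "\<forall>\<^sub>F \<tau> in nhds 0. h (x \<tau>) = chart_map d (k \<tau>)"
    using curve_lift[OF BA BC h(1), of "\<lambda>\<tau>. chart_map d (k \<tau>)" "X c"] by blast
  note vel = has_velocity_chart_curve[OF A c x(1,2)]
  have "has_velocity A (\<lambda>\<tau>. chart_inv c (x \<tau>)) p X"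
    using vel(1) coord_vec_of_coordinates[OF X c] by simp
  moreover have "\<forall>\<^sub>F \<tau> in nhds 0. f (chart_inv c (x \<tau>)) = k \<tau>"
    using eventually_filterlim[OF has_velocity_filterlim[OF A vel(1)] h(2)] vel(2) x(3)
      has_velocityD(3)[OF k d]
  proof eventually_elim
    case (elim \<tau>)
    then have "chart_map d (f (chart_inv c (x \<tau>))) = chart_map d (k \<tau>)"
      using chart_facts(6)[OF A charts_atD(1)[OF c]] by simp
    then show ?case using elim chart_facts(5)[OF C charts_atD(1)[OF d]] by (metis UNIV_I)
  qed
  ultimately show ?thesis using that by blast
qed

section \<open>Products of manifolds\<close>

lemma prod_chart_simps [simp]:
  "chart_dom (prod_chart c d) = chart_dom c \<times> chart_dom d"
  "chart_map (prod_chart c d) (x, y) = (chart_map c x, chart_map d y)"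
  by (simp_all add: prod_chart_def)

lemma prod_chart_image:
  "chart_map (prod_chart c d) ` (S \<times> T) = (chart_map c ` S) \<times> (chart_map d ` T)"
  by (auto simp: prod_chart_def image_iff)

lemma charts_at_prod_atlas:
  "e \<in> charts_at (prod_atlas A B) (p, q) \<longleftrightarrow>
    (\<exists>c\<in>charts_at A p. \<exists>d\<in>charts_at B q. e = prod_chart c d)"
  unfolding charts_at_def prod_atlas_def mem_Collect_eq
  by (metis (lifting) mem_Collect_eq mem_Sigma_iff prod_chart_simps(1))

lemma prod_atlasE:
  assumes "e \<in> prod_atlas A B"
  obtains c d where "e = prod_chart c d" "c \<in> A" "d \<in> B"
  using assms unfolding prod_atlas_def by blast

lemma charts_at_prod_atlasE:
  assumes "e \<in> charts_at (prod_atlas A B) (p, q)"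
  obtains c d where "c \<in> charts_at A p" "d \<in> charts_at B q" "e = prod_chart c d"
  using assms unfolding charts_at_prod_atlas by (elim bexE)

lemma prod_chart_in: "c \<in> charts_at A p \<Longrightarrow> d \<in> charts_at B q \<Longrightarrow>
    prod_chart c d \<in> charts_at (prod_atlas A B) (p, q)"
  unfolding charts_at_prod_atlas by (rule bexI[of _ c], rule bexI[of _ d], rule refl)

lemma prod_chart_inv:
  assumes A: "smooth_atlas A" and B: "smooth_atlas B" and c: "c \<in> A" and d: "d \<in> B"
    and u: "u \<in> chart_map c ` chart_dom c" and v: "v \<in> chart_map d ` chart_dom d"
  shows "chart_inv (prod_chart c d) (u, v) = (chart_inv c u, chart_inv d v)"
proof -
  note cf = chart_facts[OF A c] and df = chart_facts[OF B d]
  have "inj_on (chart_map (prod_chart c d)) (chart_dom (prod_chart c d))"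
    by (rule inj_onI) (auto, (metis cf(5) df(5))+)
  from inv_into_f_f[OF this, of "(chart_inv c u, chart_inv d v)"] show ?thesis
    using cf(6,7) df(6,7) u v by (simp add: chart_inv_def[of "prod_chart c d"])
qed

lemma smooth_atlas_prod:
  assumes A: "smooth_atlas (A :: ('a::topological_space, 'e::banach) chart set)"
    and B: "smooth_atlas (B :: ('b::topological_space, 'f::banach) chart set)"
  shows "smooth_atlas (prod_atlas A B)"
proof -
  obtain BA :: "'e set" where BA: "finite BA" "span BA = UNIV"
    using A unfolding smooth_atlas_def by blast
  obtain BB :: "'f set" where BB: "finite BB" "span BB = UNIV"
    using B unfolding smooth_atlas_def by blast
  obtain KA \<kappa>A where KA: "coordinate_system (KA :: 'e set) \<kappa>A" using smooth_atlas_coordinates[OF A] .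
  obtain KB \<kappa>B where KB: "coordinate_system (KB :: 'f set) \<kappa>B" using smooth_atlas_coordinates[OF B] .
  define E where "E = (\<lambda>x. (x, 0 :: 'f)) ` BA \<union> (\<lambda>y. (0 :: 'e, y)) ` BB"
  have "finite E" using BA BB by (simp add: E_def)
  moreover have "span E = UNIV"
  proof -
    have l: "linear (\<lambda>x::'e. (x, 0 :: 'f))" "linear (\<lambda>y::'f. (0 :: 'e, y))"
      by (simp_all add: linear_iff)
    have "(x, y) \<in> span E" for x y
    proof -
      have "(x, 0) \<in> span ((\<lambda>x. (x, 0 :: 'f)) ` BA)"
        unfolding linear_span_image[OF l(1)] BA(2) by simp
      moreover have "(0, y) \<in> span ((\<lambda>y. (0 :: 'e, y)) ` BB)"
        unfolding linear_span_image[OF l(2)] BB(2) by simp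
      ultimately have "(x, 0) \<in> span E" "(0, y) \<in> span E"
        using span_mono[of "(\<lambda>x. (x, 0)) ` BA" E] span_mono[of "(\<lambda>y. (0, y)) ` BB" E]
        unfolding E_def by blast+
      from span_add[OF this] show ?thesis by simp
    qed
    then show ?thesis by auto
  qed
  ultimately have ex: "\<exists>E::('e \<times> 'f) set. finite E \<and> span E = UNIV" by blast
  have ne: "\<forall>p. charts_at (prod_atlas A B) p \<noteq> {}"
  proof
    fix p :: "'a \<times> 'b"
    obtain c d where "c \<in> charts_at A (fst p)" "d \<in> charts_at B (snd p)"
      using charts_at_nonempty A B by metis
    from prod_chart_in[OF this] show "charts_at (prod_atlas A B) p \<noteq> {}" by auto
  qed
  have homeo: "open (chart_dom e) \<and> open (chart_map e ` chart_dom e) \<and>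
      homeomorphism (chart_dom e) (chart_map e ` chart_dom e) (chart_map e) (chart_inv e)"
    if e_in: "e \<in> prod_atlas A B" for e
  proof -
    obtain c d where e: "e = prod_chart c d" and c: "c \<in> A" and d: "d \<in> B"
      using prod_atlasE[OF e_in] .
    note cf = chart_facts[OF A c] and df = chart_facts[OF B d]
    have dom: "chart_dom e = chart_dom c \<times> chart_dom d" by (simp add: e)
    have img: "chart_map e ` chart_dom e = (chart_map c ` chart_dom c) \<times> (chart_map d ` chart_dom d)"
      by (simp add: e prod_chart_image)
    have inv: "chart_inv e y = (chart_inv c (fst y), chart_inv d (snd y))"
      if "y \<in> chart_map e ` chart_dom e" for y
    proof -
      have "fst y \<in> chart_map c ` chart_dom c" "snd y \<in> chart_map d ` chart_dom d"
        using that by (simp_all add: img mem_Times_iff)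
      from prod_chart_inv[OF A B c d this] show ?thesis by (simp only: e prod.collapse)
    qed
    have mp: "chart_map e = (\<lambda>x. (chart_map c (fst x), chart_map d (snd x)))"
      by (auto simp: e prod_chart_def)
    have "continuous_on (chart_dom e) (chart_map e)"
      unfolding mp dom
      by (intro continuous_on_Pair continuous_on_compose2[OF cf(3)] continuous_on_compose2[OF df(3)])
        (auto intro: continuous_intros)
    moreover have "continuous_on (chart_map e ` chart_dom e) (chart_inv e)"
    proof -
      have "continuous_on (chart_map e ` chart_dom e) (\<lambda>y. (chart_inv c (fst y), chart_inv d (snd y)))"
        unfolding img
        by (intro continuous_on_Pair continuous_on_compose2[OF cf(4)] continuous_on_compose2[OF df(4)])
          (auto intro: continuous_intros)
      then show ?thesis using inv by (simp cong: continuous_on_cong)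
    qed
    moreover have "chart_inv e (chart_map e x) = x" if "x \<in> chart_dom e" for x
    proof -
      have "fst x \<in> chart_dom c" "snd x \<in> chart_dom d" using that by (simp_all add: dom mem_Times_iff)
      then show ?thesis using inv[OF imageI[OF that]] by (simp add: mp cf(5) df(5))
    qed
    moreover have "chart_map e (chart_inv e y) = y" "chart_inv e y \<in> chart_dom e"
      if "y \<in> chart_map e ` chart_dom e" for y
    proof -
      have "fst y \<in> chart_map c ` chart_dom c" "snd y \<in> chart_map d ` chart_dom d"
        using that by (simp_all add: img mem_Times_iff)
      then show "chart_map e (chart_inv e y) = y" "chart_inv e y \<in> chart_dom e"
        by (simp_all add: inv[OF that] mp cf(6,7) df(6,7) dom)
    qed
    ultimately have "homeomorphism (chart_dom e) (chart_map e ` chart_dom e) (chart_map e) (chart_inv e)"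
      by (intro homeomorphismI) auto
    moreover have "open (chart_dom e)" unfolding dom by (rule open_Times[OF cf(1) df(1)])
    moreover have "open (chart_map e ` chart_dom e)" unfolding img by (rule open_Times[OF cf(2) df(2)])
    ultimately show ?thesis by blast
  qed
  have smooth: "smooth_on (chart_map e ` (chart_dom e \<inter> chart_dom e')) (chart_map e' \<circ> chart_inv e)"
    if e_in: "e \<in> prod_atlas A B" and e'_in: "e' \<in> prod_atlas A B" for e e'
  proof (rule smooth_onI_smooth_at)
    obtain c d where e: "e = prod_chart c d" and c: "c \<in> A" and d: "d \<in> B"
      using prod_atlasE[OF e_in] .
    obtain c' d' where e': "e' = prod_chart c' d'" and c': "c' \<in> A" and d': "d' \<in> B"
      using prod_atlasE[OF e'_in] .
    fix z assume "z \<in> chart_map e ` (chart_dom e \<inter> chart_dom e')"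
    then obtain p q where z: "z = (chart_map c p, chart_map d q)"
      and p: "p \<in> chart_dom c" "p \<in> chart_dom c'" and q: "q \<in> chart_dom d" "q \<in> chart_dom d'"
      by (auto simp: e e')
    have cp: "c \<in> charts_at A p" "c' \<in> charts_at A p" and dq: "d \<in> charts_at B q" "d' \<in> charts_at B q"
      using c c' d d' p q by (auto simp: charts_at_def)
    define t where "t = chart_map c' \<circ> chart_inv c"
    define r where "r = chart_map d' \<circ> chart_inv d"
    have t: "smooth_at (chart_map c p) t" and r: "smooth_at (chart_map d q) r"
      unfolding t_def r_def by (rule transition_smooth_at A B cp dq)+
    have "smooth_at z (\<lambda>y. t (fst y))" "smooth_at z (\<lambda>y. r (snd y))"
      by (rule smooth_at_compose[OF KA] smooth_at_compose[OF KB];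
          simp add: z t r smooth_at_bounded_linear bounded_linear_fst bounded_linear_snd)+
    then have "smooth_at z (\<lambda>y. (t (fst y), r (snd y)))" by (rule smooth_at_Pair)
    moreover have "\<forall>\<^sub>F y in nhds z. y \<in> chart_map e ` chart_dom e"
      using homeo[OF e_in] \<open>z \<in> _\<close> by (intro eventually_nhds_in_open) auto
    then have "\<forall>\<^sub>F y in nhds z. (t (fst y), r (snd y)) = (chart_map e' \<circ> chart_inv e) y"
    proof eventually_elim
      case (elim y)
      then have "fst y \<in> chart_map c ` chart_dom c" "snd y \<in> chart_map d ` chart_dom d"
        by (auto simp: e prod_chart_image)
      then have "chart_inv e (fst y, snd y) = (chart_inv c (fst y), chart_inv d (snd y))"
        unfolding e by (rule prod_chart_inv[OF A B c d])
      then show ?case by (simp add: t_def r_def e')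
    qed
    ultimately show "smooth_at z (chart_map e' \<circ> chart_inv e)" by (rule smooth_at_cong)
  qed
  show ?thesis
    unfolding smooth_atlas_def using ex ne homeo smooth by blast
qed

lemma prod_chart_inject:
  assumes "prod_chart c d = prod_chart c' d'" "p \<in> chart_dom c" "q \<in> chart_dom d"
  shows "c = c' \<and> d = d'"
proof -
  have "chart_dom c \<times> chart_dom d = chart_dom c' \<times> chart_dom d'"
    using assms(1) by (metis prod_chart_simps(1))
  then have dom: "chart_dom c = chart_dom c'" "chart_dom d = chart_dom d'" using assms(2,3) by auto
  have "(chart_map c x, chart_map d y) = (chart_map c' x, chart_map d' y)" for x y
    using assms(1) by (metis prod_chart_simps(2))
  then have "chart_map c = chart_map c'" "chart_map d = chart_map d'" by auto
  with dom show ?thesis by (simp add: prod_eq_iff)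
qed

lemma tan_pair_prod_chart:
  assumes c: "c \<in> charts_at A p" and d: "d \<in> charts_at B q"
  shows "tan_pair A B p q v w (prod_chart c d) = (v c, w d)"
proof -
  have "(THE z. \<exists>c'\<in>charts_at A p. \<exists>d'\<in>charts_at B q. prod_chart c d = prod_chart c' d' \<and>
      z = (v c', w d')) = (v c, w d)"
    using c d prod_chart_inject[of c d _ _ p q] charts_atD(2)[OF c] charts_atD(2)[OF d]
    by (intro the_equality) blast+
  then show ?thesis unfolding tan_pair_def using prod_chart_in[OF c d] by simp
qed

lemma tan_pair_linear_combination:
  "tan_pair A B p q (\<lambda>c. a *\<^sub>R v c + b *\<^sub>R v' c) (\<lambda>d. a *\<^sub>R w d + b *\<^sub>R w' d) =
    (\<lambda>e. a *\<^sub>R tan_pair A B p q v w e + b *\<^sub>R tan_pair A B p q v' w' e)"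
proof
  fix e
  show "tan_pair A B p q (\<lambda>c. a *\<^sub>R v c + b *\<^sub>R v' c) (\<lambda>d. a *\<^sub>R w d + b *\<^sub>R w' d) e =
    a *\<^sub>R tan_pair A B p q v w e + b *\<^sub>R tan_pair A B p q v' w' e"
  proof (cases "e \<in> charts_at (prod_atlas A B) (p, q)")
    case True
    then obtain c d where "c \<in> charts_at A p" "d \<in> charts_at B q" "e = prod_chart c d"
      by (rule charts_at_prod_atlasE)
    then show ?thesis by (simp add: tan_pair_prod_chart)
  qed (simp add: tan_pair_def)
qed

lemma has_velocity_Pair:
  assumes A: "smooth_atlas A" and B: "smooth_atlas B"
    and \<gamma>: "has_velocity A \<gamma> p v" and \<delta>: "has_velocity B \<delta> q w"
  shows "has_velocity (prod_atlas A B) (\<lambda>\<tau>. (\<gamma> \<tau>, \<delta> \<tau>)) (p, q) (tan_pair A B p q v w)"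
proof (rule has_velocityI[OF smooth_atlas_prod[OF A B]])
  show "(\<gamma> 0, \<delta> 0) = (p, q)" by (simp add: has_velocityD(1)[OF \<gamma>] has_velocityD(1)[OF \<delta>])
  show "tan_pair A B p q v w e = 0" if "e \<notin> charts_at (prod_atlas A B) (p, q)" for e
    using that by (simp add: tan_pair_def)
  fix e assume "e \<in> charts_at (prod_atlas A B) (p, q)"
  then obtain c d where c: "c \<in> charts_at A p" and d: "d \<in> charts_at B q" and e: "e = prod_chart c d"
    by (rule charts_at_prod_atlasE)
  show "\<forall>\<^sub>F \<tau> in nhds 0. (\<gamma> \<tau>, \<delta> \<tau>) \<in> chart_dom e"
    using has_velocityD(3)[OF \<gamma> c] has_velocityD(3)[OF \<delta> d] by eventually_elim (simp add: e)
  show "((\<lambda>\<tau>. chart_map e (\<gamma> \<tau>, \<delta> \<tau>)) has_vector_derivative tan_pair A B p q v w e) (at 0)"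
    unfolding e tan_pair_prod_chart[OF c d] prod_chart_simps
    by (rule has_vector_derivative_Pair[OF has_velocityD(4)[OF \<gamma> c] has_velocityD(4)[OF \<delta> d]])
qed

lemma smooth_mapI_germ:
  assumes A: "smooth_atlas A"
    and germ: "\<And>p thesis. p \<in> S \<Longrightarrow>
      (\<And>c d h. c \<in> charts_at A p \<Longrightarrow> d \<in> charts_at B (f p) \<Longrightarrow> smooth_at (chart_map c p) h \<Longrightarrow>
        \<forall>\<^sub>F x in nhds p. x \<in> S \<longrightarrow> f x \<in> chart_dom d \<and> h (chart_map c x) = chart_map d (f x) \<Longrightarrow>
        thesis) \<Longrightarrow> thesis"
  shows "smooth_map A B S f"
  unfolding smooth_map_def
proof
  fix p assume p: "p \<in> S"
  obtain c d h where c: "c \<in> charts_at A p" and d: "d \<in> charts_at B (f p)"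
    and h: "smooth_at (chart_map c p) h"
    and ev: "\<forall>\<^sub>F x in nhds p. x \<in> S \<longrightarrow> f x \<in> chart_dom d \<and> h (chart_map c x) = chart_map d (f x)"
    by (rule germ[OF p])
  obtain U where U: "open U" "chart_map c p \<in> U" "smooth_on U h" using h by (auto simp: smooth_at_def)
  have "\<forall>\<^sub>F x in nhds p. chart_map c x \<in> U"
    using eventually_filterlim[OF chart_filterlim(1)[OF A c] eventually_nhds_in_open[OF U(1,2)]] .
  from eventually_conj[OF eventually_chart_dom(1)[OF A c] eventually_conj[OF this ev]]
  obtain W where W: "open W" "p \<in> W" "\<forall>x\<in>W. x \<in> chart_dom c \<and> chart_map c x \<in> U \<and>
      (x \<in> S \<longrightarrow> f x \<in> chart_dom d \<and> h (chart_map c x) = chart_map d (f x))"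
    by (auto simp only: eventually_nhds)
  have "smooth_on (chart_map c ` W) h"
  proof -
    have "chart_map c ` W \<subseteq> U" using W(3) by auto
    then show ?thesis using U(3) Ck_on_subset[of _ U h "chart_map c ` W"] by (simp add: smooth_on_def)
  qed
  moreover have "W \<subseteq> chart_dom c" "\<forall>x\<in>W \<inter> S. f x \<in> chart_dom d \<and> h (chart_map c x) = chart_map d (f x)"
    using W(3) by auto
  ultimately show "\<exists>c\<in>charts_at A p. \<exists>d\<in>charts_at B (f p). \<exists>W h.
       open W \<and> p \<in> W \<and> W \<subseteq> chart_dom c \<and> smooth_on (chart_map c ` W) h \<and>
       (\<forall>x\<in>W \<inter> S. f x \<in> chart_dom d \<and> h (chart_map c x) = chart_map d (f x))"
    using W(1,2) by (intro bexI[OF _ c] bexI[OF _ d] exI[of _ W] exI[of _ h] conjI)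
qed

lemma smooth_map_slice_snd:
  assumes A: "smooth_atlas (A :: ('a::topological_space, 'e::banach) chart set)"
    and B: "smooth_atlas (B :: ('b::topological_space, 'f::banach) chart set)"
    and C: "smooth_atlas C"
    and f: "smooth_map (prod_atlas A B) C S f"
  shows "smooth_map B C {b. (p, b) \<in> S} (\<lambda>b. f (p, b))"
proof (rule smooth_mapI_germ[OF B])
  fix q thesis assume "q \<in> {b. (p, b) \<in> S}"
    and that: "\<And>c d h. c \<in> charts_at B q \<Longrightarrow> d \<in> charts_at C (f (p, q)) \<Longrightarrow> smooth_at (chart_map c q) h \<Longrightarrow>
      \<forall>\<^sub>F x in nhds q. x \<in> {b. (p, b) \<in> S} \<longrightarrow>
        f (p, x) \<in> chart_dom d \<and> h (chart_map c x) = chart_map d (f (p, x)) \<Longrightarrow> thesis"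
  from this(1) have pq: "(p, q) \<in> S" by simp
  obtain c d e where c: "c \<in> charts_at A p" and d: "d \<in> charts_at B q" and e: "e \<in> charts_at C (f (p, q))"
    using charts_at_nonempty[OF A, of p] charts_at_nonempty[OF B, of q]
      charts_at_nonempty[OF C, of "f (p, q)"] by (elim exE)
  obtain K \<kappa> where K: "coordinate_system (K :: ('e \<times> 'f) set) \<kappa>"
    using smooth_atlas_coordinates[OF smooth_atlas_prod[OF A B]] .
  obtain h where h: "smooth_at (chart_map (prod_chart c d) (p, q)) h"
    "\<forall>\<^sub>F x in nhds (p, q). x \<in> S \<longrightarrow>
      f x \<in> chart_dom e \<and> h (chart_map (prod_chart c d) x) = chart_map e (f x)"
    using smooth_map_germ[OF smooth_atlas_prod[OF A B] C f pq prod_chart_in[OF c d] e] .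
  have "smooth_at (chart_map d q) (\<lambda>y. h (chart_map c p, y))"
    by (rule smooth_at_compose[OF K _ smooth_at_Pair[OF smooth_at_const
          smooth_at_bounded_linear[OF bounded_linear_ident]]]) (use h(1) in simp)
  moreover have "filterlim (\<lambda>b. (p, b)) (nhds (p, q)) (nhds q)"
    by (intro tendsto_Pair tendsto_const filterlim_ident)
  from eventually_filterlim[OF this h(2)]
  have "\<forall>\<^sub>F b in nhds q. b \<in> {b. (p, b) \<in> S} \<longrightarrow>
      f (p, b) \<in> chart_dom e \<and> h (chart_map c p, chart_map d b) = chart_map e (f (p, b))"
    by simp
  ultimately show thesis by (rule that[OF d e])
qed

lemma smooth_map_slice_fst:
  assumes A: "smooth_atlas (A :: ('a::topological_space, 'e::banach) chart set)"
    and B: "smooth_atlas (B :: ('b::topological_space, 'f::banach) chart set)"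
    and C: "smooth_atlas C"
    and f: "smooth_map (prod_atlas A B) C S f"
  shows "smooth_map A C {a. (a, q) \<in> S} (\<lambda>a. f (a, q))"
proof (rule smooth_mapI_germ[OF A])
  fix p thesis assume "p \<in> {a. (a, q) \<in> S}"
    and that: "\<And>c d h. c \<in> charts_at A p \<Longrightarrow> d \<in> charts_at C (f (p, q)) \<Longrightarrow> smooth_at (chart_map c p) h \<Longrightarrow>
      \<forall>\<^sub>F x in nhds p. x \<in> {a. (a, q) \<in> S} \<longrightarrow>
        f (x, q) \<in> chart_dom d \<and> h (chart_map c x) = chart_map d (f (x, q)) \<Longrightarrow> thesis"
  from this(1) have pq: "(p, q) \<in> S" by simp
  obtain c d e where c: "c \<in> charts_at A p" and d: "d \<in> charts_at B q" and e: "e \<in> charts_at C (f (p, q))"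
    using charts_at_nonempty[OF A, of p] charts_at_nonempty[OF B, of q]
      charts_at_nonempty[OF C, of "f (p, q)"] by (elim exE)
  obtain K \<kappa> where K: "coordinate_system (K :: ('e \<times> 'f) set) \<kappa>"
    using smooth_atlas_coordinates[OF smooth_atlas_prod[OF A B]] .
  obtain h where h: "smooth_at (chart_map (prod_chart c d) (p, q)) h"
    "\<forall>\<^sub>F x in nhds (p, q). x \<in> S \<longrightarrow>
      f x \<in> chart_dom e \<and> h (chart_map (prod_chart c d) x) = chart_map e (f x)"
    using smooth_map_germ[OF smooth_atlas_prod[OF A B] C f pq prod_chart_in[OF c d] e] .
  have "smooth_at (chart_map c p) (\<lambda>y. h (y, chart_map d q))"
    by (rule smooth_at_compose[OF K _ smooth_at_Pair[OF
          smooth_at_bounded_linear[OF bounded_linear_ident] smooth_at_const]]) (use h(1) in simp)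
  moreover have "filterlim (\<lambda>a. (a, q)) (nhds (p, q)) (nhds p)"
    by (intro tendsto_Pair tendsto_const filterlim_ident)
  from eventually_filterlim[OF this h(2)]
  have "\<forall>\<^sub>F a in nhds p. a \<in> {a. (a, q) \<in> S} \<longrightarrow>
      f (a, q) \<in> chart_dom e \<and> h (chart_map c a, chart_map d q) = chart_map e (f (a, q))"
    by simp
  ultimately show thesis by (rule that[OF c e])
qed

section \<open>The tangent groupoid\<close>

locale lie_groupoid_loc =
  fixes G :: "('g::topological_space, 'm::{t2_space, second_countable_topology},
    'e::banach, 'n::banach) lie_groupoid"
  assumes lie: "is_lie_groupoid G"
begin

abbreviation source ("s") where "s \<equiv> src G"
abbreviation target ("t") where "t \<equiv> tgt G"
abbreviation unit ("\<epsilon>") where "\<epsilon> \<equiv> unt G"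
abbreviation inverse_arrow ("\<iota>") where "\<iota> \<equiv> ginv G"
abbreviation product (infixl "\<cdot>" 70) where "g \<cdot> h \<equiv> cmp G g h"
abbreviation "velocity \<equiv> has_velocity (garr G)"
abbreviation "velocity_obj \<equiv> has_velocity (gobj G)"

lemma groupoid_laws:
  shows "s (\<epsilon> x) = x" "t (\<epsilon> x) = x"
    "s g = t h \<Longrightarrow> s (g \<cdot> h) = s h" "s g = t h \<Longrightarrow> t (g \<cdot> h) = t g"
    "s g = t h \<Longrightarrow> s h = t k \<Longrightarrow> (g \<cdot> h) \<cdot> k = g \<cdot> (h \<cdot> k)"
    "\<epsilon> (t g) \<cdot> g = g" "g \<cdot> \<epsilon> (s g) = g"
    "s (\<iota> g) = t g" "t (\<iota> g) = s g" "g \<cdot> \<iota> g = \<epsilon> (t g)" "\<iota> g \<cdot> g = \<epsilon> (s g)"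
  using lie unfolding is_lie_groupoid_def by blast+

lemma arr_atlas: "smooth_atlas (garr G)" and obj_atlas: "smooth_atlas (gobj G)"
  and src_submersion: "submersion (garr G) (gobj G) s" and tgt_submersion: "submersion (garr G) (gobj G) t"
  and unt_smooth: "smooth_map (gobj G) (garr G) UNIV \<epsilon>"
  and inv_smooth: "smooth_map (garr G) (garr G) UNIV \<iota>"
  and cmp_smooth: "smooth_map (prod_atlas (garr G) (garr G)) (garr G) (composable G) (\<lambda>(g, h). g \<cdot> h)"
  using lie unfolding is_lie_groupoid_def by blast+

lemma src_smooth: "smooth_map (garr G) (gobj G) UNIV s"
  and tgt_smooth: "smooth_map (garr G) (gobj G) UNIV t"
  using src_submersion tgt_submersion unfolding submersion_def by blast+

lemmas pair_atlas = smooth_atlas_prod[OF arr_atlas arr_atlas]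

lemma inv_cmp_cmp: "s g = t h \<Longrightarrow> \<iota> g \<cdot> (g \<cdot> h) = h"
  using groupoid_laws(5)[of "\<iota> g" g h] groupoid_laws(6)[of h] by (simp add: groupoid_laws(8,11))

lemma left_cancel: "s g = t h \<Longrightarrow> s g = t k \<Longrightarrow> g \<cdot> h = g \<cdot> k \<Longrightarrow> h = k"
  by (metis inv_cmp_cmp)

lemma inv_unique: "s g = t h \<Longrightarrow> g \<cdot> h = \<epsilon> (t g) \<Longrightarrow> h = \<iota> g"
  by (rule left_cancel[of g]) (simp_all add: groupoid_laws)

lemma inv_inv: "\<iota> (\<iota> g) = g"
  using inv_unique[of "\<iota> g" g] by (simp add: groupoid_laws)

lemma inv_unit: "\<iota> (\<epsilon> x) = \<epsilon> x"
proof -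
  have "\<epsilon> x \<cdot> \<epsilon> x = \<epsilon> x" using groupoid_laws(7)[of "\<epsilon> x"] by (simp add: groupoid_laws(1))
  then show ?thesis using inv_unique[of "\<epsilon> x" "\<epsilon> x"] by (simp add: groupoid_laws(1,2))
qed

lemma cmp_cmp_inv: "s g = t h \<Longrightarrow> (g \<cdot> h) \<cdot> \<iota> h = g"
  using groupoid_laws(5)[of g h "\<iota> h"] groupoid_laws(7)[of g] by (simp add: groupoid_laws(8-11))

lemma cmp_inv_cmp: "s g = s h \<Longrightarrow> (g \<cdot> \<iota> h) \<cdot> h = g"
  using cmp_cmp_inv[of g "\<iota> h"] by (simp add: inv_inv groupoid_laws(9))

lemma inv_cmp_inv: "s g = s h \<Longrightarrow> \<iota> (g \<cdot> \<iota> h) = h \<cdot> \<iota> g"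
proof -
  assume sg: "s g = s h"
  have "(g \<cdot> \<iota> h) \<cdot> (h \<cdot> \<iota> g) = ((g \<cdot> \<iota> h) \<cdot> h) \<cdot> \<iota> g"
    using sg by (subst groupoid_laws(5)) (simp_all add: groupoid_laws(3,8,9))
  also have "\<dots> = \<epsilon> (t g)" using sg by (simp add: cmp_inv_cmp groupoid_laws(10))
  finally show ?thesis
    using sg inv_unique[of "g \<cdot> \<iota> h" "h \<cdot> \<iota> g"] by (simp add: groupoid_laws(3,4,8,9))
qed

lemma TG_linear_combination:
  "X \<in> TG G g \<Longrightarrow> Y \<in> TG G g \<Longrightarrow> (\<lambda>c. a *\<^sub>R X c + b *\<^sub>R Y c) \<in> TG G g"
  using lin_subspace_tangent_space[OF arr_atlas, of g] unfolding lin_subspace_def TG_def by blast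

lemma TG_zero: "(\<lambda>c. 0) \<in> TG G g"
  using lin_subspace_tangent_space[OF arr_atlas, of g] unfolding lin_subspace_def TG_def by blast

lemma TG_minus: "X \<in> TG G g \<Longrightarrow> (\<lambda>c. - X c) \<in> TG G g"
  using TG_linear_combination[of X g X "-1" 0] by simp

lemma velocity_TG: "velocity \<gamma> g X \<Longrightarrow> X \<in> TG G g"
  unfolding TG_def by (rule has_velocityD(2))

lemma velocity_exists:
  assumes "X \<in> TG G g"
  obtains \<gamma> where "velocity \<gamma> g X"
  using has_velocity_exists[OF arr_atlas] assms unfolding TG_def by blast

lemmas velocity_unique = has_velocity_unique[OF arr_atlas]
lemmas velocity_obj_unique = has_velocity_unique[OF obj_atlas]

lemma velocity_const: "velocity (\<lambda>\<tau>. g) g (\<lambda>c. 0)"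
  by (rule has_velocity_const[OF arr_atlas])

lemma velocity_src: "velocity \<gamma> g X \<Longrightarrow> velocity_obj (\<lambda>\<tau>. s (\<gamma> \<tau>)) (s g) (d_src G g X)"
  and velocity_tgt: "velocity \<gamma> g X \<Longrightarrow> velocity_obj (\<lambda>\<tau>. t (\<gamma> \<tau>)) (t g) (d_tgt G g X)"
  and velocity_unt: "velocity_obj k x Y \<Longrightarrow> velocity (\<lambda>\<tau>. \<epsilon> (k \<tau>)) (\<epsilon> x) (d_unt G x Y)"
  and velocity_inv: "velocity \<gamma> g X \<Longrightarrow> velocity (\<lambda>\<tau>. \<iota> (\<gamma> \<tau>)) (\<iota> g) (d_inv G g X)"
  unfolding d_src_def d_tgt_def d_unt_def d_inv_def
  by (erule has_velocity_mdiff[OF arr_atlas obj_atlas src_smooth] has_velocity_mdiff[OF arr_atlas obj_atlas tgt_smooth]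
      has_velocity_mdiff[OF obj_atlas arr_atlas unt_smooth] has_velocity_mdiff[OF arr_atlas arr_atlas inv_smooth];
      simp)+

lemma velocity_cmp:
  assumes \<gamma>: "velocity \<gamma> g X" and \<delta>: "velocity \<delta> h Y" and st: "\<forall>\<^sub>F \<tau> in nhds 0. s (\<gamma> \<tau>) = t (\<delta> \<tau>)"
  shows "velocity (\<lambda>\<tau>. \<gamma> \<tau> \<cdot> \<delta> \<tau>) (g \<cdot> h) (d_cmp G g h X Y)"
  using has_velocity_mdiff[OF pair_atlas arr_atlas cmp_smooth
      has_velocity_Pair[OF arr_atlas arr_atlas \<gamma> \<delta>]] st
  by (simp add: composable_def d_cmp_def)

lemma d_src_eq_d_tgt_of_curves:
  assumes "velocity \<gamma> g X" "velocity \<delta> h Y" "\<forall>\<^sub>F \<tau> in nhds 0. s (\<gamma> \<tau>) = t (\<delta> \<tau>)"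
  shows "d_src G g X = d_tgt G h Y"
proof -
  have "s g = t h"
    using eventually_nhds_x_imp_x[OF assms(3)] has_velocityD(1)[OF assms(1)] has_velocityD(1)[OF assms(2)] by simp
  then show ?thesis
    using velocity_obj_unique[OF velocity_src[OF assms(1)] _ assms(3)] velocity_tgt[OF assms(2)] by simp
qed

lemma d_src_zero_of_curve:
  assumes "velocity \<gamma> g X" "\<forall>\<^sub>F \<tau> in nhds 0. s (\<gamma> \<tau>) = s g"
  shows "d_src G g X = (\<lambda>c. 0)"
  by (rule velocity_obj_unique[OF velocity_src[OF assms(1)] has_velocity_const[OF obj_atlas] assms(2)])

lemma d_tgt_zero_of_curve:
  assumes "velocity \<gamma> g X" "\<forall>\<^sub>F \<tau> in nhds 0. t (\<gamma> \<tau>) = t g"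
  shows "d_tgt G g X = (\<lambda>c. 0)"
  by (rule velocity_obj_unique[OF velocity_tgt[OF assms(1)] has_velocity_const[OF obj_atlas] assms(2)])

text \<open>
  Vectors with \<open>ds X = dt Y\<close> are tangent to the set of composable pairs: a curve for \<open>Y\<close> is chosen
  freely and its target is lifted through the source map to a curve for \<open>X\<close>.
\<close>
lemma composable_curves:
  assumes X: "X \<in> TG G g" and Y: "Y \<in> TG G h" and st: "s g = t h" and d: "d_src G g X = d_tgt G h Y"
  obtains \<gamma> \<delta> where "velocity \<gamma> g X" "velocity \<delta> h Y" "\<forall>\<^sub>F \<tau> in nhds 0. s (\<gamma> \<tau>) = t (\<delta> \<tau>)"
proof -
  obtain \<delta> where \<delta>: "velocity \<delta> h Y" using velocity_exists[OF Y] .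
  have "velocity_obj (\<lambda>\<tau>. t (\<delta> \<tau>)) (s g) (mdiff (garr G) (gobj G) UNIV s g X)"
    using velocity_tgt[OF \<delta>] by (simp add: st d[unfolded d_src_def])
  then obtain \<gamma> where "velocity \<gamma> g X" "\<forall>\<^sub>F \<tau> in nhds 0. s (\<gamma> \<tau>) = t (\<delta> \<tau>)"
    using velocity_lift[OF arr_atlas obj_atlas src_submersion X[unfolded TG_def]] by blast
  with \<delta> show ?thesis using that by blast
qed

lemma source_fibre_curve:
  assumes X: "X \<in> TG G g" and d: "d_src G g X = (\<lambda>c. 0)"
  obtains \<gamma> where "velocity \<gamma> g X" "\<forall>\<^sub>F \<tau> in nhds 0. s (\<gamma> \<tau>) = s g"
proof -
  have "velocity_obj (\<lambda>\<tau>. s g) (s g) (mdiff (garr G) (gobj G) UNIV s g X)"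
    using has_velocity_const[OF obj_atlas, of "s g"] by (simp add: d[unfolded d_src_def])
  then show ?thesis
    using velocity_lift[OF arr_atlas obj_atlas src_submersion X[unfolded TG_def]] that by blast
qed

lemma d_src_linear_combination:
    "d_src G g (\<lambda>c. a *\<^sub>R X c + b *\<^sub>R Y c) = (\<lambda>c. a *\<^sub>R d_src G g X c + b *\<^sub>R d_src G g Y c)"
  and d_tgt_linear_combination:
    "d_tgt G g (\<lambda>c. a *\<^sub>R X c + b *\<^sub>R Y c) = (\<lambda>c. a *\<^sub>R d_tgt G g X c + b *\<^sub>R d_tgt G g Y c)"
  and d_unt_linear_combination:
    "d_unt G x (\<lambda>c. a *\<^sub>R V c + b *\<^sub>R W c) = (\<lambda>c. a *\<^sub>R d_unt G x V c + b *\<^sub>R d_unt G x W c)"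
  and d_inv_linear_combination:
    "d_inv G g (\<lambda>c. a *\<^sub>R X c + b *\<^sub>R Y c) = (\<lambda>c. a *\<^sub>R d_inv G g X c + b *\<^sub>R d_inv G g Y c)"
  unfolding d_src_def d_tgt_def d_unt_def d_inv_def
  by (rule mdiff_linear_combination[OF _ _ _ UNIV_I] arr_atlas obj_atlas src_smooth tgt_smooth unt_smooth inv_smooth)+

lemma d_cmp_linear_combination:
  assumes "s g = t h"
  shows "d_cmp G g h (\<lambda>c. a *\<^sub>R X c + b *\<^sub>R X' c) (\<lambda>c. a *\<^sub>R Y c + b *\<^sub>R Y' c) =
    (\<lambda>c. a *\<^sub>R d_cmp G g h X Y c + b *\<^sub>R d_cmp G g h X' Y' c)"
  unfolding d_cmp_def tan_pair_linear_combination
  by (rule mdiff_linear_combination[OF pair_atlas arr_atlas cmp_smooth]) (use assms in \<open>simp add: composable_def\<close>)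

lemma d_src_zero: "d_src G g (\<lambda>c. 0) = (\<lambda>c. 0)" and d_tgt_zero: "d_tgt G g (\<lambda>c. 0) = (\<lambda>c. 0)"
  using d_src_linear_combination[of g 0 "\<lambda>c. 0" 0 "\<lambda>c. 0"] d_tgt_linear_combination[of g 0 "\<lambda>c. 0" 0 "\<lambda>c. 0"]
  by simp_all

lemma d_src_in: "X \<in> TG G g \<Longrightarrow> d_src G g X \<in> TM G (s g)"
  and d_tgt_in: "X \<in> TG G g \<Longrightarrow> d_tgt G g X \<in> TM G (t g)"
  and d_unt_in: "V \<in> TM G x \<Longrightarrow> d_unt G x V \<in> TG G (\<epsilon> x)"
  unfolding d_src_def d_tgt_def d_unt_def TG_def TM_def
  by (erule mdiff_in_tangent_space[OF arr_atlas obj_atlas src_smooth] mdiff_in_tangent_space[OF arr_atlas obj_atlas tgt_smooth]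
      mdiff_in_tangent_space[OF obj_atlas arr_atlas unt_smooth])+

lemma
  assumes X: "X \<in> TG G g" and Y: "Y \<in> TG G h" and st: "s g = t h" and d: "d_src G g X = d_tgt G h Y"
  shows d_cmp_in: "d_cmp G g h X Y \<in> TG G (g \<cdot> h)"
    and d_src_d_cmp: "d_src G (g \<cdot> h) (d_cmp G g h X Y) = d_src G h Y"
    and d_tgt_d_cmp: "d_tgt G (g \<cdot> h) (d_cmp G g h X Y) = d_tgt G g X"
proof -
  obtain \<gamma> \<delta> where \<gamma>: "velocity \<gamma> g X" and \<delta>: "velocity \<delta> h Y"
    and ev: "\<forall>\<^sub>F \<tau> in nhds 0. s (\<gamma> \<tau>) = t (\<delta> \<tau>)"
    using composable_curves[OF assms] .
  note vel = velocity_cmp[OF \<gamma> \<delta> ev]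
  show "d_cmp G g h X Y \<in> TG G (g \<cdot> h)" by (rule velocity_TG[OF vel])
  show "d_src G (g \<cdot> h) (d_cmp G g h X Y) = d_src G h Y"
  proof (rule velocity_obj_unique)
    show "velocity_obj (\<lambda>\<tau>. s (\<gamma> \<tau> \<cdot> \<delta> \<tau>)) (s h) (d_src G (g \<cdot> h) (d_cmp G g h X Y))"
      using velocity_src[OF vel] by (simp add: groupoid_laws(3)[OF st])
    show "\<forall>\<^sub>F \<tau> in nhds 0. s (\<gamma> \<tau> \<cdot> \<delta> \<tau>) = s (\<delta> \<tau>)" using ev by eventually_elim (rule groupoid_laws(3))
  qed (rule velocity_src[OF \<delta>])
  show "d_tgt G (g \<cdot> h) (d_cmp G g h X Y) = d_tgt G g X"
  proof (rule velocity_obj_unique)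
    show "velocity_obj (\<lambda>\<tau>. t (\<gamma> \<tau> \<cdot> \<delta> \<tau>)) (t g) (d_tgt G (g \<cdot> h) (d_cmp G g h X Y))"
      using velocity_tgt[OF vel] by (simp add: groupoid_laws(4)[OF st])
    show "\<forall>\<^sub>F \<tau> in nhds 0. t (\<gamma> \<tau> \<cdot> \<delta> \<tau>) = t (\<gamma> \<tau>)" using ev by eventually_elim (rule groupoid_laws(4))
  qed (rule velocity_tgt[OF \<gamma>])
qed

text \<open>A vector at a product is \<open>Z = (Z \<cdot> Y\<inverse>) \<cdot> Y\<close> for any \<open>Y\<close> with the same source.\<close>
lemma d_cmp_surj:
  assumes Z: "Z \<in> TG G (g \<cdot> h)" and st: "s g = t h"
  obtains X Y where "X \<in> TG G g" "Y \<in> TG G h" "d_src G g X = d_tgt G h Y" "d_cmp G g h X Y = Z"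
proof -
  have "d_src G (g \<cdot> h) Z \<in> TM G (s h)" using d_src_in[OF Z] by (simp add: groupoid_laws(3)[OF st])
  then have "d_src G (g \<cdot> h) Z \<in> d_src G h ` TG G h"
    using src_submersion unfolding submersion_def d_src_def TG_def TM_def by blast
  then obtain Y where Y: "Y \<in> TG G h" "d_src G (g \<cdot> h) Z = d_src G h Y" by blast
  obtain \<delta> where \<delta>: "velocity \<delta> h Y" using velocity_exists[OF Y(1)] .
  have "velocity_obj (\<lambda>\<tau>. s (\<delta> \<tau>)) (s (g \<cdot> h)) (mdiff (garr G) (gobj G) UNIV s (g \<cdot> h) Z)"
    using velocity_src[OF \<delta>] Y(2) by (simp add: d_src_def groupoid_laws(3)[OF st])
  then obtain \<zeta> where \<zeta>: "velocity \<zeta> (g \<cdot> h) Z" "\<forall>\<^sub>F \<tau> in nhds 0. s (\<zeta> \<tau>) = s (\<delta> \<tau>)"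
    using velocity_lift[OF arr_atlas obj_atlas src_submersion Z[unfolded TG_def]] by blast
  define X where "X = d_cmp G (g \<cdot> h) (\<iota> h) Z (d_inv G h Y)"
  have "\<forall>\<^sub>F \<tau> in nhds 0. s (\<zeta> \<tau>) = t (\<iota> (\<delta> \<tau>))" using \<zeta>(2) by (simp add: groupoid_laws(9))
  from velocity_cmp[OF \<zeta>(1) velocity_inv[OF \<delta>] this]
  have \<gamma>: "velocity (\<lambda>\<tau>. \<zeta> \<tau> \<cdot> \<iota> (\<delta> \<tau>)) g X" by (simp add: X_def cmp_cmp_inv[OF st])
  have ev: "\<forall>\<^sub>F \<tau> in nhds 0. s (\<zeta> \<tau> \<cdot> \<iota> (\<delta> \<tau>)) = t (\<delta> \<tau>)"
    using \<zeta>(2) by eventually_elim (simp add: groupoid_laws(3,8,9))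
  have "\<forall>\<^sub>F \<tau> in nhds 0. \<zeta> \<tau> \<cdot> \<iota> (\<delta> \<tau>) \<cdot> \<delta> \<tau> = \<zeta> \<tau>"
    using \<zeta>(2) by eventually_elim (rule cmp_inv_cmp)
  note eqZ = velocity_unique[OF velocity_cmp[OF \<gamma> \<delta> ev] \<zeta>(1) this]
  show ?thesis by (rule that[OF velocity_TG[OF \<gamma>] Y(1) d_src_eq_d_tgt_of_curves[OF \<gamma> \<delta> ev] eqZ])
qed


section \<open>Translations of the Lie algebroid\<close>

lemma algd_linear_combination:
  "u \<in> algd G x \<Longrightarrow> v \<in> algd G x \<Longrightarrow> (\<lambda>c. a *\<^sub>R u c + b *\<^sub>R v c) \<in> algd G x"
  by (simp add: algd_def TG_linear_combination d_src_linear_combination)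

lemma algd_curve:
  assumes "u \<in> algd G x"
  obtains \<kappa> where "velocity \<kappa> (\<epsilon> x) u" "\<forall>\<^sub>F \<tau> in nhds 0. s (\<kappa> \<tau>) = x"
proof -
  have "u \<in> TG G (\<epsilon> x)" "d_src G (\<epsilon> x) u = (\<lambda>c. 0)" using assms by (simp_all add: algd_def)
  then show ?thesis
    by (rule source_fibre_curve) (rule that, simp_all add: groupoid_laws(1))
qed

text \<open>
  Translations are products with a constant curve on one side; this description makes their
  compatibility with products a case of associativity.
\<close>
lemma right_vec_velocity:
  assumes \<kappa>: "velocity \<kappa> (\<epsilon> (t g)) u" and s: "\<forall>\<^sub>F \<tau> in nhds 0. s (\<kappa> \<tau>) = t g"
  shows "velocity (\<lambda>\<tau>. \<kappa> \<tau> \<cdot> g) g (right_vec G g u)"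
proof -
  have "smooth_map (garr G) (garr G) {a. s a = t g} (\<lambda>a. a \<cdot> g)"
    using smooth_map_slice_fst[OF arr_atlas arr_atlas arr_atlas cmp_smooth, of g]
    by (simp add: composable_def)
  from has_velocity_mdiff[OF arr_atlas arr_atlas this \<kappa>] s show ?thesis
    by (simp add: right_vec_def groupoid_laws(6))
qed

lemma left_vec_velocity:
  assumes \<kappa>: "velocity \<kappa> (\<epsilon> (s g)) u" and s: "\<forall>\<^sub>F \<tau> in nhds 0. s (\<kappa> \<tau>) = s g"
  shows "velocity (\<lambda>\<tau>. g \<cdot> \<iota> (\<kappa> \<tau>)) g (\<lambda>c. - left_vec G g u c)"
proof -
  have "smooth_map (garr G) (garr G) {a. t a = s g} (\<lambda>a. g \<cdot> a)"
    using smooth_map_slice_snd[OF arr_atlas arr_atlas arr_atlas cmp_smooth, of g]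
    by (simp add: composable_def eq_commute)
  from has_velocity_mdiff[OF arr_atlas arr_atlas this velocity_inv[OF \<kappa>]] s show ?thesis
    by (simp add: left_vec_def groupoid_laws(7,9) inv_unit)
qed

lemma right_vec_eq_d_cmp:
  assumes u: "u \<in> algd G (t g)"
  shows "right_vec G g u = d_cmp G (\<epsilon> (t g)) g u (\<lambda>c. 0)"
    and "right_vec G g u \<in> TG G g" and "d_src G g (right_vec G g u) = (\<lambda>c. 0)"
proof -
  obtain \<kappa> where \<kappa>: "velocity \<kappa> (\<epsilon> (t g)) u" "\<forall>\<^sub>F \<tau> in nhds 0. s (\<kappa> \<tau>) = t g" using algd_curve[OF u] .
  note vel = right_vec_velocity[OF \<kappa>]
  have "velocity (\<lambda>\<tau>. \<kappa> \<tau> \<cdot> g) g (d_cmp G (\<epsilon> (t g)) g u (\<lambda>c. 0))"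
    using velocity_cmp[OF \<kappa>(1) velocity_const \<kappa>(2)] by (simp add: groupoid_laws(6))
  then show "right_vec G g u = d_cmp G (\<epsilon> (t g)) g u (\<lambda>c. 0)"
    by (rule velocity_unique[OF vel]) simp
  show "right_vec G g u \<in> TG G g" by (rule velocity_TG[OF vel])
  show "d_src G g (right_vec G g u) = (\<lambda>c. 0)"
    by (rule d_src_zero_of_curve[OF vel]) (use \<kappa>(2) in eventually_elim, simp add: groupoid_laws(3))
qed

lemma left_vec_eq_d_cmp:
  assumes u: "u \<in> algd G (s g)"
  shows "left_vec G g u = (\<lambda>c. - d_cmp G g (\<epsilon> (s g)) (\<lambda>c. 0) (d_inv G (\<epsilon> (s g)) u) c)"
    and "left_vec G g u \<in> TG G g" and "d_tgt G g (left_vec G g u) = (\<lambda>c. 0)"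
proof -
  obtain \<kappa> where \<kappa>: "velocity \<kappa> (\<epsilon> (s g)) u" "\<forall>\<^sub>F \<tau> in nhds 0. s (\<kappa> \<tau>) = s g" using algd_curve[OF u] .
  note vel = left_vec_velocity[OF \<kappa>]
  have ev: "\<forall>\<^sub>F \<tau> in nhds 0. s g = t (\<iota> (\<kappa> \<tau>))" using \<kappa>(2) by (simp add: groupoid_laws(9) eq_commute)
  have "velocity (\<lambda>\<tau>. g \<cdot> \<iota> (\<kappa> \<tau>)) g (d_cmp G g (\<epsilon> (s g)) (\<lambda>c. 0) (d_inv G (\<epsilon> (s g)) u))"
    using velocity_cmp[OF velocity_const velocity_inv[OF \<kappa>(1)] ev] by (simp add: groupoid_laws(7) inv_unit)
  then have eq: "(\<lambda>c. - left_vec G g u c) = d_cmp G g (\<epsilon> (s g)) (\<lambda>c. 0) (d_inv G (\<epsilon> (s g)) u)"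
    by (rule velocity_unique[OF vel]) simp
  show "left_vec G g u = (\<lambda>c. - d_cmp G g (\<epsilon> (s g)) (\<lambda>c. 0) (d_inv G (\<epsilon> (s g)) u) c)"
    by (simp add: eq[symmetric])
  show "left_vec G g u \<in> TG G g" using TG_minus[OF velocity_TG[OF vel]] by simp
  have "d_tgt G g (\<lambda>c. - left_vec G g u c) = (\<lambda>c. 0)"
    by (rule d_tgt_zero_of_curve[OF vel]) (use ev in eventually_elim, simp add: groupoid_laws(4))
  then show "d_tgt G g (left_vec G g u) = (\<lambda>c. 0)"
    using d_tgt_linear_combination[of g "-1" "\<lambda>c. - left_vec G g u c" 0 "\<lambda>c. 0"] by simp
qed

lemma right_vec_linear_combination:
  assumes u: "u \<in> algd G (t g)" and v: "v \<in> algd G (t g)"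
  shows "right_vec G g (\<lambda>c. a *\<^sub>R u c + b *\<^sub>R v c) = (\<lambda>c. a *\<^sub>R right_vec G g u c + b *\<^sub>R right_vec G g v c)"
  using d_cmp_linear_combination[of "\<epsilon> (t g)" g a u b v "\<lambda>c. 0" "\<lambda>c. 0"]
  by (simp add: right_vec_eq_d_cmp(1) u v algd_linear_combination groupoid_laws(1))

lemma left_vec_linear_combination:
  assumes u: "u \<in> algd G (s g)" and v: "v \<in> algd G (s g)"
  shows "left_vec G g (\<lambda>c. a *\<^sub>R u c + b *\<^sub>R v c) = (\<lambda>c. a *\<^sub>R left_vec G g u c + b *\<^sub>R left_vec G g v c)"
  using d_cmp_linear_combination[of g "\<epsilon> (s g)" a "\<lambda>c. 0" b "\<lambda>c. 0"
      "d_inv G (\<epsilon> (s g)) u" "d_inv G (\<epsilon> (s g)) v"]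
  by (simp add: left_vec_eq_d_cmp(1) u v algd_linear_combination groupoid_laws(2) d_inv_linear_combination
      fun_eq_iff)

lemma right_vec_cmp:
  assumes st: "s g = t h" and u: "u \<in> algd G (t g)"
  shows "right_vec G (g \<cdot> h) u = d_cmp G g h (right_vec G g u) (\<lambda>c. 0)"
proof -
  obtain \<kappa> where \<kappa>: "velocity \<kappa> (\<epsilon> (t g)) u" "\<forall>\<^sub>F \<tau> in nhds 0. s (\<kappa> \<tau>) = t g" using algd_curve[OF u] .
  have t: "t (g \<cdot> h) = t g" by (rule groupoid_laws(4)[OF st])
  have ev: "\<forall>\<^sub>F \<tau> in nhds 0. s (\<kappa> \<tau> \<cdot> g) = t h"
    using \<kappa>(2) by eventually_elim (simp add: groupoid_laws(3) st)
  have ev': "\<forall>\<^sub>F \<tau> in nhds 0. \<kappa> \<tau> \<cdot> (g \<cdot> h) = (\<kappa> \<tau> \<cdot> g) \<cdot> h"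
    using \<kappa>(2) by eventually_elim (simp add: groupoid_laws(5) st)
  show ?thesis
    using velocity_unique[OF right_vec_velocity[of \<kappa> "g \<cdot> h" u]
        velocity_cmp[OF right_vec_velocity[OF \<kappa>] velocity_const ev] ev'] \<kappa> by (simp add: t)
qed

lemma left_vec_cmp:
  assumes st: "s g = t h" and u: "u \<in> algd G (s h)"
  shows "left_vec G (g \<cdot> h) u = d_cmp G g h (\<lambda>c. 0) (left_vec G h u)"
proof -
  obtain \<kappa> where \<kappa>: "velocity \<kappa> (\<epsilon> (s h)) u" "\<forall>\<^sub>F \<tau> in nhds 0. s (\<kappa> \<tau>) = s h" using algd_curve[OF u] .
  have s: "s (g \<cdot> h) = s h" by (rule groupoid_laws(3)[OF st])
  have ev: "\<forall>\<^sub>F \<tau> in nhds 0. s g = t (h \<cdot> \<iota> (\<kappa> \<tau>))"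
    using \<kappa>(2) by eventually_elim (simp add: groupoid_laws(4,9) st)
  have ev': "\<forall>\<^sub>F \<tau> in nhds 0. (g \<cdot> h) \<cdot> \<iota> (\<kappa> \<tau>) = g \<cdot> (h \<cdot> \<iota> (\<kappa> \<tau>))"
    using \<kappa>(2) by eventually_elim (simp add: groupoid_laws(5,9) st)
  have "(\<lambda>c. - left_vec G (g \<cdot> h) u c) = d_cmp G g h (\<lambda>c. 0) (\<lambda>c. - left_vec G h u c)"
    using velocity_unique[OF left_vec_velocity[of \<kappa> "g \<cdot> h" u]
        velocity_cmp[OF velocity_const left_vec_velocity[OF \<kappa>] ev] ev'] \<kappa> by (simp add: s)
  also have "\<dots> = (\<lambda>c. - d_cmp G g h (\<lambda>c. 0) (left_vec G h u) c)"
    using d_cmp_linear_combination[OF st, of "-1" "\<lambda>c. 0" 0 "\<lambda>c. 0" "left_vec G h u" "\<lambda>c. 0"] by simp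
  finally show ?thesis by (simp add: fun_eq_iff)
qed

text \<open>
  If \<open>X \<cdot> Y = 0\<close> then \<open>Y\<close> is tangent to the source fibre, so it is the right translate of
  \<open>v = Y \<cdot> 0\<close> at \<open>h h\<inverse>\<close>; and \<open>X = (X \<cdot> Y) \<cdot> Y\<inverse> = 0 \<cdot> Y\<inverse>\<close> is minus the left translate of \<open>v\<close>.
\<close>
lemma d_cmp_kernel:
  assumes X: "X \<in> TG G g" and Y: "Y \<in> TG G h" and st: "s g = t h" and d: "d_src G g X = d_tgt G h Y"
    and zero: "d_cmp G g h X Y = (\<lambda>c. 0)"
  obtains v where "v \<in> algd G (t h)" "Y = right_vec G h v" "X = (\<lambda>c. - left_vec G g v c)"
proof -
  have "d_src G h Y = (\<lambda>c. 0)"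
    using d_src_d_cmp[OF X Y st d] by (simp add: zero d_src_zero)
  then obtain \<delta> where \<delta>: "velocity \<delta> h Y" "\<forall>\<^sub>F \<tau> in nhds 0. s (\<delta> \<tau>) = s h"
    using source_fibre_curve[OF Y] by blast
  define v where "v = d_cmp G h (\<iota> h) Y (\<lambda>c. 0)"
  define \<kappa> where "\<kappa> \<tau> = \<delta> \<tau> \<cdot> \<iota> h" for \<tau>
  have \<kappa>: "velocity \<kappa> (\<epsilon> (t h)) v"
    using velocity_cmp[OF \<delta>(1) velocity_const, of "\<iota> h"] \<delta>(2)
    by (simp add: \<kappa>_def[abs_def] v_def groupoid_laws(9,10))
  have s\<kappa>: "\<forall>\<^sub>F \<tau> in nhds 0. s (\<kappa> \<tau>) = t h"
    using \<delta>(2) by eventually_elim (simp add: \<kappa>_def groupoid_laws(3,8,9))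
  have v: "v \<in> algd G (t h)"
    using velocity_TG[OF \<kappa>] d_src_zero_of_curve[OF \<kappa>] s\<kappa> by (simp add: algd_def groupoid_laws(1))
  have "\<forall>\<^sub>F \<tau> in nhds 0. \<delta> \<tau> = \<kappa> \<tau> \<cdot> h"
    using \<delta>(2) by eventually_elim (simp add: \<kappa>_def cmp_inv_cmp)
  from velocity_unique[OF \<delta>(1) right_vec_velocity[OF \<kappa> s\<kappa>] this] have Yv: "Y = right_vec G h v" .
  obtain \<gamma> \<eta> where \<gamma>: "velocity \<gamma> g X" and \<eta>: "velocity \<eta> h Y"
    and ev: "\<forall>\<^sub>F \<tau> in nhds 0. s (\<gamma> \<tau>) = t (\<eta> \<tau>)"
    using composable_curves[OF X Y st d] .
  have gh: "velocity (\<lambda>\<tau>. \<gamma> \<tau> \<cdot> \<eta> \<tau>) (g \<cdot> h) (\<lambda>c. 0)"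
    using velocity_cmp[OF \<gamma> \<eta> ev] by (simp add: zero)
  have "\<forall>\<^sub>F \<tau> in nhds 0. s (\<gamma> \<tau> \<cdot> \<eta> \<tau>) = t (\<iota> (\<eta> \<tau>))"
    using ev by eventually_elim (simp add: groupoid_laws(3,9))
  note X1 = velocity_cmp[OF gh velocity_inv[OF \<eta>] this]
  have "\<forall>\<^sub>F \<tau> in nhds 0. \<gamma> \<tau> \<cdot> \<eta> \<tau> \<cdot> \<iota> (\<eta> \<tau>) = \<gamma> \<tau>" using ev by eventually_elim (rule cmp_cmp_inv)
  from velocity_unique[OF _ \<gamma> this] X1
  have X1': "d_cmp G (g \<cdot> h) (\<iota> h) (\<lambda>c. 0) (d_inv G h Y) = X" by (simp add: cmp_cmp_inv[OF st])
  have "\<forall>\<^sub>F \<tau> in nhds 0. s (g \<cdot> h) = t (\<iota> (\<delta> \<tau>))"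
    using \<delta>(2) by eventually_elim (simp add: groupoid_laws(3)[OF st] groupoid_laws(9))
  from velocity_cmp[OF velocity_const velocity_inv[OF \<delta>(1)] this]
  have X2: "velocity (\<lambda>\<tau>. (g \<cdot> h) \<cdot> \<iota> (\<delta> \<tau>)) g X" by (simp add: X1' cmp_cmp_inv[OF st])
  have "\<forall>\<^sub>F \<tau> in nhds 0. (g \<cdot> h) \<cdot> \<iota> (\<delta> \<tau>) = g \<cdot> \<iota> (\<kappa> \<tau>)"
    using \<delta>(2) by eventually_elim (simp add: \<kappa>_def inv_cmp_inv groupoid_laws(5,9) st)
  from velocity_unique[OF X2 _ this] left_vec_velocity[of \<kappa> g v] \<kappa> s\<kappa>
  have "X = (\<lambda>c. - left_vec G g v c)" by (simp add: st)
  with v Yv show ?thesis by (rule that)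
qed

end

section \<open>The cotangent groupoid\<close>

lemma dual_space_linear:
  assumes "\<xi> \<in> dual_space V" "v \<in> V" "w \<in> V"
  shows "\<xi> (\<lambda>i. a *\<^sub>R v i + b *\<^sub>R w i) = a * \<xi> v + b * \<xi> w"
  using assms unfolding dual_space_def lin_on_def by blast

lemma dual_space_outside: "\<xi> \<in> dual_space V \<Longrightarrow> v \<notin> V \<Longrightarrow> \<xi> v = 0"
  unfolding dual_space_def by blast

lemma dual_space_zero:
  assumes "\<xi> \<in> dual_space V"
  shows "\<xi> (\<lambda>i. 0) = 0"
proof (cases "(\<lambda>i. 0) \<in> V")
  case True
  from dual_space_linear[OF assms True True, of 0 0] show ?thesis by simp
qed (rule dual_space_outside[OF assms])

context lie_groupoid_loc
begin

lemma cot_src_eq_cot_tgt_kernel: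
  assumes \<xi>: "\<xi> \<in> dual_space (TG G g)" and st: "s g = t h"
    and match: "cot_src G g \<xi> = cot_tgt G h \<eta>"
    and X: "X \<in> TG G g" and Y: "Y \<in> TG G h" and d: "d_src G g X = d_tgt G h Y"
    and zero: "d_cmp G g h X Y = (\<lambda>c. 0)"
  shows "\<xi> X + \<eta> Y = 0"
proof -
  obtain v where v: "v \<in> algd G (t h)" "Y = right_vec G h v" "X = (\<lambda>c. - left_vec G g v c)"
    using d_cmp_kernel[OF X Y st d zero] .
  have v': "v \<in> algd G (s g)" using v(1) st by simp
  have "\<xi> X = - \<xi> (left_vec G g v)"
    using dual_space_linear[OF \<xi> left_vec_eq_d_cmp(2)[OF v'] left_vec_eq_d_cmp(2)[OF v'], of "-1" 0]
    by (simp add: v(3))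
  also have "\<xi> (left_vec G g v) = cot_src G g \<xi> v" using v' by (simp add: cot_src_def)
  also have "\<dots> = \<eta> Y" using v(1) by (simp add: match cot_tgt_def v(2))
  finally show ?thesis by simp
qed

text \<open>
  The products \<open>X \<cdot> Y\<close> exhaust the tangent space at \<open>g h\<close>, which makes the product covector unique;
  it exists because \<open>\<xi> X + \<eta> Y\<close> vanishes on the kernel of the product, where the condition that
  the source of \<open>\<xi>\<close> is the target of \<open>\<eta>\<close> enters.
\<close>
lemma cot_cmp_characterization:
  assumes \<xi>: "\<xi> \<in> dual_space (TG G g)" and \<eta>: "\<eta> \<in> dual_space (TG G h)" and st: "s g = t h"
    and match: "cot_src G g \<xi> = cot_tgt G h \<eta>"
  shows "cot_cmp G g h \<xi> \<eta> \<in> dual_space (TG G (g \<cdot> h)) \<and>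
    (\<forall>X\<in>TG G g. \<forall>Y\<in>TG G h. d_src G g X = d_tgt G h Y \<longrightarrow>
      cot_cmp G g h \<xi> \<eta> (d_cmp G g h X Y) = \<xi> X + \<eta> Y)"
proof -
  have well: "\<xi> X + \<eta> Y = \<xi> X' + \<eta> Y'"
    if X: "X \<in> TG G g" and Y: "Y \<in> TG G h" and d: "d_src G g X = d_tgt G h Y"
      and X': "X' \<in> TG G g" and Y': "Y' \<in> TG G h" and d': "d_src G g X' = d_tgt G h Y'"
      and eq: "d_cmp G g h X Y = d_cmp G g h X' Y'" for X Y X' Y'
  proof -
    let ?X = "\<lambda>c. 1 *\<^sub>R X c + (-1) *\<^sub>R X' c" and ?Y = "\<lambda>c. 1 *\<^sub>R Y c + (-1) *\<^sub>R Y' c"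
    have "\<xi> ?X + \<eta> ?Y = 0"
    proof (rule cot_src_eq_cot_tgt_kernel[OF \<xi> st match])
      show "?X \<in> TG G g" "?Y \<in> TG G h" by (rule TG_linear_combination X X' Y Y')+
      show "d_src G g ?X = d_tgt G h ?Y"
        unfolding d_src_linear_combination d_tgt_linear_combination d d' ..
      show "d_cmp G g h ?X ?Y = (\<lambda>c. 0)"
        unfolding d_cmp_linear_combination[OF st] eq by simp
    qed
    moreover have "\<xi> ?X = 1 * \<xi> X + (-1) * \<xi> X'" by (rule dual_space_linear[OF \<xi> X X'])
    moreover have "\<eta> ?Y = 1 * \<eta> Y + (-1) * \<eta> Y'" by (rule dual_space_linear[OF \<eta> Y Y'])
    ultimately show ?thesis by simp
  qed
  have "\<forall>Z. \<exists>X Y. Z \<in> TG G (g \<cdot> h) \<longrightarrow>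
      X \<in> TG G g \<and> Y \<in> TG G h \<and> d_src G g X = d_tgt G h Y \<and> d_cmp G g h X Y = Z"
    using d_cmp_surj[OF _ st] by metis
  then obtain l r where lr: "\<And>Z. Z \<in> TG G (g \<cdot> h) \<Longrightarrow>
      l Z \<in> TG G g \<and> r Z \<in> TG G h \<and> d_src G g (l Z) = d_tgt G h (r Z) \<and> d_cmp G g h (l Z) (r Z) = Z"
    by metis
  define \<zeta> where "\<zeta> Z = (if Z \<in> TG G (g \<cdot> h) then \<xi> (l Z) + \<eta> (r Z) else 0)" for Z
  have \<zeta>: "\<zeta> (d_cmp G g h X Y) = \<xi> X + \<eta> Y"
    if X: "X \<in> TG G g" and Y: "Y \<in> TG G h" and d: "d_src G g X = d_tgt G h Y" for X Y
  proof -
    have Z: "d_cmp G g h X Y \<in> TG G (g \<cdot> h)" by (rule d_cmp_in[OF X Y st d])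
    show ?thesis unfolding \<zeta>_def using lr[OF Z] Z well[OF _ _ _ X Y d] by simp
  qed
  have "\<zeta> (\<lambda>i. a *\<^sub>R Z i + b *\<^sub>R W i) = a * \<zeta> Z + b * \<zeta> W"
    if Z: "Z \<in> TG G (g \<cdot> h)" and W: "W \<in> TG G (g \<cdot> h)" for Z W a b
  proof -
    let ?X = "\<lambda>c. a *\<^sub>R l Z c + b *\<^sub>R l W c" and ?Y = "\<lambda>c. a *\<^sub>R r Z c + b *\<^sub>R r W c"
    note z = lr[OF Z] and w = lr[OF W]
    have X: "?X \<in> TG G g" and Y: "?Y \<in> TG G h" using z w by (simp_all add: TG_linear_combination)
    have d: "d_src G g ?X = d_tgt G h ?Y"
      using z w by (simp add: d_src_linear_combination d_tgt_linear_combination)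
    have "d_cmp G g h ?X ?Y = (\<lambda>i. a *\<^sub>R Z i + b *\<^sub>R W i)"
      using z w by (simp add: d_cmp_linear_combination[OF st])
    then have "\<zeta> (\<lambda>i. a *\<^sub>R Z i + b *\<^sub>R W i) = \<xi> ?X + \<eta> ?Y" using \<zeta>[OF X Y d] by simp
    also have "\<dots> = a * \<zeta> Z + b * \<zeta> W"
      using z w dual_space_linear[OF \<xi>, of "l Z" "l W" a b] dual_space_linear[OF \<eta>, of "r Z" "r W" a b] Z W
      by (simp add: \<zeta>_def algebra_simps)
    finally show ?thesis .
  qed
  then have dual: "\<zeta> \<in> dual_space (TG G (g \<cdot> h))"
    unfolding dual_space_def lin_on_def by (simp add: \<zeta>_def)
  let ?P = "\<lambda>\<zeta>. \<zeta> \<in> dual_space (TG G (g \<cdot> h)) \<and>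
    (\<forall>X\<in>TG G g. \<forall>Y\<in>TG G h. d_src G g X = d_tgt G h Y \<longrightarrow> \<zeta> (d_cmp G g h X Y) = \<xi> X + \<eta> Y)"
  have P: "?P \<zeta>" using dual \<zeta> by simp
  have "\<zeta>' = \<zeta>" if P': "?P \<zeta>'" for \<zeta>'
  proof
    fix Z
    show "\<zeta>' Z = \<zeta> Z"
    proof (cases "Z \<in> TG G (g \<cdot> h)")
      case True
      note z = lr[OF True]
      have "\<zeta>' (d_cmp G g h (l Z) (r Z)) = \<xi> (l Z) + \<eta> (r Z)" using P' z by blast
      then show ?thesis using z True by (simp add: \<zeta>_def)
    next
      case False
      then show ?thesis using dual_space_outside[OF conjunct1[OF P'] False] by (simp add: \<zeta>_def)
    qed
  qed
  with P show ?thesis unfolding cot_cmp_def by (rule theI[of ?P \<zeta>])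
qed

lemma
  assumes \<xi>: "\<xi> \<in> dual_space (TG G g)" and \<eta>: "\<eta> \<in> dual_space (TG G h)" and st: "s g = t h"
    and match: "cot_src G g \<xi> = cot_tgt G h \<eta>"
  shows cot_src_cot_cmp: "cot_src G (g \<cdot> h) (cot_cmp G g h \<xi> \<eta>) = cot_src G h \<eta>"
    and cot_tgt_cot_cmp: "cot_tgt G (g \<cdot> h) (cot_cmp G g h \<xi> \<eta>) = cot_tgt G g \<xi>"
proof -
  note char = cot_cmp_characterization[OF assms, THEN conjunct2, rule_format]
  have "cot_cmp G g h \<xi> \<eta> (left_vec G (g \<cdot> h) u) = \<eta> (left_vec G h u)" if u: "u \<in> algd G (s h)" for u
    unfolding left_vec_cmp[OF st u] using char[OF TG_zero left_vec_eq_d_cmp(2)[OF u]]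
    by (simp add: d_src_zero left_vec_eq_d_cmp(3)[OF u] dual_space_zero[OF \<xi>])
  then show "cot_src G (g \<cdot> h) (cot_cmp G g h \<xi> \<eta>) = cot_src G h \<eta>"
    unfolding cot_src_def groupoid_laws(3)[OF st] by (simp cong: if_cong)
  have "cot_cmp G g h \<xi> \<eta> (right_vec G (g \<cdot> h) u) = \<xi> (right_vec G g u)" if u: "u \<in> algd G (t g)" for u
    unfolding right_vec_cmp[OF st u] using char[OF right_vec_eq_d_cmp(2)[OF u] TG_zero]
    by (simp add: d_tgt_zero right_vec_eq_d_cmp(3)[OF u] dual_space_zero[OF \<eta>])
  then show "cot_tgt G (g \<cdot> h) (cot_cmp G g h \<xi> \<eta>) = cot_tgt G g \<xi>"
    unfolding cot_tgt_def groupoid_laws(4)[OF st] by (simp cong: if_cong)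
qed


section \<open>The groupoid on which tensors are functions\<close>

lemma tensor_groupoid_simps:
  "(g, Xs, \<xi>s) \<in> arr (tensor_groupoid G p q) \<longleftrightarrow> length Xs = q \<and> length \<xi>s = p \<and>
    set Xs \<subseteq> TG G g \<and> set \<xi>s \<subseteq> dual_space (TG G g)"
  "src (tensor_groupoid G p q) (g, Xs, \<xi>s) = (s g, map (d_src G g) Xs, map (cot_src G g) \<xi>s)"
  "tgt (tensor_groupoid G p q) (g, Xs, \<xi>s) = (t g, map (d_tgt G g) Xs, map (cot_tgt G g) \<xi>s)"
  "cmp (tensor_groupoid G p q) (g, Xs, \<xi>s) (h, Ys, \<eta>s) =
    (g \<cdot> h, map2 (d_cmp G g h) Xs Ys, map2 (cot_cmp G g h) \<xi>s \<eta>s)"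
  "unt (tensor_groupoid G p q) (x, Vs, \<alpha>s) = (\<epsilon> x, map (d_unt G x) Vs, map (cot_unt G x) \<alpha>s)"
  by (auto simp: tensor_groupoid_def Let_def tangent_groupoid_def cotangent_groupoid_def)

lemma map_map2_fst:
  assumes "length xs = length ys" "\<And>i. i < length xs \<Longrightarrow> f (k (xs ! i) (ys ! i)) = u (xs ! i)"
  shows "map f (map2 k xs ys) = map u xs"
  using assms by (intro nth_equalityI) auto

lemma map_map2_snd:
  assumes "length xs = length ys" "\<And>i. i < length xs \<Longrightarrow> f (k (xs ! i) (ys ! i)) = u (ys ! i)"
  shows "map f (map2 k xs ys) = map u ys"
  using assms by (intro nth_equalityI) auto

lemma
  assumes \<gamma>: "\<gamma> \<in> arr (tensor_groupoid G p q)" and \<delta>: "\<delta> \<in> arr (tensor_groupoid G p q)"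
    and eq: "src (tensor_groupoid G p q) \<gamma> = tgt (tensor_groupoid G p q) \<delta>"
  shows src_tensor_cmp: "src (tensor_groupoid G p q) (cmp (tensor_groupoid G p q) \<gamma> \<delta>) =
      src (tensor_groupoid G p q) \<delta>"
    and tgt_tensor_cmp: "tgt (tensor_groupoid G p q) (cmp (tensor_groupoid G p q) \<gamma> \<delta>) =
      tgt (tensor_groupoid G p q) \<gamma>"
proof -
  obtain g Xs \<xi>s where \<gamma>': "\<gamma> = (g, Xs, \<xi>s)" by (cases \<gamma>)
  obtain h Ys \<eta>s where \<delta>': "\<delta> = (h, Ys, \<eta>s)" by (cases \<delta>)
  note a = \<gamma>[unfolded \<gamma>' tensor_groupoid_simps] and b = \<delta>[unfolded \<delta>' tensor_groupoid_simps]
  have st: "s g = t h" and X: "map (d_src G g) Xs = map (d_tgt G h) Ys"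
    and \<xi>: "map (cot_src G g) \<xi>s = map (cot_tgt G h) \<eta>s"
    using eq by (simp_all add: \<gamma>' \<delta>' tensor_groupoid_simps)
  have Xi: "Xs ! i \<in> TG G g \<and> Ys ! i \<in> TG G h \<and> d_src G g (Xs ! i) = d_tgt G h (Ys ! i)"
    if "i < length Xs" for i
  proof -
    have "Xs ! i \<in> set Xs" "Ys ! i \<in> set Ys" using that a b by simp_all
    moreover have "map (d_src G g) Xs ! i = map (d_tgt G h) Ys ! i" using X by simp
    ultimately show ?thesis using that a b by auto
  qed
  have \<xi>i: "\<xi>s ! i \<in> dual_space (TG G g) \<and> \<eta>s ! i \<in> dual_space (TG G h) \<and>
      cot_src G g (\<xi>s ! i) = cot_tgt G h (\<eta>s ! i)" if "i < length \<xi>s" for i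
  proof -
    have "\<xi>s ! i \<in> set \<xi>s" "\<eta>s ! i \<in> set \<eta>s" using that a b by simp_all
    moreover have "map (cot_src G g) \<xi>s ! i = map (cot_tgt G h) \<eta>s ! i" using \<xi> by simp
    ultimately show ?thesis using that a b by auto
  qed
  have "length Xs = length Ys" "length \<xi>s = length \<eta>s" using a b by simp_all
  then show "src (tensor_groupoid G p q) (cmp (tensor_groupoid G p q) \<gamma> \<delta>) = src (tensor_groupoid G p q) \<delta>"
    "tgt (tensor_groupoid G p q) (cmp (tensor_groupoid G p q) \<gamma> \<delta>) = tgt (tensor_groupoid G p q) \<gamma>"
    unfolding \<gamma>' \<delta>' tensor_groupoid_simps groupoid_laws(3)[OF st] groupoid_laws(4)[OF st]
    by (simp_all only: prod.inject, intro conjI refl map_map2_fst map_map2_snd;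
        simp add: Xi \<xi>i st d_src_d_cmp d_tgt_d_cmp cot_src_cot_cmp cot_tgt_cot_cmp)+
qed

end

text \<open>
  With \<open>F\<^sub>l = F - F \<circ> \<epsilon> \<circ> s\<close> one has \<open>F (g h) - F g - F h + F (\<epsilon> (s g)) = F\<^sub>l (g h) - F\<^sub>l g - F\<^sub>l h\<close>,
  since \<open>g h\<close> has the same source as \<open>h\<close>.
\<close>
lemma affine_fun_iff_multiplicative_fun_src:
  assumes "\<And>g h. g \<in> arr \<Gamma> \<Longrightarrow> h \<in> arr \<Gamma> \<Longrightarrow> src \<Gamma> g = tgt \<Gamma> h \<Longrightarrow> src \<Gamma> (cmp \<Gamma> g h) = src \<Gamma> h"
  shows "affine_fun \<Gamma> F \<longleftrightarrow> multiplicative_fun \<Gamma> (\<lambda>g. F g - F (unt \<Gamma> (src \<Gamma> g)))"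
  unfolding affine_fun_def multiplicative_fun_def using assms by (auto simp: algebra_simps)

lemma affine_fun_iff_multiplicative_fun_tgt:
  assumes "\<And>g h. g \<in> arr \<Gamma> \<Longrightarrow> h \<in> arr \<Gamma> \<Longrightarrow> src \<Gamma> g = tgt \<Gamma> h \<Longrightarrow> tgt \<Gamma> (cmp \<Gamma> g h) = tgt \<Gamma> g"
  shows "affine_fun \<Gamma> F \<longleftrightarrow> multiplicative_fun \<Gamma> (\<lambda>g. F g - F (unt \<Gamma> (tgt \<Gamma> g)))"
  unfolding affine_fun_def multiplicative_fun_def using assms by (auto simp: algebra_simps)

section \<open>Smooth families of tangent vectors\<close>

text \<open>
  A map \<open>P\<close> into the manifold with atlas \<open>B\<close>, together with tangent vectors \<open>X y\<close> at the
  points \<open>P y\<close>, is smooth near \<open>x\<close> when read in a chart \<open>c\<close> around \<open>x\<close>.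
\<close>
definition smooth_family ::
    "('a::topological_space, 'e::real_normed_vector) chart \<Rightarrow> 'a \<Rightarrow>
      ('b::topological_space, 'f::real_normed_vector) chart set \<Rightarrow> ('a \<Rightarrow> 'b) \<Rightarrow> ('a \<Rightarrow> ('b, 'f) tvec) \<Rightarrow> bool"
  where "smooth_family c x B P X \<longleftrightarrow> (\<forall>d\<in>charts_at B (P x).
    (\<forall>\<^sub>F y in nhds x. P y \<in> chart_dom d) \<and>
    smooth_at (chart_map c x) (\<lambda>u. chart_map d (P (chart_inv c u))) \<and>
    smooth_at (chart_map c x) (\<lambda>u. X (chart_inv c u) d))"

lemma smooth_familyD:
  assumes "smooth_family c x B P X" "d \<in> charts_at B (P x)"
  shows "\<forall>\<^sub>F y in nhds x. P y \<in> chart_dom d"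
    "smooth_at (chart_map c x) (\<lambda>u. chart_map d (P (chart_inv c u)))"
    "smooth_at (chart_map c x) (\<lambda>u. X (chart_inv c u) d)"
  using assms unfolding smooth_family_def by blast+

lemma smooth_family_cong:
  assumes A: "smooth_atlas A" and c: "c \<in> charts_at A x" and "smooth_family c x B P X"
    and ev: "\<forall>\<^sub>F y in nhds x. X y = Y y"
  shows "smooth_family c x B P Y"
  unfolding smooth_family_def
proof (intro ballI conjI)
  fix d assume d: "d \<in> charts_at B (P x)"
  note X = smooth_familyD[OF assms(3) d]
  show "\<forall>\<^sub>F y in nhds x. P y \<in> chart_dom d"
    "smooth_at (chart_map c x) (\<lambda>u. chart_map d (P (chart_inv c u)))" by (rule X)+
  have "\<forall>\<^sub>F u in nhds (chart_map c x). X (chart_inv c u) = Y (chart_inv c u)"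
    by (rule eventually_filterlim[OF chart_filterlim(2)[OF A c] ev])
  then have "\<forall>\<^sub>F u in nhds (chart_map c x). X (chart_inv c u) d = Y (chart_inv c u) d"
    by eventually_elim simp
  then show "smooth_at (chart_map c x) (\<lambda>u. Y (chart_inv c u) d)" by (rule smooth_at_cong[OF X(3)])
qed

lemma smooth_family_linear_combination:
  assumes "smooth_family c x B P X" "smooth_family c x B P Y"
  shows "smooth_family c x B P (\<lambda>y d. a *\<^sub>R X y d + b *\<^sub>R Y y d)"
  unfolding smooth_family_def
proof (intro ballI conjI)
  fix d assume d: "d \<in> charts_at B (P x)"
  note X = smooth_familyD[OF assms(1) d] and Y = smooth_familyD[OF assms(2) d]
  show "\<forall>\<^sub>F y in nhds x. P y \<in> chart_dom d"
    "smooth_at (chart_map c x) (\<lambda>u. chart_map d (P (chart_inv c u)))" by (rule X)+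
  show "smooth_at (chart_map c x) (\<lambda>u. a *\<^sub>R X (chart_inv c u) d + b *\<^sub>R Y (chart_inv c u) d)"
    by (intro smooth_at_add smooth_at_scaleR smooth_at_const X(3) Y(3))
qed

lemma smooth_family_ident:
  assumes A: "smooth_atlas A" and c: "c \<in> charts_at A x"
  shows "smooth_family c x A (\<lambda>y. y) (\<lambda>y d. 0)"
  unfolding smooth_family_def
proof (intro ballI conjI smooth_at_const)
  fix d assume d: "d \<in> charts_at A x"
  show "\<forall>\<^sub>F y in nhds x. y \<in> chart_dom d" by (rule eventually_chart_dom(1)[OF A d])
  show "smooth_at (chart_map c x) (\<lambda>u. chart_map d (chart_inv c u))"
    using transition_smooth_at[OF A c d] by (simp add: o_def)
qed

lemma smooth_family_coord_vec:
  assumes B: "smooth_atlas (B :: ('b::topological_space, 'f::banach) chart set)"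
    and A: "smooth_atlas A" and c: "c \<in> charts_at A x"
    and P: "smooth_family c x B P X" and d: "d \<in> charts_at B (P x)"
  shows "smooth_family c x B P (\<lambda>y. coord_vec B d (P y) w)"
  unfolding smooth_family_def
proof (intro ballI conjI)
  obtain K \<kappa> where K: "coordinate_system (K :: 'f set) \<kappa>" using smooth_atlas_coordinates[OF B] .
  fix e assume e: "e \<in> charts_at B (P x)"
  show "\<forall>\<^sub>F y in nhds x. P y \<in> chart_dom e"
    "smooth_at (chart_map c x) (\<lambda>u. chart_map e (P (chart_inv c u)))" by (rule smooth_familyD[OF P e])+
  define r where "r = chart_map e \<circ> chart_inv d"
  have r: "smooth_at (chart_map d (P (chart_inv c (chart_map c x)))) r"
    unfolding r_def chart_inv_chart[OF A c] by (rule transition_smooth_at[OF B d e])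
  have "smooth_at (chart_map c x)
      (\<lambda>u. frechet_derivative r (at (chart_map d (P (chart_inv c u)))) w)"
    by (rule smooth_at_derivative[OF K r smooth_familyD(2)[OF P d] smooth_at_const])
  moreover have "\<forall>\<^sub>F y in nhds x. P y \<in> chart_dom e" by (rule smooth_familyD[OF P e])
  then have "\<forall>\<^sub>F y in nhds x. frechet_derivative r (at (chart_map d (P y))) w = coord_vec B d (P y) w e"
    by eventually_elim (use e in \<open>simp add: coord_vec_def r_def charts_at_def\<close>)
  from eventually_filterlim[OF chart_filterlim(2)[OF A c] this]
  have "\<forall>\<^sub>F u in nhds (chart_map c x). frechet_derivative r (at (chart_map d (P (chart_inv c u)))) w =
      coord_vec B d (P (chart_inv c u)) w e" .
  ultimately show "smooth_at (chart_map c x) (\<lambda>u. coord_vec B d (P (chart_inv c u)) w e)"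
    by (rule smooth_at_cong)
qed

lemma smooth_family_filterlim:
  assumes A: "smooth_atlas A" and B: "smooth_atlas B" and c: "c \<in> charts_at A x"
    and P: "smooth_family c x B P X"
  shows "filterlim P (nhds (P x)) (nhds x)"
proof -
  obtain d where d: "d \<in> charts_at B (P x)" using charts_at_nonempty[OF B] by blast
  have "filterlim (\<lambda>u. chart_map d (P (chart_inv c u))) (nhds (chart_map d (P x))) (nhds (chart_map c x))"
    using smooth_at_tendsto[OF smooth_familyD(2)[OF P d]] by (simp add: chart_inv_chart[OF A c])
  from filterlim_compose[OF chart_filterlim(2)[OF B d] filterlim_compose[OF this chart_filterlim(1)[OF A c]]]
  have "filterlim (\<lambda>y. chart_inv d (chart_map d (P (chart_inv c (chart_map c y))))) (nhds (P x)) (nhds x)" .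
  moreover have "\<forall>\<^sub>F y in nhds x. chart_inv d (chart_map d (P (chart_inv c (chart_map c y)))) = P y"
    using smooth_familyD(1)[OF P d] eventually_chart_dom(1)[OF A c]
    by eventually_elim (simp add: chart_facts(5)[OF A charts_atD(1)[OF c]] chart_facts(5)[OF B charts_atD(1)[OF d]])
  ultimately show ?thesis using filterlim_cong by fast
qed

text \<open>
  With one local representative \<open>h\<close> of \<open>f\<close>, the coordinates of the image vectors are \<open>Dh (d (P y)) (X y)\<close>
  for all \<open>y\<close> near \<open>x\<close>.  Tangency to \<open>S\<close> is needed at each of these points, as \<open>h\<close> represents \<open>f\<close> only on \<open>S\<close>.
\<close>
lemma smooth_family_mdiff:
  assumes A: "smooth_atlas A"
    and B: "smooth_atlas (B :: ('b::topological_space, 'f::banach) chart set)"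
    and C: "smooth_atlas C"
    and c: "c \<in> charts_at A x" and X: "smooth_family c x B P X" and f: "smooth_map B C S f"
    and tangent: "\<forall>\<^sub>F y in nhds x. \<exists>\<gamma>. has_velocity B \<gamma> (P y) (X y) \<and> (\<forall>\<^sub>F \<tau> in nhds 0. \<gamma> \<tau> \<in> S)"
  shows "smooth_family c x C (\<lambda>y. f (P y)) (\<lambda>y. mdiff B C S f (P y) (X y))"
  unfolding smooth_family_def
proof (intro ballI)
  obtain K \<kappa> where K: "coordinate_system (K :: 'f set) \<kappa>" using smooth_atlas_coordinates[OF B] .
  fix e assume e: "e \<in> charts_at C (f (P x))"
  obtain d where d: "d \<in> charts_at B (P x)" using charts_at_nonempty[OF B] by blast
  have S: "P y \<in> S" if tan: "\<exists>\<gamma>. has_velocity B \<gamma> (P y) (X y) \<and> (\<forall>\<^sub>F \<tau> in nhds 0. \<gamma> \<tau> \<in> S)" for y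
  proof -
    obtain \<gamma> where \<gamma>: "has_velocity B \<gamma> (P y) (X y)" "\<forall>\<^sub>F \<tau> in nhds 0. \<gamma> \<tau> \<in> S"
      using tan by (elim exE conjE)
    show ?thesis using eventually_nhds_x_imp_x[OF \<gamma>(2)] has_velocityD(1)[OF \<gamma>(1)] by simp
  qed
  have Px: "P x \<in> S" by (rule S[OF eventually_nhds_x_imp_x[OF tangent]])
  obtain h where h: "smooth_at (chart_map d (P x)) h"
    "\<forall>\<^sub>F z in nhds (P x). z \<in> S \<longrightarrow> f z \<in> chart_dom e \<and> h (chart_map d z) = chart_map e (f z)"
    using smooth_map_germ[OF B C f Px d e] .
  note lim = smooth_family_filterlim[OF A B c X]
  let ?p = "\<lambda>u. chart_map d (P (chart_inv c u))"
  note p = smooth_familyD(2)[OF X d] and v = smooth_familyD(3)[OF X d]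
  have hx: "smooth_at (?p (chart_map c x)) h" by (simp add: chart_inv_chart[OF A c] h(1))
  have ev_h: "\<forall>\<^sub>F y in nhds x. smooth_at (chart_map d (P y)) h"
    by (rule eventually_filterlim[OF lim eventually_filterlim[OF chart_filterlim(1)[OF B d]
            smooth_at_eventually[OF h(1)]]])
  have germ: "\<forall>\<^sub>F y in nhds x. P y \<in> S \<longrightarrow> f (P y) \<in> chart_dom e \<and> h (chart_map d (P y)) = chart_map e (f (P y))"
    by (rule eventually_filterlim[OF lim h(2)])
  have near: "\<forall>\<^sub>F y in nhds x. \<forall>\<^sub>F z in nhds (P y). z \<in> S \<longrightarrow>
      f z \<in> chart_dom e \<and> h (chart_map d z) = chart_map e (f z)"
    by (rule eventually_filterlim[OF lim]) (simp only: eventually_eventually h(2))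
  have point: "\<forall>\<^sub>F y in nhds x. h (chart_map d (P y)) = chart_map e (f (P y))"
    using germ tangent
  proof eventually_elim
    case (elim y)
    show ?case using elim(1) S[OF elim(2)] by simp
  qed
  have vec: "\<forall>\<^sub>F y in nhds x. frechet_derivative h (at (chart_map d (P y))) (X y d) = mdiff B C S f (P y) (X y) e"
    using near tangent germ ev_h smooth_familyD(1)[OF X d]
  proof eventually_elim
    case (elim y)
    obtain \<gamma> where \<gamma>: "has_velocity B \<gamma> (P y) (X y)" "\<forall>\<^sub>F \<tau> in nhds 0. \<gamma> \<tau> \<in> S"
      using elim(2) by (elim exE conjE)
    have dy: "d \<in> charts_at B (P y)" using d elim(5) by (simp add: charts_at_def)
    have ey: "e \<in> charts_at C (f (P y))" using e elim(3) S[OF elim(2)] by (simp add: charts_at_def)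
    have "\<forall>\<^sub>F z in nhds (P y). z \<in> S \<longrightarrow> h (chart_map d z) = chart_map e (f z)"
      using elim(1) by eventually_elim simp
    from mdiff_germ[OF B C f \<gamma> dy ey elim(4) this] show ?case by simp
  qed
  show "(\<forall>\<^sub>F y in nhds x. f (P y) \<in> chart_dom e) \<and>
    smooth_at (chart_map c x) (\<lambda>u. chart_map e (f (P (chart_inv c u)))) \<and>
    smooth_at (chart_map c x) (\<lambda>u. mdiff B C S f (P (chart_inv c u)) (X (chart_inv c u)) e)"
  proof (intro conjI)
    show "\<forall>\<^sub>F y in nhds x. f (P y) \<in> chart_dom e"
      using germ tangent
    proof eventually_elim
      case (elim y)
      show ?case using elim(1) S[OF elim(2)] by simp
    qed
    have "smooth_at (chart_map c x) (\<lambda>u. h (?p u))" by (rule smooth_at_compose[OF K hx p])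
    then show "smooth_at (chart_map c x) (\<lambda>u. chart_map e (f (P (chart_inv c u))))"
      by (rule smooth_at_cong) (rule eventually_filterlim[OF chart_filterlim(2)[OF A c] point])
    have "smooth_at (chart_map c x) (\<lambda>u. frechet_derivative h (at (?p u)) (X (chart_inv c u) d))"
      by (rule smooth_at_derivative[OF K hx p v])
    then show "smooth_at (chart_map c x) (\<lambda>u. mdiff B C S f (P (chart_inv c u)) (X (chart_inv c u)) e)"
      by (rule smooth_at_cong) (rule eventually_filterlim[OF chart_filterlim(2)[OF A c] vec])
  qed
qed

lemma smooth_family_mdiff_UNIV:
  assumes A: "smooth_atlas A"
    and B: "smooth_atlas B"
    and C: "smooth_atlas C"
    and c: "c \<in> charts_at A x" and X: "smooth_family c x B P X" and f: "smooth_map B C UNIV f"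
    and tangent: "\<forall>\<^sub>F y in nhds x. X y \<in> tangent_space B (P y)"
  shows "smooth_family c x C (\<lambda>y. f (P y)) (\<lambda>y. mdiff B C UNIV f (P y) (X y))"
proof (rule smooth_family_mdiff[OF A B C c X f])
  show "\<forall>\<^sub>F y in nhds x. \<exists>\<gamma>. has_velocity B \<gamma> (P y) (X y) \<and> (\<forall>\<^sub>F \<tau> in nhds 0. \<gamma> \<tau> \<in> UNIV)"
    using tangent
  proof eventually_elim
    case (elim y)
    obtain \<gamma> where "has_velocity B \<gamma> (P y) (X y)" using has_velocity_exists[OF B elim] .
    then show ?case by auto
  qed
qed

lemma smooth_family_Pair:
  assumes A: "smooth_atlas A" and c: "c \<in> charts_at A x"
    and X: "smooth_family c x B P X" and Y: "smooth_family c x C Q Y"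
  shows "smooth_family c x (prod_atlas B C) (\<lambda>y. (P y, Q y)) (\<lambda>y. tan_pair B C (P y) (Q y) (X y) (Y y))"
  unfolding smooth_family_def
proof (intro ballI)
  fix e assume "e \<in> charts_at (prod_atlas B C) (P x, Q x)"
  then obtain d d' where d: "d \<in> charts_at B (P x)" and d': "d' \<in> charts_at C (Q x)" and e: "e = prod_chart d d'"
    by (rule charts_at_prod_atlasE)
  have ev: "\<forall>\<^sub>F y in nhds x. (P y, Q y) \<in> chart_dom e"
    using smooth_familyD(1)[OF X d] smooth_familyD(1)[OF Y d'] by eventually_elim (simp add: e)
  have "\<forall>\<^sub>F y in nhds x. (X y d, Y y d') = tan_pair B C (P y) (Q y) (X y) (Y y) e"
    using smooth_familyD(1)[OF X d] smooth_familyD(1)[OF Y d']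
  proof eventually_elim
    case (elim y)
    have "d \<in> charts_at B (P y)" "d' \<in> charts_at C (Q y)" using d d' elim by (simp_all add: charts_at_def)
    from tan_pair_prod_chart[OF this] show ?case by (simp add: e)
  qed
  note vec = eventually_filterlim[OF chart_filterlim(2)[OF A c] this]
  show "(\<forall>\<^sub>F y in nhds x. (P y, Q y) \<in> chart_dom e) \<and>
    smooth_at (chart_map c x) (\<lambda>u. chart_map e (P (chart_inv c u), Q (chart_inv c u))) \<and>
    smooth_at (chart_map c x) (\<lambda>u. tan_pair B C (P (chart_inv c u)) (Q (chart_inv c u))
      (X (chart_inv c u)) (Y (chart_inv c u)) e)"
  proof (intro conjI ev)
    show "smooth_at (chart_map c x) (\<lambda>u. chart_map e (P (chart_inv c u), Q (chart_inv c u)))"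
      unfolding e prod_chart_simps
      by (rule smooth_at_Pair[OF smooth_familyD(2)[OF X d] smooth_familyD(2)[OF Y d']])
    show "smooth_at (chart_map c x) (\<lambda>u. tan_pair B C (P (chart_inv c u)) (Q (chart_inv c u))
      (X (chart_inv c u)) (Y (chart_inv c u)) e)"
      by (rule smooth_at_cong[OF smooth_at_Pair[OF smooth_familyD(3)[OF X d] smooth_familyD(3)[OF Y d']] vec])
  qed
qed

section \<open>Pulling back tensor fields\<close>

lemma alternating_multilinear_slot:
  assumes "alternating_multilinear V k \<Phi>" "length vs = k" "set vs \<subseteq> V" "i < k"
  shows "lin_on V (\<lambda>v. \<Phi> (vs[i := v]))"
  using assms unfolding alternating_multilinear_def by blast

lemma alternating_multilinear_repeat:
  assumes "alternating_multilinear V k \<Phi>" "length vs = k" "set vs \<subseteq> V" "i < j" "j < k" "vs ! i = vs ! j"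
  shows "\<Phi> vs = 0"
  using assms unfolding alternating_multilinear_def by blast

lemma alternating_multilinear_slot_sum:
  assumes \<Phi>: "alternating_multilinear V k \<Phi>" and V: "lin_subspace V"
    and len: "length as + Suc (length bs) = k" and as: "set as \<subseteq> V" and bs: "set bs \<subseteq> V"
    and e: "\<And>j. j \<in> I \<Longrightarrow> e j \<in> V"
  shows "\<Phi> (as @ (\<lambda>i. \<Sum>j\<in>I. a j *\<^sub>R e j i) # bs) = (\<Sum>j\<in>I. a j * \<Phi> (as @ e j # bs))"
proof -
  have z: "(\<lambda>i. 0) \<in> V" using V by (simp add: lin_subspace_def)
  let ?vs = "as @ (\<lambda>i. 0) # bs"
  have upd: "?vs[length as := v] = as @ v # bs" for v by simp
  have "lin_on V (\<lambda>v. \<Phi> (?vs[length as := v]))"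
    by (rule alternating_multilinear_slot[OF \<Phi>]) (use len as bs z in auto)
  then have "lin_on V (\<lambda>v. \<Phi> (as @ v # bs))" unfolding upd .
  from conjunct2[OF lin_on_sum[OF this V e]] show ?thesis .
qed

lemma alternating_multilinear_pullback:
  fixes W :: "('i \<Rightarrow> 'w::real_vector) set" and V :: "('j \<Rightarrow> 'v::real_vector) set"
  assumes \<Phi>: "alternating_multilinear V k \<Phi>" and f: "\<And>w. w \<in> W \<Longrightarrow> f w \<in> V"
    and lin: "\<And>v w a b. v \<in> W \<Longrightarrow> w \<in> W \<Longrightarrow>
      f (\<lambda>i. a *\<^sub>R v i + b *\<^sub>R w i) = (\<lambda>j. a *\<^sub>R f v j + b *\<^sub>R f w j)"
  shows "alternating_multilinear W k (\<lambda>ws. \<Phi> (map f ws))"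
  unfolding alternating_multilinear_def
proof (intro conjI allI impI; elim conjE)
  fix ws :: "('i \<Rightarrow> 'w) list" and i
  assume ws: "length ws = k" "set ws \<subseteq> W" "i < k"
  have sub: "set (map f ws) \<subseteq> V" using ws(2) f by auto
  have L: "lin_on V (\<lambda>v. \<Phi> ((map f ws)[i := v]))"
    by (rule alternating_multilinear_slot[OF \<Phi>]) (use ws sub in auto)
  show "lin_on W (\<lambda>v. \<Phi> (map f (ws[i := v])))"
    unfolding lin_on_def map_update
  proof (intro ballI allI)
    fix v w a b assume "v \<in> W" "w \<in> W"
    then show "\<Phi> ((map f ws)[i := f (\<lambda>i. a *\<^sub>R v i + b *\<^sub>R w i)]) =
        a * \<Phi> ((map f ws)[i := f v]) + b * \<Phi> ((map f ws)[i := f w])"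
      unfolding lin[OF \<open>v \<in> W\<close> \<open>w \<in> W\<close>]
      using L[unfolded lin_on_def, rule_format, OF f[OF \<open>v \<in> W\<close>] f[OF \<open>w \<in> W\<close>]] by blast
  qed
next
  fix ws :: "('i \<Rightarrow> 'w) list" and i j
  assume ws: "length ws = k" "set ws \<subseteq> W" "i < j" "j < k" "ws ! i = ws ! j"
  have "set (map f ws) \<subseteq> V" using ws(2) f by auto
  moreover have "map f ws ! i = map f ws ! j" using ws by simp
  ultimately show "\<Phi> (map f ws) = 0"
    using alternating_multilinear_repeat[OF \<Phi>, of "map f ws" i j] ws(1,3,4) by simp
qed

lemma lin_subspace_dual_space: "lin_subspace (dual_space V)"
  unfolding lin_subspace_def dual_space_def lin_on_def by (auto simp: algebra_simps)

lemma coord_covec_in_dual: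
  assumes l: "linear l" and V: "lin_subspace (tangent_space A p)"
  shows "coord_covec A c p l \<in> cotangent_space A p"
  using V unfolding dual_space_def lin_on_def lin_subspace_def
  by (simp add: coord_covec_def linear_add[OF l] linear_scale[OF l])

lemma tensor_fieldD:
  assumes "tensor_field A p q F"
  shows "length \<xi>s = p \<Longrightarrow> set \<xi>s \<subseteq> cotangent_space A g \<Longrightarrow>
      alternating_multilinear (tangent_space A g) q (\<lambda>Xs. F (g, Xs, \<xi>s))"
    "length Xs = q \<Longrightarrow> set Xs \<subseteq> tangent_space A g \<Longrightarrow>
      alternating_multilinear (cotangent_space A g) p (\<lambda>\<xi>s. F (g, Xs, \<xi>s))"
    "c \<in> A \<Longrightarrow> length xs = q \<Longrightarrow> length ls = p \<Longrightarrow> \<forall>l\<in>set ls. linear l \<Longrightarrow>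
      smooth_on (chart_map c ` chart_dom c) (\<lambda>y. let g = chart_inv c y in
        F (g, map (coord_vec A c g) xs, map (coord_covec A c g) ls))"
  using assms unfolding tensor_field_def by blast+

text \<open>
  A tensor field has smooth values on vectors and covectors whose coordinates depend smoothly on
  a parameter: the vectors are expanded in the coordinate basis \<open>K\<close> and then the covectors in the
  dual basis \<open>\<kappa>\<close>, which leaves the components of the field.
\<close>
lemma smooth_at_tensor_field_families:
  fixes B :: "('b::topological_space, 'f::banach) chart set" and e :: "'y::real_normed_vector \<Rightarrow> 'b"
    and \<mu>s :: "('y \<Rightarrow> 'f \<Rightarrow> real) list"
  assumes B: "smooth_atlas B" and F: "tensor_field B p q F"
    and near: "\<forall>\<^sub>F u in nhds u0. d \<in> charts_at B (e u)" and e_smooth: "smooth_at u0 (\<lambda>u. chart_map d (e u))"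
    and "length ws = q" "\<And>w. w \<in> set ws \<Longrightarrow> smooth_at u0 w" and "length \<mu>s = p"
    and "\<And>\<mu> w. \<mu> \<in> set \<mu>s \<Longrightarrow> smooth_at u0 (\<lambda>u. \<mu> u w)" "\<And>\<mu>. \<mu> \<in> set \<mu>s \<Longrightarrow> \<forall>\<^sub>F u in nhds u0. linear (\<mu> u)"
  shows "smooth_at u0 (\<lambda>u. F (e u, map (coord_vec B d (e u)) (map (\<lambda>w. w u) ws),
    map (coord_covec B d (e u)) (map (\<lambda>\<mu>. \<mu> u) \<mu>s)))"
proof -
  note F1 = tensor_fieldD(1)[OF F] and F2 = tensor_fieldD(2)[OF F] and F3 = tensor_fieldD(3)[OF F]
  note subB = lin_subspace_tangent_space[OF B]
  have d: "d \<in> charts_at B (e u0)" by (rule eventually_nhds_x_imp_x[OF near])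
  obtain K \<kappa> where K: "coordinate_system (K :: 'f set) \<kappa>" using smooth_atlas_coordinates[OF B] .
  have fin: "finite K" and bl: "bounded_linear (\<kappa> b)" for b
    using K by (auto simp: coordinate_system_def)
  define \<Psi> where "\<Psi> u vs ms = F (e u, map (coord_vec B d (e u)) vs, map (coord_covec B d (e u)) ms)" for u vs ms
  have coord_in: "coord_vec B d (e u) w \<in> tangent_space B (e u)" if "d \<in> charts_at B (e u)" for u w
    by (rule coord_vec_in_tangent_space[OF B that])
  have covec_in: "coord_covec B d (e u) l \<in> cotangent_space B (e u)" if "linear l" for u l
    by (rule coord_covec_in_dual[OF that subB])
  have const: "smooth_at u0 (\<lambda>u. \<Psi> u vs ms)"
    if vs: "length vs = q" and ms: "length ms = p" "\<forall>l\<in>set ms. linear l" for vs ms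
  proof (rule smooth_at_cong)
    let ?f = "\<lambda>y. let g = chart_inv d y in F (g, map (coord_vec B d g) vs, map (coord_covec B d g) ms)"
    have "smooth_at (chart_map d (e u0)) ?f"
      by (rule smooth_on_eventually_imp_smooth_at[OF F3[OF charts_atD(1)[OF d] vs ms]
            eventually_chart_dom(2)[OF B eventually_nhds_x_imp_x[OF near]]])
    then show "smooth_at u0 (\<lambda>u. ?f (chart_map d (e u)))" by (rule smooth_at_compose[OF K _ e_smooth])
    show "\<forall>\<^sub>F u in nhds u0. ?f (chart_map d (e u)) = \<Psi> u vs ms"
      using near by eventually_elim (simp add: \<Psi>_def chart_inv_chart[OF B] Let_def)
  qed
  have vectors: "smooth_at u0 (\<lambda>u. \<Psi> u (map (\<lambda>v. v u) vs) ms)"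
    if vs: "length vs = q" "set vs \<subseteq> {v. smooth_at u0 v}"
      and ms: "length ms = p" "\<forall>l\<in>set ms. linear l" for vs ms
  proof (rule smooth_at_multilinear[where \<phi>="\<lambda>u vs. \<Psi> u vs ms" and e="\<lambda>b u. b"
        and a="\<lambda>v b u. \<kappa> b (v u)" and W="{v. smooth_at u0 v}", OF fin _ _ _ vs])
    show "smooth_at u0 (\<lambda>u. \<Psi> u (map (\<lambda>i. i) is) ms)" if "length is = q" for "is"
      using const[of "is" ms] that ms by simp
    show "smooth_at u0 (\<lambda>u. \<kappa> b (v u))" if "v \<in> {v. smooth_at u0 v}" for v b
      using smooth_at_bounded_linear_compose[OF bl] that by blast
    fix v :: "'y \<Rightarrow> 'f" and "is" :: "'f list" and ws :: "('y \<Rightarrow> 'f) list"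
    assume len: "length is + Suc (length ws) = q"
    show "\<forall>\<^sub>F u in nhds u0. \<Psi> u (map (\<lambda>i. i) is @ v u # map (\<lambda>w. w u) ws) ms =
        (\<Sum>b\<in>K. \<kappa> b (v u) * \<Psi> u (map (\<lambda>i. i) is @ b # map (\<lambda>w. w u) ws) ms)"
      using near
    proof eventually_elim
      case (elim u)
      have "coord_vec B d (e u) (v u) = (\<lambda>i. \<Sum>b\<in>K. \<kappa> b (v u) *\<^sub>R coord_vec B d (e u) b i)"
        by (rule ext) (rule linear_coordinates[OF K coord_vec_linear[OF B elim]])
      moreover have "set (map (coord_covec B d (e u)) ms) \<subseteq> cotangent_space B (e u)"
        using ms(2) covec_in by auto
      ultimately show ?case
        unfolding \<Psi>_def map_append list.map(2)
        using alternating_multilinear_slot_sum[OF F1 subB, of "map (coord_covec B d (e u)) ms" "e u"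
            "map (coord_vec B d (e u)) (map (\<lambda>i. i) is)"
            "map (coord_vec B d (e u)) (map (\<lambda>w. w u) ws)" K "coord_vec B d (e u)" "\<lambda>b. \<kappa> b (v u)"]
          len ms(1) coord_in[OF elim] by auto
    qed
  qed
  define W where "W = {\<mu> :: 'y \<Rightarrow> 'f \<Rightarrow> real. (\<forall>w. smooth_at u0 (\<lambda>u. \<mu> u w)) \<and> (\<forall>\<^sub>F u in nhds u0. linear (\<mu> u))}"
  \<comment> \<open>As \<open>\<kappa> b\<close> is the dual basis, the coefficient of a linear form at \<open>\<kappa> b\<close> is its value at \<open>b\<close>.\<close>
  have covectors: "smooth_at u0 (\<lambda>u. \<Psi> u (map (\<lambda>v. v u) vs) (map (\<lambda>\<mu>. \<mu> u) ms))"
    if vs: "length vs = q" "set vs \<subseteq> {v. smooth_at u0 v}" and ms: "length ms = p" "set ms \<subseteq> W" for vs ms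
  proof (rule smooth_at_multilinear[where \<phi>="\<lambda>u ms. \<Psi> u (map (\<lambda>v. v u) vs) ms" and e="\<lambda>b u. \<kappa> b"
        and a="\<lambda>\<mu> b u. \<mu> u b" and W=W, OF fin _ _ _ ms])
    have lin\<kappa>: "linear (\<kappa> b)" for b using bl by (simp add: bounded_linear.linear)
    show "smooth_at u0 (\<lambda>u. \<Psi> u (map (\<lambda>v. v u) vs) (map \<kappa> is))" if "length is = p" for "is"
      by (rule vectors[OF vs]) (use that lin\<kappa> in auto)
    show "smooth_at u0 (\<lambda>u. \<mu> u b)" if "\<mu> \<in> W" for \<mu> b using that by (simp add: W_def)
    fix \<mu> and "is" :: "'f list" and ws :: "('y \<Rightarrow> 'f \<Rightarrow> real) list"
    assume \<mu>: "\<mu> \<in> W" and ws: "set ws \<subseteq> W" and len: "length is + Suc (length ws) = p"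
    have lin_ws: "\<forall>\<^sub>F u in nhds u0. \<forall>\<nu>\<in>set ws. linear (\<nu> u)"
      using ws by (intro eventually_ball_finite) (auto simp: W_def)
    have "\<forall>\<^sub>F u in nhds u0. linear (\<mu> u)" using \<mu> by (simp add: W_def)
    with near lin_ws show "\<forall>\<^sub>F u in nhds u0.
        \<Psi> u (map (\<lambda>v. v u) vs) (map \<kappa> is @ \<mu> u # map (\<lambda>\<mu>. \<mu> u) ws) =
        (\<Sum>b\<in>K. \<mu> u b * \<Psi> u (map (\<lambda>v. v u) vs) (map \<kappa> is @ \<kappa> b # map (\<lambda>\<mu>. \<mu> u) ws))"
    proof eventually_elim
      case (elim u)
      have "coord_covec B d (e u) (\<mu> u) = (\<lambda>V. \<Sum>b\<in>K. \<mu> u b *\<^sub>R coord_covec B d (e u) (\<kappa> b) V)"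
      proof
        fix V
        have "\<mu> u (V d) = (\<Sum>b\<in>K. \<mu> u b *\<^sub>R \<kappa> b (V d))"
          unfolding linear_coordinates[OF K elim(3), of "V d"] by (simp only: real_scaleR_def mult.commute)
        then show "coord_covec B d (e u) (\<mu> u) V = (\<Sum>b\<in>K. \<mu> u b *\<^sub>R coord_covec B d (e u) (\<kappa> b) V)"
          by (cases "V \<in> tangent_space B (e u)") (simp_all add: coord_covec_def)
      qed
      moreover have "set (map (coord_vec B d (e u)) (map (\<lambda>v. v u) vs)) \<subseteq> tangent_space B (e u)"
        using coord_in[OF elim(1)] by auto
      moreover have "set (map (coord_covec B d (e u)) (map (\<lambda>\<mu>. \<mu> u) ws)) \<subseteq> cotangent_space B (e u)"
        "set (map (coord_covec B d (e u)) (map \<kappa> is)) \<subseteq> cotangent_space B (e u)"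
        using elim(2) covec_in lin\<kappa> by auto
      ultimately show ?case
        unfolding \<Psi>_def map_append list.map(2)
        using alternating_multilinear_slot_sum[OF F2 lin_subspace_dual_space,
            of "map (coord_vec B d (e u)) (map (\<lambda>v. v u) vs)" "e u"
            "map (coord_covec B d (e u)) (map \<kappa> is)"
            "map (coord_covec B d (e u)) (map (\<lambda>\<mu>. \<mu> u) ws)" K "\<lambda>b. coord_covec B d (e u) (\<kappa> b)" "\<mu> u"]
          len vs(1) covec_in[OF lin\<kappa>] by simp
    qed
  qed
  have "\<mu>s \<in> lists W" "ws \<in> lists {v. smooth_at u0 v}" using assms(6,8,9) by (auto simp: W_def)
  then have "smooth_at u0 (\<lambda>u. \<Psi> u (map (\<lambda>v. v u) ws) (map (\<lambda>\<mu>. \<mu> u) \<mu>s))"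
    by (intro covectors assms(5,7)) auto
  then show ?thesis by (simp only: \<Psi>_def)
qed

text \<open>
  A bundle map over \<open>\<epsilon>\<close> given by \<open>D\<close> on tangent vectors and by the transpose of \<open>L\<close> on covectors pulls
  tensor fields back to tensor fields.  Its components are values of
  the original field on smooth families of vectors and covectors.
\<close>
lemma tensor_field_pullback:
  fixes A :: "('a::topological_space, 'e::banach) chart set"
    and B :: "('b::topological_space, 'f::banach) chart set"
  assumes A: "smooth_atlas A" and B: "smooth_atlas B" and F: "tensor_field B p q F"
    and D_in: "\<And>g X. X \<in> tangent_space A g \<Longrightarrow> D g X \<in> tangent_space B (\<epsilon> g)"
    and D_lin: "\<And>g X Y a b. X \<in> tangent_space A g \<Longrightarrow> Y \<in> tangent_space A g \<Longrightarrow>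
      D g (\<lambda>c. a *\<^sub>R X c + b *\<^sub>R Y c) = (\<lambda>c. a *\<^sub>R D g X c + b *\<^sub>R D g Y c)"
    and D_smooth: "\<And>x c w. c \<in> charts_at A x \<Longrightarrow> smooth_family c x B \<epsilon> (\<lambda>g. D g (coord_vec A c g w))"
    and L_in: "\<And>g V. V \<in> tangent_space B (\<epsilon> g) \<Longrightarrow> L g V \<in> tangent_space A g"
    and L_lin: "\<And>g V W a b. V \<in> tangent_space B (\<epsilon> g) \<Longrightarrow> W \<in> tangent_space B (\<epsilon> g) \<Longrightarrow>
      L g (\<lambda>c. a *\<^sub>R V c + b *\<^sub>R W c) = (\<lambda>c. a *\<^sub>R L g V c + b *\<^sub>R L g W c)"
    and L_smooth: "\<And>x c d w. c \<in> charts_at A x \<Longrightarrow> d \<in> charts_at B (\<epsilon> x) \<Longrightarrow>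
      smooth_family c x A (\<lambda>g. g) (\<lambda>g. L g (coord_vec B d (\<epsilon> g) w))"
  shows "tensor_field A p q (\<lambda>(g, Xs, \<xi>s). F (\<epsilon> g, map (D g) Xs,
    map (\<lambda>\<xi> V. if V \<in> tangent_space B (\<epsilon> g) then \<xi> (L g V) else 0) \<xi>s))"
proof -
  define T :: "'a \<Rightarrow> ('a, 'e) covec \<Rightarrow> ('b, 'f) covec" where
    "T g \<xi> V = (if V \<in> tangent_space B (\<epsilon> g) then \<xi> (L g V) else 0)" for g \<xi> V
  note F1 = tensor_fieldD(1)[OF F] and F2 = tensor_fieldD(2)[OF F]
  note subA = lin_subspace_tangent_space[OF A] and subB = lin_subspace_tangent_space[OF B]
  have T_in: "T g \<xi> \<in> cotangent_space B (\<epsilon> g)" if \<xi>: "\<xi> \<in> cotangent_space A g" for g \<xi>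
    unfolding dual_space_def lin_on_def
  proof (intro CollectI conjI ballI allI impI)
    fix V W a b assume V: "V \<in> tangent_space B (\<epsilon> g)" and W: "W \<in> tangent_space B (\<epsilon> g)"
    have "(\<lambda>i. a *\<^sub>R V i + b *\<^sub>R W i) \<in> tangent_space B (\<epsilon> g)"
      using subB V W unfolding lin_subspace_def by simp
    then show "T g \<xi> (\<lambda>i. a *\<^sub>R V i + b *\<^sub>R W i) = a * T g \<xi> V + b * T g \<xi> W"
      using V W L_lin[OF V W] dual_space_linear[OF \<xi> L_in[OF V] L_in[OF W]] by (simp add: T_def)
  qed (simp add: T_def)
  have T_lin: "T g (\<lambda>V. a *\<^sub>R \<xi> V + b *\<^sub>R \<eta> V) = (\<lambda>V. a *\<^sub>R T g \<xi> V + b *\<^sub>R T g \<eta> V)" for g \<xi> \<eta> a b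
    by (simp add: T_def fun_eq_iff)
  have "tensor_field A p q (\<lambda>(g, Xs, \<xi>s). F (\<epsilon> g, map (D g) Xs, map (T g) \<xi>s))"
    unfolding tensor_field_def prod.case
  proof (intro conjI allI ballI impI; (elim conjE)?)
    fix g and \<xi>s :: "('a, 'e) covec list" assume \<xi>s: "length \<xi>s = p" "set \<xi>s \<subseteq> cotangent_space A g"
    have "set (map (T g) \<xi>s) \<subseteq> cotangent_space B (\<epsilon> g)" using \<xi>s(2) T_in by auto
    then show "alternating_multilinear (tangent_space A g) q (\<lambda>Xs. F (\<epsilon> g, map (D g) Xs, map (T g) \<xi>s))"
      using \<xi>s(1) by (intro alternating_multilinear_pullback[OF F1 D_in D_lin]) simp_all
  next
    fix g and Xs :: "('a, 'e) tvec list" assume Xs: "length Xs = q" "set Xs \<subseteq> tangent_space A g"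
    have "set (map (D g) Xs) \<subseteq> tangent_space B (\<epsilon> g)" using Xs(2) D_in by auto
    then show "alternating_multilinear (cotangent_space A g) p (\<lambda>\<xi>s. F (\<epsilon> g, map (D g) Xs, map (T g) \<xi>s))"
      using Xs(1) by (intro alternating_multilinear_pullback[OF F2 T_in T_lin]) simp_all
  next
    fix c :: "('a, 'e) chart" and xs :: "'e list" and ls :: "('e \<Rightarrow> real) list"
    assume cA: "c \<in> A" and xs: "length xs = q" and ls: "length ls = p" "\<forall>l\<in>set ls. linear l"
    show "smooth_on (chart_map c ` chart_dom c) (\<lambda>y. let g = chart_inv c y in
        F (\<epsilon> g, map (D g) (map (coord_vec A c g) xs), map (T g) (map (coord_covec A c g) ls)))"
    proof (rule smooth_onI_smooth_at)
      fix u0 assume "u0 \<in> chart_map c ` chart_dom c"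
      then obtain x where x: "x \<in> chart_dom c" "u0 = chart_map c x" by auto
      have c: "c \<in> charts_at A x" using cA x(1) by (simp add: charts_at_def)
      obtain d where d: "d \<in> charts_at B (\<epsilon> x)" using charts_at_nonempty[OF B] by blast
      obtain KA \<kappa>A where KA: "coordinate_system (KA :: 'e set) \<kappa>A" using smooth_atlas_coordinates[OF A] .
      define e where "e u = \<epsilon> (chart_inv c u)" for u
      have near: "\<forall>\<^sub>F u in nhds u0. d \<in> charts_at B (e u)"
        using eventually_filterlim[OF chart_filterlim(2)[OF A c] smooth_familyD(1)[OF D_smooth[OF c, of 0] d]]
        unfolding x(2) by eventually_elim (simp add: e_def charts_at_def charts_atD(1)[OF d])
      have e_smooth: "smooth_at u0 (\<lambda>u. chart_map d (e u))"
        unfolding x(2) e_def by (rule smooth_familyD(2)[OF D_smooth[OF c, of 0] d])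
      \<comment> \<open>coordinates in \<open>d\<close> of the images of the coordinate vectors and covectors of \<open>c\<close>\<close>
      define v where "v w u = D (chart_inv c u) (coord_vec A c (chart_inv c u) w) d" for w u
      define \<mu> where "\<mu> l u w = l (L (chart_inv c u) (coord_vec B d (e u) w) c)" for l :: "'e \<Rightarrow> real" and u w
      have v_smooth: "smooth_at u0 (v w)" for w
        unfolding v_def[abs_def] x(2) by (rule smooth_familyD(3)[OF D_smooth[OF c] d])
      have \<mu>_smooth: "smooth_at u0 (\<lambda>u. \<mu> l u w)" if "linear l" for l w
        unfolding \<mu>_def e_def x(2)
        by (rule smooth_at_bounded_linear_compose[OF linear_imp_bounded_linear_coordinates[OF KA that]
              smooth_familyD(3)[OF L_smooth[OF c d] c]])
      have \<mu>_lin: "linear (\<mu> l u)" if l: "linear l" and du: "d \<in> charts_at B (e u)" for l u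
      proof (rule linearI)
        note cl = coord_vec_linear[OF B du]
        have V: "coord_vec B d (e u) w \<in> tangent_space B (\<epsilon> (chart_inv c u))" for w
          using coord_vec_in_tangent_space[OF B du] by (simp add: e_def)
        show "\<mu> l u (w + w') = \<mu> l u w + \<mu> l u w'" for w w'
        proof -
          have "coord_vec B d (e u) (w + w') = (\<lambda>i. 1 *\<^sub>R coord_vec B d (e u) w i + 1 *\<^sub>R coord_vec B d (e u) w' i)"
            by (rule ext) (simp add: linear_add[OF cl])
          then show ?thesis
            by (simp only: \<mu>_def L_lin[OF V V]) (simp add: linear_add[OF l])
        qed
        show "\<mu> l u (r *\<^sub>R w) = r *\<^sub>R \<mu> l u w" for r w
        proof -
          have "coord_vec B d (e u) (r *\<^sub>R w) = (\<lambda>i. r *\<^sub>R coord_vec B d (e u) w i + 0 *\<^sub>R coord_vec B d (e u) w i)"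
            by (rule ext) (simp add: linear_scale[OF cl])
          then show ?thesis
            by (simp only: \<mu>_def L_lin[OF V V]) (simp add: linear_scale[OF l])
        qed
      qed
      have "\<forall>\<^sub>F u in nhds u0. linear (\<mu> l u)" if "linear l" for l
        using near by eventually_elim (rule \<mu>_lin[OF that])
      then have "smooth_at u0 (\<lambda>u. F (e u, map (coord_vec B d (e u)) (map (\<lambda>w. w u) (map v xs)),
          map (coord_covec B d (e u)) (map (\<lambda>\<mu>. \<mu> u) (map \<mu> ls))))"
        using xs ls v_smooth \<mu>_smooth by (intro smooth_at_tensor_field_families[OF B F near e_smooth]) auto
      moreover have "\<forall>\<^sub>F u in nhds u0. u \<in> chart_map c ` chart_dom c"
        unfolding x(2) by (rule eventually_chart_dom(2)[OF A c])
      with near have "\<forall>\<^sub>F u in nhds u0. F (e u, map (coord_vec B d (e u)) (map (\<lambda>w. w u) (map v xs)),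
          map (coord_covec B d (e u)) (map (\<lambda>\<mu>. \<mu> u) (map \<mu> ls))) =
        (let g = chart_inv c u in
          F (\<epsilon> g, map (D g) (map (coord_vec A c g) xs), map (T g) (map (coord_covec A c g) ls)))"
      proof eventually_elim
        case (elim u)
        define g where "g = chart_inv c u"
        have cg: "c \<in> charts_at A g"
          using elim(2) chart_facts(7)[OF A cA] cA by (simp add: g_def charts_at_def)
        have dg: "d \<in> charts_at B (\<epsilon> g)" using elim(1) by (simp add: e_def g_def)
        have "coord_vec B d (\<epsilon> g) (v w u) = D g (coord_vec A c g w)" for w
          unfolding v_def g_def[symmetric]
          by (rule coord_vec_of_coordinates[OF D_in[OF coord_vec_in_tangent_space[OF A cg]] dg])
        moreover have "coord_covec B d (\<epsilon> g) (\<mu> l u) = T g (coord_covec A c g l)" for l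
        proof
          fix V
          show "coord_covec B d (\<epsilon> g) (\<mu> l u) V = T g (coord_covec A c g l) V"
          proof (cases "V \<in> tangent_space B (\<epsilon> g)")
            case True
            then show ?thesis
              by (simp add: coord_covec_def T_def L_in \<mu>_def e_def g_def[symmetric]
                  coord_vec_of_coordinates[OF True dg])
          qed (simp add: coord_covec_def T_def)
        qed
        ultimately show ?case by (simp add: e_def g_def[symmetric] Let_def o_def)
      qed
      ultimately show "smooth_at u0 (\<lambda>u. let g = chart_inv c u in
          F (\<epsilon> g, map (D g) (map (coord_vec A c g) xs), map (T g) (map (coord_covec A c g) ls)))"
        by (rule smooth_at_cong)
    qed
  qed
  then show ?thesis by (simp add: T_def[abs_def])
qed

lemma alternating_multilinear_diff:
  assumes "alternating_multilinear V k \<Phi>" "alternating_multilinear V k \<Phi>'"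
  shows "alternating_multilinear V k (\<lambda>vs. \<Phi> vs - \<Phi>' vs)"
  using assms unfolding alternating_multilinear_def lin_on_def by (simp add: algebra_simps)

lemma tensor_field_diff:
  fixes A :: "('a::topological_space, 'e::banach) chart set"
  assumes A: "smooth_atlas A" and F: "tensor_field A p q F" and F': "tensor_field A p q F'"
  shows "tensor_field A p q (\<lambda>\<gamma>. F \<gamma> - F' \<gamma>)"
  unfolding tensor_field_def
proof (intro conjI allI ballI impI; (elim conjE)?)
  show "alternating_multilinear (tangent_space A g) q (\<lambda>Xs. F (g, Xs, \<xi>s) - F' (g, Xs, \<xi>s))"
    if "length \<xi>s = p" "set \<xi>s \<subseteq> cotangent_space A g" for g \<xi>s
    by (rule alternating_multilinear_diff[OF tensor_fieldD(1)[OF F that] tensor_fieldD(1)[OF F' that]])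
  show "alternating_multilinear (cotangent_space A g) p (\<lambda>\<xi>s. F (g, Xs, \<xi>s) - F' (g, Xs, \<xi>s))"
    if "length Xs = q" "set Xs \<subseteq> tangent_space A g" for g Xs
    by (rule alternating_multilinear_diff[OF tensor_fieldD(2)[OF F that] tensor_fieldD(2)[OF F' that]])
  fix c and xs :: "'e list" and ls :: "('e \<Rightarrow> real) list"
  assume c: "c \<in> A" and xs: "length xs = q" and ls: "length ls = p" "\<forall>l\<in>set ls. linear l"
  let ?S = "chart_map c ` chart_dom c"
  let ?k = "\<lambda>F y. let g = chart_inv c y in F (g, map (coord_vec A c g) xs, map (coord_covec A c g) ls)"
  have "smooth_on ?S (?k F)" "smooth_on ?S (?k F')"
    by (rule tensor_fieldD(3)[OF F c xs ls] tensor_fieldD(3)[OF F' c xs ls])+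
  then have "smooth_at y (\<lambda>y. ?k F y - ?k F' y)" if "y \<in> ?S" for y
    using that smooth_on_imp_smooth_at[OF _ chart_facts(2)[OF A c]] by (intro smooth_at_diff) blast+
  then show "smooth_on ?S (?k (\<lambda>\<gamma>. F \<gamma> - F' \<gamma>))"
    by (intro smooth_onI_smooth_at) (simp add: Let_def)
qed

section \<open>Translates of the base component\<close>

context lie_groupoid_loc
begin

lemma d_src_d_unt:
  assumes "V \<in> TM G x"
  shows "d_src G (\<epsilon> x) (d_unt G x V) = V"
proof -
  obtain k where k: "velocity_obj k x V"
    using has_velocity_exists[OF obj_atlas] assms unfolding TM_def by blast
  have "velocity_obj (\<lambda>\<tau>. s (\<epsilon> (k \<tau>))) x (d_src G (\<epsilon> x) (d_unt G x V))"
    using velocity_src[OF velocity_unt[OF k]] by (simp add: groupoid_laws(1))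
  then show ?thesis by (rule velocity_obj_unique[OF _ k]) (simp add: groupoid_laws(1))
qed

lemma pr_algd_eq: "pr_algd G x V = (\<lambda>c. 1 *\<^sub>R V c + (-1) *\<^sub>R d_unt G x (d_src G (\<epsilon> x) V) c)"
  by (simp add: pr_algd_def)

lemma unit_part_in:
  assumes "V \<in> TG G (\<epsilon> x)"
  shows "d_src G (\<epsilon> x) V \<in> TM G x" "d_unt G x (d_src G (\<epsilon> x) V) \<in> TG G (\<epsilon> x)"
proof -
  show *: "d_src G (\<epsilon> x) V \<in> TM G x" using d_src_in[OF assms] by (simp add: groupoid_laws(1))
  show "d_unt G x (d_src G (\<epsilon> x) V) \<in> TG G (\<epsilon> x)" by (rule d_unt_in[OF *])
qed

lemma pr_algd_in:
  assumes V: "V \<in> TG G (\<epsilon> x)"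
  shows "pr_algd G x V \<in> algd G x"
proof -
  have "pr_algd G x V \<in> TG G (\<epsilon> x)"
    unfolding pr_algd_eq by (rule TG_linear_combination[OF V unit_part_in(2)[OF V]])
  moreover have "d_src G (\<epsilon> x) (pr_algd G x V) = (\<lambda>c. 0)"
    unfolding pr_algd_eq d_src_linear_combination d_src_d_unt[OF unit_part_in(1)[OF V]] by simp
  ultimately show ?thesis by (simp add: algd_def)
qed

lemma pr_algd_linear_combination:
  "pr_algd G x (\<lambda>c. a *\<^sub>R V c + b *\<^sub>R W c) = (\<lambda>c. a *\<^sub>R pr_algd G x V c + b *\<^sub>R pr_algd G x W c)"
  unfolding pr_algd_def d_src_linear_combination d_unt_linear_combination
  by (simp add: algebra_simps)

lemma smooth_family_src:
    "c \<in> charts_at (garr G) x \<Longrightarrow> smooth_family c x (garr G) P X \<Longrightarrow> \<forall>\<^sub>F y in nhds x. X y \<in> TG G (P y) \<Longrightarrow>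
      smooth_family c x (gobj G) (\<lambda>y. s (P y)) (\<lambda>y. d_src G (P y) (X y))"
  and smooth_family_tgt:
    "c \<in> charts_at (garr G) x \<Longrightarrow> smooth_family c x (garr G) P X \<Longrightarrow> \<forall>\<^sub>F y in nhds x. X y \<in> TG G (P y) \<Longrightarrow>
      smooth_family c x (gobj G) (\<lambda>y. t (P y)) (\<lambda>y. d_tgt G (P y) (X y))"
  and smooth_family_inv:
    "c \<in> charts_at (garr G) x \<Longrightarrow> smooth_family c x (garr G) P X \<Longrightarrow> \<forall>\<^sub>F y in nhds x. X y \<in> TG G (P y) \<Longrightarrow>
      smooth_family c x (garr G) (\<lambda>y. \<iota> (P y)) (\<lambda>y. d_inv G (P y) (X y))"
  unfolding d_src_def d_tgt_def d_inv_def TG_def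
  by (rule smooth_family_mdiff_UNIV[OF arr_atlas arr_atlas obj_atlas _ _ src_smooth]
      smooth_family_mdiff_UNIV[OF arr_atlas arr_atlas obj_atlas _ _ tgt_smooth]
      smooth_family_mdiff_UNIV[OF arr_atlas arr_atlas arr_atlas _ _ inv_smooth]; assumption)+

lemma smooth_family_unt:
  "c \<in> charts_at (garr G) x \<Longrightarrow> smooth_family c x (gobj G) m V \<Longrightarrow> \<forall>\<^sub>F y in nhds x. V y \<in> TM G (m y) \<Longrightarrow>
    smooth_family c x (garr G) (\<lambda>y. \<epsilon> (m y)) (\<lambda>y. d_unt G (m y) (V y))"
  unfolding d_unt_def TM_def
  by (rule smooth_family_mdiff_UNIV[OF arr_atlas obj_atlas arr_atlas _ _ unt_smooth])

lemma smooth_family_cmp: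
  assumes c: "c \<in> charts_at (garr G) x" and X: "smooth_family c x (garr G) P X"
    and Y: "smooth_family c x (garr G) Q Y"
    and ev: "\<forall>\<^sub>F y in nhds x. X y \<in> TG G (P y) \<and> Y y \<in> TG G (Q y) \<and> s (P y) = t (Q y) \<and>
      d_src G (P y) (X y) = d_tgt G (Q y) (Y y)"
  shows "smooth_family c x (garr G) (\<lambda>y. P y \<cdot> Q y) (\<lambda>y. d_cmp G (P y) (Q y) (X y) (Y y))"
proof -
  have "\<forall>\<^sub>F y in nhds x. \<exists>\<gamma>. has_velocity (prod_atlas (garr G) (garr G)) \<gamma> (P y, Q y)
      (tan_pair (garr G) (garr G) (P y) (Q y) (X y) (Y y)) \<and> (\<forall>\<^sub>F \<tau> in nhds 0. \<gamma> \<tau> \<in> composable G)"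
    using ev
  proof eventually_elim
    case (elim y)
    then obtain \<gamma> \<delta> where \<gamma>: "velocity \<gamma> (P y) (X y)" and \<delta>: "velocity \<delta> (Q y) (Y y)"
      and st: "\<forall>\<^sub>F \<tau> in nhds 0. s (\<gamma> \<tau>) = t (\<delta> \<tau>)"
      using composable_curves[of "X y" "P y" "Y y" "Q y"] by blast
    have "\<forall>\<^sub>F \<tau> in nhds 0. (\<gamma> \<tau>, \<delta> \<tau>) \<in> composable G" using st by (simp add: composable_def)
    with has_velocity_Pair[OF arr_atlas arr_atlas \<gamma> \<delta>] show ?case by (intro exI conjI)
  qed
  from smooth_family_mdiff[OF arr_atlas pair_atlas arr_atlas c
      smooth_family_Pair[OF arr_atlas c X Y] cmp_smooth this]
  show ?thesis by (simp add: d_cmp_def)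
qed

lemma smooth_family_coord_arr:
  assumes c: "c \<in> charts_at (garr G) x"
  shows "smooth_family c x (garr G) (\<lambda>y. y) (\<lambda>y. coord_vec (garr G) c y w)"
    and "\<forall>\<^sub>F y in nhds x. coord_vec (garr G) c y w \<in> TG G y"
proof -
  show "smooth_family c x (garr G) (\<lambda>y. y) (\<lambda>y. coord_vec (garr G) c y w)"
    by (rule smooth_family_coord_vec[OF arr_atlas arr_atlas c smooth_family_ident[OF arr_atlas c] c])
  show "\<forall>\<^sub>F y in nhds x. coord_vec (garr G) c y w \<in> TG G y"
    using eventually_chart_dom(1)[OF arr_atlas c]
  proof eventually_elim
    case (elim y)
    then have "c \<in> charts_at (garr G) y" using c by (simp add: charts_at_def)
    then show ?case unfolding TG_def by (rule coord_vec_in_tangent_space[OF arr_atlas])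
  qed
qed

text \<open>
  The projection to the algebroid is \<open>V - d\<epsilon> (ds V)\<close>; the vectors with constant coordinates in a chart
  around \<open>\<epsilon> (m x)\<close> stand for an arbitrary frame along \<open>\<epsilon> \<circ> m\<close>.
\<close>
lemma smooth_family_pr_algd:
  assumes c: "c \<in> charts_at (garr G) x" and m: "smooth_family c x (garr G) (\<lambda>g. \<epsilon> (m g)) Z"
    and d: "d \<in> charts_at (garr G) (\<epsilon> (m x))"
  shows "smooth_family c x (garr G) (\<lambda>g. \<epsilon> (m g)) (\<lambda>g. pr_algd G (m g) (coord_vec (garr G) d (\<epsilon> (m g)) w))"
    and "\<forall>\<^sub>F g in nhds x. pr_algd G (m g) (coord_vec (garr G) d (\<epsilon> (m g)) w) \<in> algd G (m g)"
proof -
  define V where "V g = coord_vec (garr G) d (\<epsilon> (m g)) w" for g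
  have V: "smooth_family c x (garr G) (\<lambda>g. \<epsilon> (m g)) V"
    unfolding V_def[abs_def] by (rule smooth_family_coord_vec[OF arr_atlas arr_atlas c m d])
  have V_in: "\<forall>\<^sub>F g in nhds x. V g \<in> TG G (\<epsilon> (m g))"
    using smooth_familyD(1)[OF m d]
  proof eventually_elim
    case (elim g)
    then have "d \<in> charts_at (garr G) (\<epsilon> (m g))" using d by (simp add: charts_at_def)
    then show ?case unfolding TG_def V_def by (rule coord_vec_in_tangent_space[OF arr_atlas])
  qed
  have dV: "smooth_family c x (gobj G) m (\<lambda>g. d_src G (\<epsilon> (m g)) (V g))"
    using smooth_family_src[OF c V V_in] by (simp add: groupoid_laws(1))
  have "\<forall>\<^sub>F g in nhds x. d_src G (\<epsilon> (m g)) (V g) \<in> TM G (m g)"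
    using V_in by eventually_elim (rule unit_part_in(1))
  from smooth_family_linear_combination[OF V smooth_family_unt[OF c dV this], of 1 "-1"]
  show "smooth_family c x (garr G) (\<lambda>g. \<epsilon> (m g)) (\<lambda>g. pr_algd G (m g) (coord_vec (garr G) d (\<epsilon> (m g)) w))"
    unfolding pr_algd_eq V_def .
  show "\<forall>\<^sub>F g in nhds x. pr_algd G (m g) (coord_vec (garr G) d (\<epsilon> (m g)) w) \<in> algd G (m g)"
    using V_in unfolding V_def by eventually_elim (rule pr_algd_in)
qed

text \<open>
  The left translate is \<open>-0\<^sub>g \<cdot> d\<iota> u\<close> for the product of tangent vectors.  In this form it is the
  differential of one smooth map on composable pairs, whereas its definition takes a derivative
  on a fibre that varies with \<open>g\<close>.
\<close>
lemma smooth_family_left_vec: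
  assumes c: "c \<in> charts_at (garr G) x" and u: "smooth_family c x (garr G) (\<lambda>g. \<epsilon> (s g)) u"
    and u_in: "\<forall>\<^sub>F g in nhds x. u g \<in> algd G (s g)"
  shows "smooth_family c x (garr G) (\<lambda>g. g) (\<lambda>g. left_vec G g (u g))"
proof -
  have u_TG: "\<forall>\<^sub>F g in nhds x. u g \<in> TG G (\<epsilon> (s g))" using u_in by eventually_elim (simp add: algd_def)
  have iu: "smooth_family c x (garr G) (\<lambda>g. \<epsilon> (s g)) (\<lambda>g. d_inv G (\<epsilon> (s g)) (u g))"
    using smooth_family_inv[OF c u u_TG] by (simp add: inv_unit)
  have "\<forall>\<^sub>F g in nhds x. (\<lambda>d. 0) \<in> TG G g \<and> d_inv G (\<epsilon> (s g)) (u g) \<in> TG G (\<epsilon> (s g)) \<and>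
      s g = t (\<epsilon> (s g)) \<and> d_src G g (\<lambda>d. 0) = d_tgt G (\<epsilon> (s g)) (d_inv G (\<epsilon> (s g)) (u g))"
    using u_in
  proof eventually_elim
    case (elim g)
    obtain \<kappa> where \<kappa>: "velocity \<kappa> (\<epsilon> (s g)) (u g)" "\<forall>\<^sub>F \<tau> in nhds 0. s (\<kappa> \<tau>) = s g"
      using algd_curve[OF elim] .
    note vel = velocity_inv[OF \<kappa>(1), unfolded inv_unit]
    have "d_tgt G (\<epsilon> (s g)) (d_inv G (\<epsilon> (s g)) (u g)) = (\<lambda>c. 0)"
      by (rule d_tgt_zero_of_curve[OF vel]) (use \<kappa>(2) in eventually_elim, simp add: groupoid_laws(2,9))
    then show ?case using velocity_TG[OF vel] by (simp add: TG_zero d_src_zero groupoid_laws(2))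
  qed
  from smooth_family_cmp[OF c smooth_family_ident[OF arr_atlas c] iu this]
  have cmp: "smooth_family c x (garr G) (\<lambda>g. g)
      (\<lambda>g. d_cmp G g (\<epsilon> (s g)) (\<lambda>d. 0) (d_inv G (\<epsilon> (s g)) (u g)))"
    by (simp add: groupoid_laws(7))
  show ?thesis
  proof (rule smooth_family_cong[OF arr_atlas c smooth_family_linear_combination[OF cmp cmp, of "-1" 0]])
    show "\<forall>\<^sub>F g in nhds x. (\<lambda>d. -1 *\<^sub>R d_cmp G g (\<epsilon> (s g)) (\<lambda>d. 0) (d_inv G (\<epsilon> (s g)) (u g)) d +
        0 *\<^sub>R d_cmp G g (\<epsilon> (s g)) (\<lambda>d. 0) (d_inv G (\<epsilon> (s g)) (u g)) d) = left_vec G g (u g)"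
      using u_in by eventually_elim (simp add: left_vec_eq_d_cmp(1))
  qed
qed

lemma smooth_family_right_vec:
  assumes c: "c \<in> charts_at (garr G) x" and u: "smooth_family c x (garr G) (\<lambda>g. \<epsilon> (t g)) u"
    and u_in: "\<forall>\<^sub>F g in nhds x. u g \<in> algd G (t g)"
  shows "smooth_family c x (garr G) (\<lambda>g. g) (\<lambda>g. right_vec G g (u g))"
proof -
  have "\<forall>\<^sub>F g in nhds x. u g \<in> TG G (\<epsilon> (t g)) \<and> (\<lambda>d. 0) \<in> TG G g \<and>
      s (\<epsilon> (t g)) = t g \<and> d_src G (\<epsilon> (t g)) (u g) = d_tgt G g (\<lambda>d. 0)"
    using u_in by eventually_elim (simp add: algd_def TG_zero d_tgt_zero groupoid_laws(1))
  from smooth_family_cmp[OF c u smooth_family_ident[OF arr_atlas c] this]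
  have cmp: "smooth_family c x (garr G) (\<lambda>g. g) (\<lambda>g. d_cmp G (\<epsilon> (t g)) g (u g) (\<lambda>d. 0))"
    by (simp add: groupoid_laws(6))
  show ?thesis
  proof (rule smooth_family_cong[OF arr_atlas c cmp])
    show "\<forall>\<^sub>F g in nhds x. d_cmp G (\<epsilon> (t g)) g (u g) (\<lambda>d. 0) = right_vec G g (u g)"
      using u_in by eventually_elim (simp add: right_vec_eq_d_cmp(1))
  qed
qed

text \<open>
  The common form of the left and right translates: \<open>m\<close> and \<open>dm\<close> stand for the source or the target
  and its differential, and \<open>T\<close> for the translation of the Lie algebroid along \<open>m\<close>.  Composed with the
  inclusions of \<open>TM\<close> and \<open>A\<^sup>*\<close> at units, \<open>dm\<close> and the transpose of \<open>T\<close> form a bundle map over \<open>\<epsilon> \<circ> m\<close>.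
\<close>
lemma tensor_field_translate:
  assumes F: "tensor_field (garr G) p q F"
    and dm_in: "\<And>g X. X \<in> TG G g \<Longrightarrow> dm g X \<in> TM G (m g)"
    and dm_lin: "\<And>g X Y a b. dm g (\<lambda>c. a *\<^sub>R X c + b *\<^sub>R Y c) = (\<lambda>c. a *\<^sub>R dm g X c + b *\<^sub>R dm g Y c)"
    and dm_smooth: "\<And>c x w. c \<in> charts_at (garr G) x \<Longrightarrow>
      smooth_family c x (gobj G) m (\<lambda>g. dm g (coord_vec (garr G) c g w))"
    and T_in: "\<And>g u. u \<in> algd G (m g) \<Longrightarrow> T g u \<in> TG G g"
    and T_lin: "\<And>g u v a b. u \<in> algd G (m g) \<Longrightarrow> v \<in> algd G (m g) \<Longrightarrow>
      T g (\<lambda>c. a *\<^sub>R u c + b *\<^sub>R v c) = (\<lambda>c. a *\<^sub>R T g u c + b *\<^sub>R T g v c)"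
    and T_smooth: "\<And>c x u. c \<in> charts_at (garr G) x \<Longrightarrow> smooth_family c x (garr G) (\<lambda>g. \<epsilon> (m g)) u \<Longrightarrow>
      \<forall>\<^sub>F g in nhds x. u g \<in> algd G (m g) \<Longrightarrow> smooth_family c x (garr G) (\<lambda>g. g) (\<lambda>g. T g (u g))"
  shows "tensor_field (garr G) p q (\<lambda>(g, Xs, \<xi>s). base_component G F
    (m g, map (dm g) Xs, map (\<lambda>\<xi> u. if u \<in> algd G (m g) then \<xi> (T g u) else 0) \<xi>s))"
proof -
  have D_smooth: "smooth_family c x (garr G) (\<lambda>g. \<epsilon> (m g)) (\<lambda>g. d_unt G (m g) (dm g (coord_vec (garr G) c g w)))"
    if c: "c \<in> charts_at (garr G) x" for c x w
  proof (rule smooth_family_unt[OF c dm_smooth[OF c]])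
    show "\<forall>\<^sub>F y in nhds x. dm y (coord_vec (garr G) c y w) \<in> TM G (m y)"
      using smooth_family_coord_arr(2)[OF c] by eventually_elim (rule dm_in)
  qed
  have "tensor_field (garr G) p q (\<lambda>(g, Xs, \<xi>s). F (\<epsilon> (m g), map (\<lambda>X. d_unt G (m g) (dm g X)) Xs,
    map (\<lambda>\<xi> V. if V \<in> tangent_space (garr G) (\<epsilon> (m g)) then \<xi> (T g (pr_algd G (m g) V)) else 0) \<xi>s))"
  proof (rule tensor_field_pullback[OF arr_atlas arr_atlas F, where D="\<lambda>g X. d_unt G (m g) (dm g X)"
        and \<epsilon>="\<lambda>g. \<epsilon> (m g)" and L="\<lambda>g V. T g (pr_algd G (m g) V)"], fold TG_def)
    show "d_unt G (m g) (dm g X) \<in> TG G (\<epsilon> (m g))" if "X \<in> TG G g" for g X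
      by (rule d_unt_in[OF dm_in[OF that]])
    show "T g (pr_algd G (m g) V) \<in> TG G g" if "V \<in> TG G (\<epsilon> (m g))" for g V
      by (rule T_in[OF pr_algd_in[OF that]])
    show "T g (pr_algd G (m g) (\<lambda>c. a *\<^sub>R V c + b *\<^sub>R W c)) =
        (\<lambda>c. a *\<^sub>R T g (pr_algd G (m g) V) c + b *\<^sub>R T g (pr_algd G (m g) W) c)"
      if "V \<in> TG G (\<epsilon> (m g))" "W \<in> TG G (\<epsilon> (m g))" for g V W a b
      unfolding pr_algd_linear_combination by (rule T_lin[OF pr_algd_in[OF that(1)] pr_algd_in[OF that(2)]])
    show "smooth_family c x (garr G) (\<lambda>g. g) (\<lambda>g. T g (pr_algd G (m g) (coord_vec (garr G) d (\<epsilon> (m g)) w)))"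
      if "c \<in> charts_at (garr G) x" "d \<in> charts_at (garr G) (\<epsilon> (m x))" for x c d w
      by (rule T_smooth[OF that(1) smooth_family_pr_algd[OF that(1) D_smooth[OF that(1)] that(2)]])
  qed (simp_all add: dm_lin d_unt_linear_combination D_smooth)
  moreover have "(\<lambda>V. if V \<in> tangent_space (garr G) (\<epsilon> (m g)) then \<xi> (T g (pr_algd G (m g) V)) else 0) =
      cot_unt G (m g) (\<lambda>u. if u \<in> algd G (m g) then \<xi> (T g u) else 0)" for g \<xi>
    using pr_algd_in by (auto simp: cot_unt_def TG_def fun_eq_iff)
  ultimately show ?thesis by (simp add: base_component_def o_def)
qed

lemma tensor_field_left_tensor:
  assumes F: "tensor_field (garr G) p q F"
  shows "tensor_field (garr G) p q (left_tensor G p q (base_component G F))"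
proof -
  have eq: "left_tensor G p q (base_component G F) = (\<lambda>(g, Xs, \<xi>s). base_component G F (s g, map (d_src G g) Xs,
      map (\<lambda>\<xi> u. if u \<in> algd G (s g) then \<xi> (left_vec G g u) else 0) \<xi>s))"
    by (rule ext) (simp add: left_tensor_def tensor_groupoid_simps cot_src_def[abs_def] split: prod.split)
  show ?thesis
    unfolding eq
    by (rule tensor_field_translate[OF F, where m=s and dm="d_src G" and T="left_vec G"])
      (rule d_src_in d_src_linear_combination smooth_family_src[OF _ smooth_family_coord_arr]
        left_vec_eq_d_cmp(2) left_vec_linear_combination smooth_family_left_vec; assumption)+
qed

lemma tensor_field_right_tensor:
  assumes F: "tensor_field (garr G) p q F"
  shows "tensor_field (garr G) p q (right_tensor G p q (base_component G F))"
proof -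
  have eq: "right_tensor G p q (base_component G F) = (\<lambda>(g, Xs, \<xi>s). base_component G F (t g, map (d_tgt G g) Xs,
      map (\<lambda>\<xi> u. if u \<in> algd G (t g) then \<xi> (right_vec G g u) else 0) \<xi>s))"
    by (rule ext) (simp add: right_tensor_def tensor_groupoid_simps cot_tgt_def[abs_def] split: prod.split)
  show ?thesis
    unfolding eq
    by (rule tensor_field_translate[OF F, where m=t and dm="d_tgt G" and T="right_vec G"])
      (rule d_tgt_in d_tgt_linear_combination smooth_family_tgt[OF _ smooth_family_coord_arr]
        right_vec_eq_d_cmp(2) right_vec_linear_combination smooth_family_right_vec; assumption)+
qed

end

text \<open>The inclusions of \<open>TM\<close> and \<open>A\<^sup>*\<close> along which \<open>F\<close> is restricted are the units of the groupoid of tensors.\<close>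
lemma base_component_eq: "base_component G F = F \<circ> unt (tensor_groupoid G p q)"
  by (auto simp: base_component_def tensor_groupoid_def Let_def tangent_groupoid_def cotangent_groupoid_def)

theorem proposition5p7:
  fixes G :: "('g::topological_space, 'm::{t2_space, second_countable_topology},
               'e::banach, 'n::banach) lie_groupoid"
    and p q :: nat
    and F F_l F_r :: "('g, 'e) tensor_arr \<Rightarrow> real"
    and f :: "('g, 'm, 'e, 'n) tensor_obj \<Rightarrow> real"
  assumes "is_lie_groupoid G"
    and "tensor_field (garr G) p q F"
    and "f = base_component G F"
    and "F_l = (\<lambda>\<gamma>. F \<gamma> - left_tensor G p q f \<gamma>)"
    and "F_r = (\<lambda>\<gamma>. F \<gamma> - right_tensor G p q f \<gamma>)"
  shows "(affine_tensor G p q F \<longleftrightarrow> multiplicative_tensor G p q F_l) \<and>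
         (affine_tensor G p q F \<longleftrightarrow> multiplicative_tensor G p q F_r)"
proof -
  interpret lie_groupoid_loc G by standard (rule assms(1))
  let ?\<Gamma> = "tensor_groupoid G p q"
  have fields: "tensor_field (garr G) p q F_l" "tensor_field (garr G) p q F_r"
    unfolding assms(3-5)
    by (rule tensor_field_diff[OF arr_atlas assms(2)] tensor_field_left_tensor tensor_field_right_tensor assms(2))+
  have F_l: "F_l = (\<lambda>\<gamma>. F \<gamma> - F (unt ?\<Gamma> (src ?\<Gamma> \<gamma>)))"
    unfolding assms(3,4) left_tensor_def base_component_eq[of G F p q] by simp
  have F_r: "F_r = (\<lambda>\<gamma>. F \<gamma> - F (unt ?\<Gamma> (tgt ?\<Gamma> \<gamma>)))"
    unfolding assms(3,5) right_tensor_def base_component_eq[of G F p q] by simp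
  have "affine_fun ?\<Gamma> F \<longleftrightarrow> multiplicative_fun ?\<Gamma> F_l"
    unfolding F_l by (rule affine_fun_iff_multiplicative_fun_src) (rule src_tensor_cmp)
  moreover have "affine_fun ?\<Gamma> F \<longleftrightarrow> multiplicative_fun ?\<Gamma> F_r"
    unfolding F_r by (rule affine_fun_iff_multiplicative_fun_tgt) (rule tgt_tensor_cmp)
  ultimately show ?thesis
    using fields assms(2) unfolding affine_tensor_def multiplicative_tensor_def by blast
qed

end
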